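(* Let $A$ be a commutative ring containing $\mathbb{Q}$, let $B := A[[t_1, \ldots, t_n]]$, and let $\mathfrak{b} \subseteq B$ be the ideal generated by the variables $t_1, \ldots, t_n$. Suppose $M$ is a left $\mathcal{D}_{B/A}$-module, which is $\mathfrak{b}$-adically complete as a $B$-module. Then the canonical $\mathcal{D}_{B/A}$-module homomorphism $$B \, \widehat{\otimes}_A \, M^{\mathrm{hor}} \to M$$ is bijective.
   Context: No finiteness condition is put on $A$ or on $M$. $\mathcal{D}_{B/A}$ is the ring of $A$-linear differential operators of $B$ in the sense of Grothendieck: an operator $\theta \in \mathrm{End}_A(B)$ has differential order $\leq 0$ if it is $B$-linear, and (for $k \geq 1$) order $\leq k$ if for every $b \in B$ the operator $[b,\theta] := b \cdot \theta - \theta \cdot b$ has order $\leq k-1$; $\mathcal{D}_{B/A}$ is the subring of $\mathrm{End}_A(B)$ of all operators of finite differential order. The operators of order $\leq 0$ form the subring $B$, so a left $\mathcal{D}_{B/A}$-module is in particular a $B$-module. Let $\partial_j := \partial/\partial t_j \in \mathcal{D}_{B/A}$. A $B$-module $M$ is $\mathfrak{b}$-adically complete if the canonical homomorphism $M \to \varprojlim_i M/\mathfrak{b}^i \cdot M$ is an isomorphism. The horizontal submodule of a left $\mathcal{D}_{B/A}$-module $M$ is the $A$-module $M^{\mathrm{hor}} := \{ m \in M \mid \partial_j(m) = 0 \text{ for all } j \}$. For an $A$-module $L$, $B \, \widehat{\otimes}_A \, L$ is the $\mathfrak{b}$-adic completion of the $B$-module $B \otimes_A L$. The $B$-module $B \otimes_A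 L$ has the induced left $\mathcal{D}_{B/A}$-module structure $\theta \cdot (b \otimes l) = \theta(b) \otimes l$, and this extends by continuity to a left $\mathcal{D}_{B/A}$-module structure on $B \, \widehat{\otimes}_A \, L$. The canonical homomorphism $B \, \widehat{\otimes}_A \, M^{\mathrm{hor}} \to M$ is the $B$-linear homomorphism obtained by $\mathfrak{b}$-adic completion from $B \otimes_A M^{\mathrm{hor}} \to M$, $b \otimes m \mapsto b \cdot m$ (using that $M$ is $\mathfrak{b}$-adically complete). *)

theory Defs
  imports "HOL-Algebra.Algebra" "HOL-Algebra.Algebraic_Closure_Type"
begin

section \<open>Left modules over rings that need not be commutative\<close>

text \<open>
  The locale \<^locale>\<open>module\<close> requires a commutative ring of scalars, so left modules are
  introduced here, on the same record type.  The fields \<^const>\<open>monoid.mult\<close> and \<^const>\<open>monoid.one\<close> of a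
  module record carry no information.
\<close>

locale left_module = R?: ring R + M?: abelian_group M
  for R :: "('r, 'x) ring_scheme" (structure)
    and M :: "('r, 'm, 'y) module_scheme" (structure) +
  assumes smult_closed:
      "\<lbrakk>a \<in> carrier R; x \<in> carrier M\<rbrakk> \<Longrightarrow> a \<odot>\<^bsub>M\<^esub> x \<in> carrier M"
    and smult_l_distr:
      "\<lbrakk>a \<in> carrier R; b \<in> carrier R; x \<in> carrier M\<rbrakk> \<Longrightarrow>
        (a \<oplus>\<^bsub>R\<^esub> b) \<odot>\<^bsub>M\<^esub> x = a \<odot>\<^bsub>M\<^esub> x \<oplus>\<^bsub>M\<^esub> b \<odot>\<^bsub>M\<^esub> x"
    and smult_r_distr:
      "\<lbrakk>a \<in> carrier R; x \<in> carrier M; y \<in> carrier M\<rbrakk> \<Longrightarrow>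
        a \<odot>\<^bsub>M\<^esub> (x \<oplus>\<^bsub>M\<^esub> y) = a \<odot>\<^bsub>M\<^esub> x \<oplus>\<^bsub>M\<^esub> a \<odot>\<^bsub>M\<^esub> y"
    and smult_assoc:
      "\<lbrakk>a \<in> carrier R; b \<in> carrier R; x \<in> carrier M\<rbrakk> \<Longrightarrow>
        (a \<otimes>\<^bsub>R\<^esub> b) \<odot>\<^bsub>M\<^esub> x = a \<odot>\<^bsub>M\<^esub> (b \<odot>\<^bsub>M\<^esub> x)"
    and smult_one:
      "x \<in> carrier M \<Longrightarrow> \<one>\<^bsub>R\<^esub> \<odot>\<^bsub>M\<^esub> x = x"

definition lmodule_hom ::
    "('r, 'x) ring_scheme \<Rightarrow> ('r, 'm, 'y) module_scheme \<Rightarrow> ('r, 'n, 'z) module_scheme \<Rightarrow> ('m \<Rightarrow> 'n) set"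
  where "lmodule_hom R M N =
    {h \<in> carrier M \<rightarrow> carrier N.
      (\<forall>x\<in>carrier M. \<forall>y\<in>carrier M. h (x \<oplus>\<^bsub>M\<^esub> y) = h x \<oplus>\<^bsub>N\<^esub> h y) \<and>
      (\<forall>r\<in>carrier R. \<forall>x\<in>carrier M. h (r \<odot>\<^bsub>M\<^esub> x) = r \<odot>\<^bsub>N\<^esub> h x)}"

definition lmodule_iso ::
    "('r, 'x) ring_scheme \<Rightarrow> ('r, 'm, 'y) module_scheme \<Rightarrow> ('r, 'n, 'z) module_scheme \<Rightarrow> ('m \<Rightarrow> 'n) set"
  where "lmodule_iso R M N = {h \<in> lmodule_hom R M N. bij_betw h (carrier M) (carrier N)}"

definition restrict_scalars ::
    "('s \<Rightarrow> 'r) \<Rightarrow> ('r, 'm, 'y) module_scheme \<Rightarrow> ('s, 'm) module"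
  where "restrict_scalars f M =
    \<lparr>carrier = carrier M, monoid.mult = monoid.mult M, monoid.one = \<one>\<^bsub>M\<^esub>,
     ring.zero = \<zero>\<^bsub>M\<^esub>, ring.add = add M,
     module.smult = (\<lambda>s x. f s \<odot>\<^bsub>M\<^esub> x)\<rparr>"

definition contains_rationals :: "('a, 'x) ring_scheme \<Rightarrow> bool"
  where "contains_rationals A \<longleftrightarrow>
    (\<exists>h \<in> ring_hom (ring_of_type_algebra :: rat ring) A. inj_on h UNIV)"


section \<open>Adic completion\<close>

text \<open>The submodule \<open>I \<cdot> M\<close>: finite sums of products of elements of \<open>I\<close> and \<open>M\<close>.\<close>

definition ideal_smult :: "'b set \<Rightarrow> ('b, 'm, 'y) module_scheme \<Rightarrow> 'm set"
  where "ideal_smult I M =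
    generate (add_monoid M) {b \<odot>\<^bsub>M\<^esub> x | b x. b \<in> I \<and> x \<in> carrier M}"

text \<open>The submodule \<open>I\<^sup>i \<cdot> M\<close>, with \<open>I\<^sup>i\<close> the power in the monoid of ideals of \<open>B\<close>
  (so \<open>I\<^sup>0 = B\<close>).\<close>

definition adic_filtration ::
    "('b, 'x) ring_scheme \<Rightarrow> 'b set \<Rightarrow> ('b, 'm, 'y) module_scheme \<Rightarrow> nat \<Rightarrow> 'm set"
  where "adic_filtration B I M i = ideal_smult (I [^]\<^bsub>ideals_set B\<^esub> i) M"

definition quotient_module ::
    "('b, 'm, 'y) module_scheme \<Rightarrow> 'm set \<Rightarrow> ('b, 'm set) module"
  where "quotient_module M N =
    \<lparr>carrier = a_rcosets\<^bsub>M\<^esub> N, monoid.mult = undefined, monoid.one = undefined,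
     ring.zero = N, ring.add = set_add M,
     module.smult = (\<lambda>b S. \<Union>x\<in>S. N +>\<^bsub>M\<^esub> (b \<odot>\<^bsub>M\<^esub> x))\<rparr>"

text \<open>
  The inverse limit of the modules \<open>M / I\<^sup>i M\<close>; the transition map \<open>M / I\<^sup>j M \<rightarrow> M / I\<^sup>i M\<close>
  for \<open>i \<le> j\<close> sends a coset \<open>S\<close> to \<open>I\<^sup>i M + S\<close>.
\<close>

definition adic_completion ::
    "('b, 'x) ring_scheme \<Rightarrow> 'b set \<Rightarrow> ('b, 'm, 'y) module_scheme \<Rightarrow> ('b, nat \<Rightarrow> 'm set) module"
  where "adic_completion B I M =
    \<lparr>carrier = {x. (\<forall>i. x i \<in> carrier (quotient_module M (adic_filtration B I M i))) \<and>
                   (\<forall>i j. i \<le> j \<longrightarrow> adic_filtration B I M i <+>\<^bsub>M\<^esub> x j = x i)},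
     monoid.mult = undefined, monoid.one = undefined,
     ring.zero = (\<lambda>i. \<zero>\<^bsub>quotient_module M (adic_filtration B I M i)\<^esub>),
     ring.add = (\<lambda>x y i. x i \<oplus>\<^bsub>quotient_module M (adic_filtration B I M i)\<^esub> y i),
     module.smult = (\<lambda>b x i. b \<odot>\<^bsub>quotient_module M (adic_filtration B I M i)\<^esub> x i)\<rparr>"

definition to_completion ::
    "('b, 'x) ring_scheme \<Rightarrow> 'b set \<Rightarrow> ('b, 'm, 'y) module_scheme \<Rightarrow> 'm \<Rightarrow> nat \<Rightarrow> 'm set"
  where "to_completion B I M m = (\<lambda>i. adic_filtration B I M i +>\<^bsub>M\<^esub> m)"

definition adically_complete ::
    "('b, 'x) ring_scheme \<Rightarrow> 'b set \<Rightarrow> ('b, 'm, 'y) module_scheme \<Rightarrow> bool"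
  where "adically_complete B I M \<longleftrightarrow>
    to_completion B I M \<in> lmodule_iso B M (adic_completion B I M)"

text \<open>The map of completions induced by a \<open>B\<close>-linear map \<open>h : M \<rightarrow> N\<close>.\<close>

definition completion_map ::
    "('b, 'x) ring_scheme \<Rightarrow> 'b set \<Rightarrow> ('b, 'n, 'z) module_scheme \<Rightarrow> ('m \<Rightarrow> 'n) \<Rightarrow>
      (nat \<Rightarrow> 'm set) \<Rightarrow> nat \<Rightarrow> 'n set"
  where "completion_map B I N h x = (\<lambda>i. \<Union>m\<in>x i. adic_filtration B I N i +>\<^bsub>N\<^esub> h m)"


section \<open>Differential operators of a commutative algebra\<close>

text \<open>
  An \<open>A\<close>-algebra \<open>B\<close> is a \<^locale>\<open>module\<close> record with its ring operations and scalar
  multiplication.  Operators are extensional functions, so that operators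
  that agree on \<open>B\<close> are equal.
\<close>

definition End_ring ::
    "('a, 'x) ring_scheme \<Rightarrow> ('a, 'b, 'y) module_scheme \<Rightarrow> ('b \<Rightarrow> 'b) ring"
  where "End_ring A B =
    \<lparr>carrier = lmodule_hom A B B \<inter> extensional (carrier B),
     monoid.mult = compose (carrier B),
     monoid.one = (\<lambda>x\<in>carrier B. x),
     ring.zero = (\<lambda>x\<in>carrier B. \<zero>\<^bsub>B\<^esub>),
     ring.add = (\<lambda>\<theta> \<eta>. \<lambda>x\<in>carrier B. \<theta> x \<oplus>\<^bsub>B\<^esub> \<eta> x)\<rparr>"

definition mult_op :: "('a, 'b, 'y) module_scheme \<Rightarrow> 'b \<Rightarrow> 'b \<Rightarrow> 'b"
  where "mult_op B b = (\<lambda>x\<in>carrier B. b \<otimes>\<^bsub>B\<^esub> x)"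

primrec diff_ops ::
    "('a, 'x) ring_scheme \<Rightarrow> ('a, 'b, 'y) module_scheme \<Rightarrow> nat \<Rightarrow> ('b \<Rightarrow> 'b) set"
  where
    "diff_ops A B 0 =
      {\<theta> \<in> carrier (End_ring A B).
        \<forall>b\<in>carrier B. \<forall>x\<in>carrier B. \<theta> (b \<otimes>\<^bsub>B\<^esub> x) = b \<otimes>\<^bsub>B\<^esub> \<theta> x}"
  | "diff_ops A B (Suc k) =
      {\<theta> \<in> carrier (End_ring A B). \<forall>b\<in>carrier B.
        (mult_op B b \<otimes>\<^bsub>End_ring A B\<^esub> \<theta>) \<ominus>\<^bsub>End_ring A B\<^esub> (\<theta> \<otimes>\<^bsub>End_ring A B\<^esub> mult_op B b)
          \<in> diff_ops A B k}"

definition diff_op_ring ::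
    "('a, 'x) ring_scheme \<Rightarrow> ('a, 'b, 'y) module_scheme \<Rightarrow> ('b \<Rightarrow> 'b) ring"
  where "diff_op_ring A B = (End_ring A B)\<lparr>carrier := (\<Union>k. diff_ops A B k)\<rparr>"

definition diff_order ::
    "('a, 'x) ring_scheme \<Rightarrow> ('a, 'b, 'y) module_scheme \<Rightarrow> ('b \<Rightarrow> 'b) \<Rightarrow> nat"
  where "diff_order A B \<theta> = (LEAST k. \<theta> \<in> diff_ops A B k)"

text \<open>The \<open>B\<close>-module underlying a left module over the differential operators.\<close>

definition underlying_module ::
    "('a, 'b, 'y) module_scheme \<Rightarrow> ('b \<Rightarrow> 'b, 'm, 'z) module_scheme \<Rightarrow> ('b, 'm) module"
  where "underlying_module B M = restrict_scalars (mult_op B) M"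

text \<open>
  The completion of (the \<open>B\<close>-module underlying) a left module over the differential operators,
  with the operators acting by continuity: an operator \<open>\<theta>\<close> of order \<open>\<le> k\<close> maps
  \<open>I\<^bsup>i+k\<^esup> M\<close> into \<open>I\<^sup>i M\<close>, hence induces maps \<open>M / I\<^bsup>i+k\<^esup> M \<rightarrow> M / I\<^sup>i M\<close>.
\<close>

definition diff_completion ::
    "('a, 'x) ring_scheme \<Rightarrow> ('a, 'b, 'y) module_scheme \<Rightarrow> 'b set \<Rightarrow>
      ('b \<Rightarrow> 'b, 'm, 'z) module_scheme \<Rightarrow> ('b \<Rightarrow> 'b, nat \<Rightarrow> 'm set) module"
  where "diff_completion A B I M =
    (let C = adic_completion B I (underlying_module B M) in
    \<lparr>carrier = carrier C, monoid.mult = undefined, monoid.one = undefined,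
     ring.zero = \<zero>\<^bsub>C\<^esub>, ring.add = add C,
     module.smult = (\<lambda>\<theta> x i. \<Union>m\<in>x (i + diff_order A B \<theta>).
       adic_filtration B I (underlying_module B M) i +>\<^bsub>M\<^esub> (\<theta> \<odot>\<^bsub>M\<^esub> m))\<rparr>)"


section \<open>Tensor products\<close>

text \<open>Generators of the subgroup of relations in the free abelian group on \<open>N \<times> L\<close>.\<close>

definition tensor_relations ::
    "('a, 'x) ring_scheme \<Rightarrow> ('a, 'n, 'y) module_scheme \<Rightarrow> ('a, 'l, 'z) module_scheme \<Rightarrow>
      ('n \<times> 'l \<Rightarrow>\<^sub>0 int) set"
  where "tensor_relations A N L =
    {frag_of (x \<oplus>\<^bsub>N\<^esub> y, l) - (frag_of (x, l) + frag_of (y, l)) | x y l.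
        x \<in> carrier N \<and> y \<in> carrier N \<and> l \<in> carrier L} \<union>
    {frag_of (x, l \<oplus>\<^bsub>L\<^esub> m) - (frag_of (x, l) + frag_of (x, m)) | x l m.
        x \<in> carrier N \<and> l \<in> carrier L \<and> m \<in> carrier L} \<union>
    {frag_of (a \<odot>\<^bsub>N\<^esub> x, l) - frag_of (x, a \<odot>\<^bsub>L\<^esub> l) | a x l.
        a \<in> carrier A \<and> x \<in> carrier N \<and> l \<in> carrier L}"

definition tensor_kernel ::
    "('a, 'x) ring_scheme \<Rightarrow> ('a, 'n, 'y) module_scheme \<Rightarrow> ('a, 'l, 'z) module_scheme \<Rightarrow>
      ('n \<times> 'l \<Rightarrow>\<^sub>0 int) set"
  where "tensor_kernel A N L =
    generate (free_Abelian_group (carrier N \<times> carrier L)) (tensor_relations A N L)"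

text \<open>
  \<open>N \<otimes>\<^sub>A L\<close>, as a module over the \<open>A\<close>-linear operators of \<open>N\<close>, which act by
  \<open>\<theta> \<cdot> (x \<otimes> l) = \<theta>(x) \<otimes> l\<close>.
\<close>

definition tensor_product ::
    "('a, 'x) ring_scheme \<Rightarrow> ('a, 'n, 'y) module_scheme \<Rightarrow> ('a, 'l, 'z) module_scheme \<Rightarrow>
      ('n \<Rightarrow> 'n, ('n \<times> 'l \<Rightarrow>\<^sub>0 int) set) module"
  where "tensor_product A N L =
    (let F = free_Abelian_group (carrier N \<times> carrier L); K = tensor_kernel A N L in
    \<lparr>carrier = carrier (F Mod K), monoid.mult = undefined, monoid.one = undefined,
     ring.zero = \<one>\<^bsub>F Mod K\<^esub>, ring.add = monoid.mult (F Mod K),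
     module.smult = (\<lambda>\<theta> S. \<Union>u\<in>S. K #>\<^bsub>F\<^esub> frag_extend (\<lambda>(x, l). frag_of (\<theta> x, l)) u)\<rparr>)"

text \<open>For a \<open>B\<close>-module \<open>M\<close>, the additive map \<open>b \<otimes> m \<mapsto> b \<cdot> m\<close> on cosets of formal sums.\<close>

definition tensor_eval ::
    "('b, 'm, 'y) module_scheme \<Rightarrow> ('b \<times> 'm \<Rightarrow>\<^sub>0 int) set \<Rightarrow> 'm"
  where "tensor_eval M S =
    the_elem ((\<lambda>u. \<Oplus>\<^bsub>M\<^esub>p\<in>Poly_Mapping.keys u.
      [Poly_Mapping.lookup u p] \<cdot>\<^bsub>M\<^esub> (fst p \<odot>\<^bsub>M\<^esub> snd p)) ` S)"


section \<open>Power series in finitely many variables\<close>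

text \<open>Exponents of monomials in the variables \<open>t\<^sub>0, \<dots>, t\<^bsub>n-1\<^esub>\<close>.\<close>

definition exponents :: "nat \<Rightarrow> (nat \<Rightarrow> nat) set"
  where "exponents n = {\<alpha>. \<forall>j\<ge>n. \<alpha> j = 0}"

definition power_series ::
    "('a, 'x) ring_scheme \<Rightarrow> nat \<Rightarrow> ('a, (nat \<Rightarrow> nat) \<Rightarrow> 'a) module"
  where "power_series A n =
    \<lparr>carrier = exponents n \<rightarrow>\<^sub>E carrier A,
     monoid.mult = (\<lambda>f g. \<lambda>\<alpha>\<in>exponents n.
       \<Oplus>\<^bsub>A\<^esub>\<beta>\<in>{\<beta>. \<forall>j. \<beta> j \<le> \<alpha> j}. f \<beta> \<otimes>\<^bsub>A\<^esub> g (\<lambda>j. \<alpha> j - \<beta> j)),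
     monoid.one = (\<lambda>\<alpha>\<in>exponents n. if \<alpha> = (\<lambda>_. 0) then \<one>\<^bsub>A\<^esub> else \<zero>\<^bsub>A\<^esub>),
     ring.zero = (\<lambda>\<alpha>\<in>exponents n. \<zero>\<^bsub>A\<^esub>),
     ring.add = (\<lambda>f g. \<lambda>\<alpha>\<in>exponents n. f \<alpha> \<oplus>\<^bsub>A\<^esub> g \<alpha>),
     module.smult = (\<lambda>a f. \<lambda>\<alpha>\<in>exponents n. a \<otimes>\<^bsub>A\<^esub> f \<alpha>)\<rparr>"

definition variable :: "('a, 'x) ring_scheme \<Rightarrow> nat \<Rightarrow> nat \<Rightarrow> (nat \<Rightarrow> nat) \<Rightarrow> 'a"
  where "variable A n j =
    (\<lambda>\<alpha>\<in>exponents n. if \<alpha> = (\<lambda>_. 0)(j := 1) then \<one>\<^bsub>A\<^esub> else \<zero>\<^bsub>A\<^esub>)"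

definition variable_ideal :: "('a, 'x) ring_scheme \<Rightarrow> nat \<Rightarrow> ((nat \<Rightarrow> nat) \<Rightarrow> 'a) set"
  where "variable_ideal A n = Idl\<^bsub>power_series A n\<^esub> (variable A n ` {..<n})"

definition partial ::
    "('a, 'x) ring_scheme \<Rightarrow> nat \<Rightarrow> nat \<Rightarrow> ((nat \<Rightarrow> nat) \<Rightarrow> 'a) \<Rightarrow> (nat \<Rightarrow> nat) \<Rightarrow> 'a"
  where "partial A n j =
    (\<lambda>f\<in>carrier (power_series A n). \<lambda>\<alpha>\<in>exponents n.
      [Suc (\<alpha> j)] \<cdot>\<^bsub>A\<^esub> f (\<alpha>(j := Suc (\<alpha> j))))"


section \<open>Horizontal elements and the canonical homomorphism\<close>

text \<open>The scalar \<open>a\<close> in \<open>A\<close> acts through the operator of multiplication by \<open>a \<cdot> 1\<^sub>B\<close>.\<close>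

definition horizontal_module ::
    "('a, 'x) ring_scheme \<Rightarrow> nat \<Rightarrow>
      (((nat \<Rightarrow> nat) \<Rightarrow> 'a) \<Rightarrow> ((nat \<Rightarrow> nat) \<Rightarrow> 'a), 'm, 'z) module_scheme \<Rightarrow> ('a, 'm) module"
  where "horizontal_module A n M =
    (restrict_scalars
      (\<lambda>a. mult_op (power_series A n) (a \<odot>\<^bsub>power_series A n\<^esub> \<one>\<^bsub>power_series A n\<^esub>)) M)
    \<lparr>carrier := {m \<in> carrier M. \<forall>j<n. partial A n j \<odot>\<^bsub>M\<^esub> m = \<zero>\<^bsub>M\<^esub>}\<rparr>"

definition completed_tensor ::
    "('a, 'x) ring_scheme \<Rightarrow> nat \<Rightarrow> ('a, 'l, 'z) module_scheme \<Rightarrow>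
      (((nat \<Rightarrow> nat) \<Rightarrow> 'a) \<Rightarrow> ((nat \<Rightarrow> nat) \<Rightarrow> 'a),
       nat \<Rightarrow> (((nat \<Rightarrow> nat) \<Rightarrow> 'a) \<times> 'l \<Rightarrow>\<^sub>0 int) set set) module"
  where "completed_tensor A n L =
    diff_completion A (power_series A n) (variable_ideal A n)
      (tensor_product A (power_series A n) L)"

text \<open>
  The map \<open>B \<otimes>\<^sub>A M\<^bsup>hor\<^esup> \<rightarrow> M\<close> is completed, and the completion of \<open>M\<close> is identified with \<open>M\<close> by the
  inverse of the canonical map; this is meaningful only for complete \<open>M\<close>.
\<close>

definition canonical_hom ::
    "('a, 'x) ring_scheme \<Rightarrow> nat \<Rightarrow>
      (((nat \<Rightarrow> nat) \<Rightarrow> 'a) \<Rightarrow> ((nat \<Rightarrow> nat) \<Rightarrow> 'a), 'm, 'z) module_scheme \<Rightarrow>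
      (nat \<Rightarrow> (((nat \<Rightarrow> nat) \<Rightarrow> 'a) \<times> 'm \<Rightarrow>\<^sub>0 int) set set) \<Rightarrow> 'm"
  where "canonical_hom A n M x =
    (let B = power_series A n; I = variable_ideal A n; N = underlying_module B M in
      inv_into (carrier N) (to_completion B I N) (completion_map B I N (tensor_eval N) x))"

end

theory Submission
  imports Defs
begin

text \<open>
  Write \<open>F\<^sup>i = b\<^sup>i M\<close>.  The Euler operator \<open>E = \<Sum> t\<^sub>j \<partial>\<^sub>j\<close> acts on \<open>F\<^sup>i / F\<^bsup>i+1\<^esup>\<close> as
  multiplication by \<open>i\<close>, which is invertible for \<open>i > 0\<close>; this holds for \<open>M\<close> and for \<open>B \<otimes> M\<^bsup>hor\<^esup>\<close>.
  If every \<open>\<partial>\<^sub>j s\<close> lies in \<open>F\<^sup>k\<close>, then for \<open>s' = s - E s / (k + 1)\<close> every \<open>\<partial>\<^sub>j s'\<close> lies in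
  \<open>F\<^bsup>k+1\<^esup>\<close>, so by completeness \<open>M = M\<^bsup>hor\<^esup> + F\<^sup>1\<close>, and \<open>B \<otimes> M\<^bsup>hor\<^esup> \<rightarrow> M / F\<^sup>i\<close> is onto for all \<open>i\<close>.
  Conversely, if \<open>u\<close> in \<open>B \<otimes> M\<^bsup>hor\<^esup>\<close> maps into \<open>F\<^bsup>i+1\<^esup>\<close>, then by induction \<open>u\<close> and all \<open>\<partial>\<^sub>j u\<close> lie
  in \<open>b\<^sup>i (B \<otimes> M\<^bsup>hor\<^esup>)\<close>, so \<open>E u\<close> and, since \<open>E u \<equiv> i u\<close>, also \<open>u\<close> lie in \<open>b\<^bsup>i+1\<^esup> (B \<otimes> M\<^bsup>hor\<^esup>)\<close>;
  the case \<open>i = 0\<close> is \<open>M\<^bsup>hor\<^esup> \<inter> F\<^sup>1 = 0\<close>, again by \<open>E\<close>.  Linearity over all differential operators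
  amounts to \<open>\<theta> l = \<theta>(1) l\<close> for horizontal \<open>l\<close>, which follows by induction on the order of \<open>\<theta>\<close>
  from an analogue of \<open>E\<close> on operators, \<open>\<theta> \<mapsto> \<Sum> [t\<^sub>j, \<theta>] \<partial>\<^sub>j\<close>.
\<close>

section \<open>The ring of power series\<close>

text \<open>Nothing is known about M^hor as an A-module, so B \<otimes> M^hor has no basis to
  compute in, and its completion is never identified with power series over M^hor. All work takes
  place with representatives in B \<otimes> M^hor and with the two adic filtrations. The horizontal
  part of m is classically the Taylor series \<Sum> (-t)^\<alpha> / \<alpha>! \<partial>^\<alpha> m;
  the corrections by E reach the same element one degree at a time, without multi-indices, and the
  same eigenvalue argument serves M and B \<otimes> M^hor alike. The eigenvalue vanishes in degree
  0, which is why an element has to be placed in F^1 before the argument can push it further. The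
  second obstacle is linearity over operators that are given only by their order, not as polynomials
  in the \<partial>_j. Their commutators with the variables suffice, but B is generated by the
  variables only in the topological sense; that an operator commuting with all t_j is a
  multiplication has to be forced by comparing degrees in B.\<close>

lemma (in abelian_monoid) finsum_Sigma:
  assumes "finite I" "\<And>i. i \<in> I \<Longrightarrow> finite (S i)"
    and "\<And>i x. \<lbrakk>i \<in> I; x \<in> S i\<rbrakk> \<Longrightarrow> f i x \<in> carrier G"
  shows "(\<Oplus>i\<in>I. \<Oplus>x\<in>S i. f i x) = (\<Oplus>p\<in>Sigma I S. f (fst p) (snd p))"
proof -
  have U: "Sigma I S = (\<Union>i\<in>I. Pair i ` S i)" by auto
  have "(\<Oplus>p\<in>Sigma I S. f (fst p) (snd p)) = (\<Oplus>i\<in>I. \<Oplus>p\<in>Pair i ` S i. f (fst p) (snd p))"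
    unfolding U
    by (rule add.finprod_UN_disjoint) (use assms in \<open>auto simp: pairwise_def disjnt_def\<close>)
  also have "\<dots> = (\<Oplus>i\<in>I. \<Oplus>x\<in>S i. f i x)"
  proof (intro finsum_cong')
    fix i assume i: "i \<in> I"
    have "(\<Oplus>p\<in>Pair i ` S i. f (fst p) (snd p)) = (\<Oplus>x\<in>S i. f (fst (i,x)) (snd (i,x)))"
      by (rule finsum_reindex) (use assms i in \<open>auto simp: inj_on_def\<close>)
    then show "(\<Oplus>p\<in>Pair i ` S i. f (fst p) (snd p)) = (\<Oplus>x\<in>S i. f i x)" by simp
  qed (use assms in auto)
  finally show ?thesis by simp
qed

lemma finite_exponents_below:
  assumes "\<alpha> \<in> exponents n"
  shows "finite {\<beta>. \<forall>j. \<beta> j \<le> \<alpha> j}"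
proof (rule finite_subset)
  show "{\<beta>. \<forall>j. \<beta> j \<le> \<alpha> j} \<subseteq>
      {f. \<forall>x. (x \<in> {..<n} \<longrightarrow> f x \<in> (\<Union>j<n. {..\<alpha> j})) \<and> (x \<notin> {..<n} \<longrightarrow> f x = 0)}"
  proof clarify
    fix \<beta> x assume \<beta>: "\<forall>j. \<beta> j \<le> \<alpha> j"
    have "\<beta> x \<in> (\<Union>j<n. {..\<alpha> j})" if "x < n" using \<beta> that by auto
    moreover have "\<beta> x = 0" if "\<not> x < n"
    proof -
      have "\<alpha> x = 0" using assms that by (simp add: exponents_def)
      then show ?thesis using \<beta>[rule_format, of x] by simp
    qed
    ultimately show "(x \<in> {..<n} \<longrightarrow> \<beta> x \<in> (\<Union>j<n. {..\<alpha> j})) \<and> (x \<notin> {..<n} \<longrightarrow> \<beta> x = 0)"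
      by auto
  qed
  show "finite {f. \<forall>x. (x \<in> {..<n} \<longrightarrow> f x \<in> (\<Union>j<n. {..\<alpha> j})) \<and> (x \<notin> {..<n} \<longrightarrow> f x = (0::nat))}"
    by (rule finite_set_of_finite_funs) auto
qed

lemma exponents_mono: "\<lbrakk>\<alpha> \<in> exponents n; \<And>j. \<beta> j \<le> \<alpha> j\<rbrakk> \<Longrightarrow> \<beta> \<in> exponents n"
proof -
  assume \<alpha>: "\<alpha> \<in> exponents n" and \<beta>: "\<And>j. \<beta> j \<le> \<alpha> j"
  have "\<beta> j = 0" if "n \<le> j" for j
    using \<alpha> that \<beta>[of j] by (simp add: exponents_def)
  then show ?thesis by (simp add: exponents_def)
qed

lemma exponents_upd: "\<lbrakk>\<alpha> \<in> exponents n; j < n\<rbrakk> \<Longrightarrow> \<alpha>(j := k) \<in> exponents n"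
  by (auto simp: exponents_def)

lemma exponents_zero: "(\<lambda>_. 0) \<in> exponents n"
  by (auto simp: exponents_def)

locale power_series_ring = cring A for A :: "('a, 'x) ring_scheme" (structure) +
  fixes n :: nat
begin

abbreviation B where "B \<equiv> power_series A n"
abbreviation below :: "(nat \<Rightarrow> nat) \<Rightarrow> (nat \<Rightarrow> nat) set" where "below \<alpha> \<equiv> {\<beta>. \<forall>j. \<beta> j \<le> \<alpha> j}"

lemma below_exponents: "\<lbrakk>\<alpha> \<in> exponents n; \<beta> \<in> below \<alpha>\<rbrakk> \<Longrightarrow> \<beta> \<in> exponents n"
  by (auto intro: exponents_mono)

lemma diff_exponents: "\<alpha> \<in> exponents n \<Longrightarrow> (\<lambda>j. \<alpha> j - \<beta> j) \<in> exponents n"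
  by (auto intro: exponents_mono)

lemma power_series_coeff: "\<lbrakk>f \<in> carrier B; \<alpha> \<in> exponents n\<rbrakk> \<Longrightarrow> f \<alpha> \<in> carrier A"
  by (auto simp: power_series_def)

lemma power_series_eqI:
  "\<lbrakk>f \<in> carrier B; g \<in> carrier B; \<And>\<alpha>. \<alpha> \<in> exponents n \<Longrightarrow> f \<alpha> = g \<alpha>\<rbrakk> \<Longrightarrow> f = g"
  by (auto simp: power_series_def intro: PiE_ext)

lemma power_series_carrierI:
  "(\<And>\<alpha>. \<alpha> \<in> exponents n \<Longrightarrow> f \<alpha> \<in> carrier A) \<Longrightarrow> (\<lambda>\<alpha>\<in>exponents n. f \<alpha>) \<in> carrier B"
  by (auto simp: power_series_def)

lemma power_series_mult_coeff:
  "\<alpha> \<in> exponents n \<Longrightarrow> (f \<otimes>\<^bsub>B\<^esub> g) \<alpha> = (\<Oplus>\<beta>\<in>below \<alpha>. f \<beta> \<otimes> g (\<lambda>j. \<alpha> j - \<beta> j))"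
  by (simp add: power_series_def)

lemma power_series_add_coeff: "\<alpha> \<in> exponents n \<Longrightarrow> (f \<oplus>\<^bsub>B\<^esub> g) \<alpha> = f \<alpha> \<oplus> g \<alpha>"
  and power_series_zero_coeff: "\<alpha> \<in> exponents n \<Longrightarrow> \<zero>\<^bsub>B\<^esub> \<alpha> = \<zero>"
  and power_series_one_coeff:
    "\<alpha> \<in> exponents n \<Longrightarrow> \<one>\<^bsub>B\<^esub> \<alpha> = (if \<alpha> = (\<lambda>_. 0) then \<one> else \<zero>)"
  and power_series_smult_coeff: "\<alpha> \<in> exponents n \<Longrightarrow> (a \<odot>\<^bsub>B\<^esub> f) \<alpha> = a \<otimes> f \<alpha>"
  by (simp_all add: power_series_def)

section \<open>The convolution product of power series\<close>

lemma conv_closed: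
  assumes "f \<in> carrier B" "g \<in> carrier B" "\<alpha> \<in> exponents n"
  shows "(\<lambda>\<beta>. f \<beta> \<otimes> g (\<lambda>j. \<alpha> j - \<beta> j)) \<in> below \<alpha> \<rightarrow> carrier A"
  using power_series_coeff[OF assms(1) below_exponents[OF assms(3)]]
    power_series_coeff[OF assms(2) diff_exponents[OF assms(3)]] by blast

lemma power_series_closed:
  shows "\<lbrakk>f \<in> carrier B; g \<in> carrier B\<rbrakk> \<Longrightarrow> f \<oplus>\<^bsub>B\<^esub> g \<in> carrier B"
    and "\<lbrakk>f \<in> carrier B; g \<in> carrier B\<rbrakk> \<Longrightarrow> f \<otimes>\<^bsub>B\<^esub> g \<in> carrier B"
    and "\<zero>\<^bsub>B\<^esub> \<in> carrier B" and "\<one>\<^bsub>B\<^esub> \<in> carrier B"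
    and "\<lbrakk>a \<in> carrier A; f \<in> carrier B\<rbrakk> \<Longrightarrow> a \<odot>\<^bsub>B\<^esub> f \<in> carrier B"
proof -
  show "f \<otimes>\<^bsub>B\<^esub> g \<in> carrier B" if "f \<in> carrier B" "g \<in> carrier B"
    using finsum_closed[OF conv_closed[OF that]] by (simp add: power_series_def PiE_iff)
qed (simp_all add: power_series_def PiE_iff)

text \<open>The reflection \<beta> \<mapsto> \<alpha> - \<beta> permutes the exponents below
  \<alpha>. It gives commutativity of the product, and in the Leibniz rule it exchanges the two
  factors together with their weights.\<close>

lemma conv_flip:
  assumes \<alpha>: "\<alpha> \<in> exponents n" and F: "\<And>\<beta>. \<beta> \<in> below \<alpha> \<Longrightarrow> F \<beta> \<in> carrier A"
  shows "(\<Oplus>\<beta>\<in>below \<alpha>. F \<beta>) = (\<Oplus>\<beta>\<in>below \<alpha>. F (\<lambda>j. \<alpha> j - \<beta> j))"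
proof -
  have im: "below \<alpha> = (\<lambda>\<beta> j. \<alpha> j - \<beta> j) ` below \<alpha>"
  proof (intro equalityI subsetI)
    fix \<beta> assume "\<beta> \<in> below \<alpha>"
    then show "\<beta> \<in> (\<lambda>\<beta> j. \<alpha> j - \<beta> j) ` below \<alpha>"
      by (intro image_eqI[of _ _ "\<lambda>j. \<alpha> j - \<beta> j"]) auto
  qed auto
  have "(\<Oplus>\<beta>\<in>(\<lambda>\<beta> j. \<alpha> j - \<beta> j) ` below \<alpha>. F \<beta>) = (\<Oplus>\<beta>\<in>below \<alpha>. F (\<lambda>j. \<alpha> j - \<beta> j))"
  proof (rule finsum_reindex)
    show "inj_on (\<lambda>\<beta> j. \<alpha> j - \<beta> j) (below \<alpha>)"
    proof (rule inj_onI, rule ext)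
      fix \<beta> \<gamma> j assume "\<beta> \<in> below \<alpha>" "\<gamma> \<in> below \<alpha>" "(\<lambda>j. \<alpha> j - \<beta> j) = (\<lambda>j. \<alpha> j - \<gamma> j)"
      then have "\<alpha> j - \<beta> j = \<alpha> j - \<gamma> j" "\<beta> j \<le> \<alpha> j" "\<gamma> j \<le> \<alpha> j" by (auto dest: fun_cong)
      then show "\<beta> j = \<gamma> j" by arith
    qed
  qed (use F in auto)
  then show ?thesis using im by simp
qed

lemma power_series_mult_comm:
  assumes f: "f \<in> carrier B" and g: "g \<in> carrier B"
  shows "f \<otimes>\<^bsub>B\<^esub> g = g \<otimes>\<^bsub>B\<^esub> f"
proof (rule power_series_eqI)
  fix \<alpha> assume \<alpha>: "\<alpha> \<in> exponents n"
  have "(\<Oplus>\<beta>\<in>below \<alpha>. f \<beta> \<otimes> g (\<lambda>j. \<alpha> j - \<beta> j))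
      = (\<Oplus>\<beta>\<in>below \<alpha>. f (\<lambda>j. \<alpha> j - \<beta> j) \<otimes> g (\<lambda>j. \<alpha> j - (\<alpha> j - \<beta> j)))"
    by (rule conv_flip) (use conv_closed[OF f g \<alpha>] \<alpha> in auto)
  also have "\<dots> = (\<Oplus>\<beta>\<in>below \<alpha>. g \<beta> \<otimes> f (\<lambda>j. \<alpha> j - \<beta> j))"
  proof (rule finsum_cong')
    fix \<beta> assume \<beta>: "\<beta> \<in> below \<alpha>"
    then have "(\<lambda>j. \<alpha> j - (\<alpha> j - \<beta> j)) = \<beta>" by auto
    then show "f (\<lambda>j. \<alpha> j - \<beta> j) \<otimes> g (\<lambda>j. \<alpha> j - (\<alpha> j - \<beta> j)) = g \<beta> \<otimes> f (\<lambda>j. \<alpha> j - \<beta> j)"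
      using f g \<alpha> \<beta> by (simp add: m_comm power_series_coeff below_exponents diff_exponents)
  qed (use conv_closed[OF g f \<alpha>] in auto)
  finally show "(f \<otimes>\<^bsub>B\<^esub> g) \<alpha> = (g \<otimes>\<^bsub>B\<^esub> f) \<alpha>"
    using \<alpha> by (simp add: power_series_mult_coeff)
qed (use assms power_series_closed in auto)

text \<open>Both sides are sums of
  \<open>f \<gamma> \<otimes> g \<delta> \<otimes> h \<epsilon>\<close> over all \<gamma> + \<delta>
  + \<epsilon> = \<alpha>. The left one indexes the triples by (\<gamma> + \<delta>, \<gamma>), the
  right one by (\<gamma>, \<delta>), and \<open>?h\<close> passes from the second indexing to the
  first.\<close>

lemma power_series_mult_assoc:
  assumes f: "f \<in> carrier B" and g: "g \<in> carrier B" and h: "h \<in> carrier B"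
  shows "(f \<otimes>\<^bsub>B\<^esub> g) \<otimes>\<^bsub>B\<^esub> h = f \<otimes>\<^bsub>B\<^esub> (g \<otimes>\<^bsub>B\<^esub> h)"
proof (rule power_series_eqI)
  fix \<alpha> assume \<alpha>: "\<alpha> \<in> exponents n"
  let ?d = "\<lambda>\<alpha> \<beta> j. \<alpha> j - \<beta> j :: nat"
  let ?T = "\<lambda>\<gamma> \<delta> \<epsilon>. f \<gamma> \<otimes> g \<delta> \<otimes> h \<epsilon>"
  note c = power_series_coeff[OF f] power_series_coeff[OF g] power_series_coeff[OF h]
  note e1 = below_exponents[OF \<alpha>]
  note e2 = below_exponents[OF below_exponents[OF \<alpha>]]
  note e3 = below_exponents[OF diff_exponents[OF \<alpha>]]
  note d = diff_exponents[OF \<alpha>] diff_exponents[OF e1] diff_exponents[OF diff_exponents[OF \<alpha>]]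
  note fin = finite_exponents_below[OF \<alpha>] finite_exponents_below[OF e1]
    finite_exponents_below[OF diff_exponents[OF \<alpha>]]
  have fg: "(f \<otimes>\<^bsub>B\<^esub> g) \<beta> \<otimes> h (?d \<alpha> \<beta>) = (\<Oplus>\<gamma>\<in>below \<beta>. ?T \<gamma> (?d \<beta> \<gamma>) (?d \<alpha> \<beta>))"
    if \<beta>: "\<beta> \<in> below \<alpha>" for \<beta>
    unfolding power_series_mult_coeff[OF e1[OF \<beta>]]
    by (rule finsum_ldistr[OF fin(2)[OF \<beta>] c(3)[OF d(1)] conv_closed[OF f g e1[OF \<beta>]]])
  have gh: "f \<gamma> \<otimes> (g \<otimes>\<^bsub>B\<^esub> h) (?d \<alpha> \<gamma>) = (\<Oplus>\<delta>\<in>below (?d \<alpha> \<gamma>). ?T \<gamma> \<delta> (?d (?d \<alpha> \<gamma>) \<delta>))"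
    if \<gamma>: "\<gamma> \<in> below \<alpha>" for \<gamma>
  proof -
    have "f \<gamma> \<otimes> (g \<otimes>\<^bsub>B\<^esub> h) (?d \<alpha> \<gamma>)
        = (\<Oplus>\<delta>\<in>below (?d \<alpha> \<gamma>). f \<gamma> \<otimes> (g \<delta> \<otimes> h (?d (?d \<alpha> \<gamma>) \<delta>)))"
      unfolding power_series_mult_coeff[OF d(1)]
      by (rule finsum_rdistr[OF fin(3) c(1)[OF e1[OF \<gamma>]] conv_closed[OF g h d(1)]])
    also have "\<dots> = (\<Oplus>\<delta>\<in>below (?d \<alpha> \<gamma>). ?T \<gamma> \<delta> (?d (?d \<alpha> \<gamma>) \<delta>))"
    proof (rule finsum_cong')
      have cl: "f \<gamma> \<in> carrier A" "g \<delta> \<in> carrier A" "h (?d (?d \<alpha> \<gamma>) \<delta>) \<in> carrier A"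
        if "\<delta> \<in> below (?d \<alpha> \<gamma>)" for \<delta>
        using c(1)[OF e1[OF \<gamma>]] c(2)[OF e3[OF that]] c(3)[OF d(3)] .
      show "(\<lambda>\<delta>. ?T \<gamma> \<delta> (?d (?d \<alpha> \<gamma>) \<delta>)) \<in> below (?d \<alpha> \<gamma>) \<rightarrow> carrier A"
        using cl by blast
      show "f \<gamma> \<otimes> (g \<delta> \<otimes> h (?d (?d \<alpha> \<gamma>) \<delta>)) = ?T \<gamma> \<delta> (?d (?d \<alpha> \<gamma>) \<delta>)"
        if "\<delta> \<in> below (?d \<alpha> \<gamma>)" for \<delta>
        using m_assoc[OF cl[OF that]] by simp
    qed simp
    finally show ?thesis .
  qed
  have T: "?T \<gamma> (?d \<beta> \<gamma>) (?d \<alpha> \<beta>) \<in> carrier A" if "\<beta> \<in> below \<alpha>" "\<gamma> \<in> below \<beta>" for \<beta> \<gamma>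
    using c(1)[OF e2[OF that]] c(2)[OF d(2)[OF that(1)]] c(3)[OF d(1)] by blast
  have T': "?T \<gamma> \<delta> (?d (?d \<alpha> \<gamma>) \<delta>) \<in> carrier A" if "\<gamma> \<in> below \<alpha>" "\<delta> \<in> below (?d \<alpha> \<gamma>)" for \<gamma> \<delta>
    using c(1)[OF e1[OF that(1)]] c(2)[OF e3[OF that(2)]] c(3)[OF d(3)] by blast
  let ?h = "\<lambda>p. (\<lambda>j. fst p j + snd p j, fst p)"
  let ?S = "Sigma (below \<alpha>) (\<lambda>\<gamma>. below (?d \<alpha> \<gamma>))"
  have im: "Sigma (below \<alpha>) below = ?h ` ?S"
  proof (intro equalityI subsetI)
    fix p assume p: "p \<in> Sigma (below \<alpha>) below"
    obtain \<beta> \<gamma> where [simp]: "p = (\<beta>, \<gamma>)" by (cases p)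
    from p have *: "\<And>j. \<beta> j \<le> \<alpha> j" "\<And>j. \<gamma> j \<le> \<beta> j" by auto
    then have "\<And>j. \<gamma> j \<le> \<alpha> j" using order_trans by blast
    with * show "p \<in> ?h ` ?S"
      by (intro image_eqI[of _ _ "(\<gamma>, ?d \<beta> \<gamma>)"]) (simp_all add: diff_le_mono)
  next
    fix p assume "p \<in> ?h ` ?S"
    then obtain \<gamma> \<delta> where *: "p = (\<lambda>j. \<gamma> j + \<delta> j, \<gamma>)" "\<And>j. \<gamma> j \<le> \<alpha> j" "\<And>j. \<delta> j \<le> \<alpha> j - \<gamma> j"
      by auto
    have "\<gamma> j + \<delta> j \<le> \<alpha> j" for j using *(2)[of j] *(3)[of j] by arith
    then show "p \<in> Sigma (below \<alpha>) below" using * by simp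
  qed
  have "((f \<otimes>\<^bsub>B\<^esub> g) \<otimes>\<^bsub>B\<^esub> h) \<alpha> = (\<Oplus>\<beta>\<in>below \<alpha>. \<Oplus>\<gamma>\<in>below \<beta>. ?T \<gamma> (?d \<beta> \<gamma>) (?d \<alpha> \<beta>))"
    unfolding power_series_mult_coeff[OF \<alpha>, of _ h]
    by (rule finsum_cong') (use fg T in \<open>auto intro!: finsum_closed\<close>)
  also have "\<dots> = (\<Oplus>p\<in>Sigma (below \<alpha>) below. ?T (snd p) (?d (fst p) (snd p)) (?d \<alpha> (fst p)))"
    by (rule finsum_Sigma[OF fin(1,2) T])
  also have "\<dots> = (\<Oplus>p\<in>?S. ?T (snd (?h p)) (?d (fst (?h p)) (snd (?h p))) (?d \<alpha> (fst (?h p))))"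
    unfolding im
  proof (rule finsum_reindex)
    show "(\<lambda>p. ?T (snd p) (?d (fst p) (snd p)) (?d \<alpha> (fst p))) \<in> ?h ` ?S \<rightarrow> carrier A"
      unfolding im[symmetric] using T by auto
    show "inj_on ?h ?S" by (auto simp: inj_on_def fun_eq_iff)
  qed
  also have "\<dots> = (\<Oplus>p\<in>?S. ?T (fst p) (snd p) (?d (?d \<alpha> (fst p)) (snd p)))"
    by (simp add: diff_diff_left)
  also have "\<dots> = (\<Oplus>\<gamma>\<in>below \<alpha>. \<Oplus>\<delta>\<in>below (?d \<alpha> \<gamma>). ?T \<gamma> \<delta> (?d (?d \<alpha> \<gamma>) \<delta>))"
    by (rule finsum_Sigma[symmetric, OF fin(1,3) T'])
  also have "\<dots> = (f \<otimes>\<^bsub>B\<^esub> (g \<otimes>\<^bsub>B\<^esub> h)) \<alpha>"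
    unfolding power_series_mult_coeff[OF \<alpha>, of f]
    by (rule finsum_cong') (use gh conv_closed[OF f power_series_closed(2)[OF g h] \<alpha>] in auto)
  finally show "((f \<otimes>\<^bsub>B\<^esub> g) \<otimes>\<^bsub>B\<^esub> h) \<alpha> = (f \<otimes>\<^bsub>B\<^esub> (g \<otimes>\<^bsub>B\<^esub> h)) \<alpha>" .
qed (use assms power_series_closed in auto)

end

section \<open>Power series as a commutative ring and as an algebra over the coefficients\<close>

context power_series_ring begin

lemma power_series_abelian_group: "abelian_group B"
proof (rule abelian_groupI)
  fix f assume f: "f \<in> carrier B"
  show "\<exists>g\<in>carrier B. g \<oplus>\<^bsub>B\<^esub> f = \<zero>\<^bsub>B\<^esub>"
  proof
    show g: "(\<lambda>\<alpha>\<in>exponents n. \<ominus> f \<alpha>) \<in> carrier B"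
      by (rule power_series_carrierI) (simp add: power_series_coeff[OF f])
    show "(\<lambda>\<alpha>\<in>exponents n. \<ominus> f \<alpha>) \<oplus>\<^bsub>B\<^esub> f = \<zero>\<^bsub>B\<^esub>"
      by (rule power_series_eqI)
        (use f g power_series_coeff[OF f] in \<open>simp_all add: power_series_closed power_series_add_coeff power_series_zero_coeff l_neg\<close>)
  qed
qed (auto intro!: power_series_eqI simp: power_series_closed power_series_add_coeff
      power_series_zero_coeff power_series_coeff a_ac)

lemma power_series_cring: "cring B"
proof (rule cringI[OF power_series_abelian_group])
  have one: "\<one>\<^bsub>B\<^esub> \<otimes>\<^bsub>B\<^esub> f = f" if f: "f \<in> carrier B" for f
  proof (rule power_series_eqI)
    fix \<alpha> assume \<alpha>: "\<alpha> \<in> exponents n"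
    have "(\<one>\<^bsub>B\<^esub> \<otimes>\<^bsub>B\<^esub> f) \<alpha> = (\<Oplus>\<beta>\<in>below \<alpha>. if \<beta> = (\<lambda>_. 0) then f (\<lambda>j. \<alpha> j - \<beta> j) else \<zero>)"
      unfolding power_series_mult_coeff[OF \<alpha>]
      by (rule finsum_cong')
        (auto simp: power_series_one_coeff below_exponents[OF \<alpha>] power_series_coeff[OF f] diff_exponents[OF \<alpha>])
    also have "\<dots> = f (\<lambda>j. \<alpha> j - 0)"
      by (rule add.finprod_singleton_swap)
        (auto simp: finite_exponents_below[OF \<alpha>] power_series_coeff[OF f] diff_exponents[OF \<alpha>])
    finally show "(\<one>\<^bsub>B\<^esub> \<otimes>\<^bsub>B\<^esub> f) \<alpha> = f \<alpha>" by simp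
  qed (use f power_series_closed in auto)
  show "comm_monoid B"
    by (rule comm_monoidI)
      (simp_all add: power_series_closed power_series_mult_assoc one, rule power_series_mult_comm)
  fix f g h assume fgh: "f \<in> carrier B" "g \<in> carrier B" "h \<in> carrier B"
  show "(f \<oplus>\<^bsub>B\<^esub> g) \<otimes>\<^bsub>B\<^esub> h = f \<otimes>\<^bsub>B\<^esub> h \<oplus>\<^bsub>B\<^esub> g \<otimes>\<^bsub>B\<^esub> h"
  proof (rule power_series_eqI)
    fix \<alpha> assume \<alpha>: "\<alpha> \<in> exponents n"
    note c = power_series_coeff[OF _ below_exponents[OF \<alpha>]] power_series_coeff[OF _ diff_exponents[OF \<alpha>]]
    have "((f \<oplus>\<^bsub>B\<^esub> g) \<otimes>\<^bsub>B\<^esub> h) \<alpha> =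
      (\<Oplus>\<beta>\<in>below \<alpha>. f \<beta> \<otimes> h (\<lambda>j. \<alpha> j - \<beta> j) \<oplus> g \<beta> \<otimes> h (\<lambda>j. \<alpha> j - \<beta> j))"
      unfolding power_series_mult_coeff[OF \<alpha>]
      by (rule finsum_cong')
        (use fgh c in \<open>auto simp: power_series_add_coeff[OF below_exponents[OF \<alpha>]] l_distr\<close>)
    then show "((f \<oplus>\<^bsub>B\<^esub> g) \<otimes>\<^bsub>B\<^esub> h) \<alpha> = (f \<otimes>\<^bsub>B\<^esub> h \<oplus>\<^bsub>B\<^esub> g \<otimes>\<^bsub>B\<^esub> h) \<alpha>"
      using conv_closed[OF fgh(1,3) \<alpha>] conv_closed[OF fgh(2,3) \<alpha>]
      by (simp add: power_series_add_coeff[OF \<alpha>] power_series_mult_coeff[OF \<alpha>] finsum_addf)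
  qed (use fgh power_series_closed in auto)
qed

sublocale B: cring "power_series A n"
  by (rule power_series_cring)

lemma power_series_smult_mult:
  assumes a: "a \<in> carrier A" and f: "f \<in> carrier B" and g: "g \<in> carrier B"
  shows "(a \<odot>\<^bsub>B\<^esub> f) \<otimes>\<^bsub>B\<^esub> g = a \<odot>\<^bsub>B\<^esub> (f \<otimes>\<^bsub>B\<^esub> g)"
proof (rule power_series_eqI)
  fix \<alpha> assume \<alpha>: "\<alpha> \<in> exponents n"
  note c = power_series_coeff[OF _ below_exponents[OF \<alpha>]] power_series_coeff[OF _ diff_exponents[OF \<alpha>]]
  have "((a \<odot>\<^bsub>B\<^esub> f) \<otimes>\<^bsub>B\<^esub> g) \<alpha> = (\<Oplus>\<beta>\<in>below \<alpha>. a \<otimes> (f \<beta> \<otimes> g (\<lambda>j. \<alpha> j - \<beta> j)))"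
    unfolding power_series_mult_coeff[OF \<alpha>]
    by (rule finsum_cong')
      (use a f g c in \<open>auto simp: power_series_smult_coeff[OF below_exponents[OF \<alpha>]] m_assoc\<close>)
  then show "((a \<odot>\<^bsub>B\<^esub> f) \<otimes>\<^bsub>B\<^esub> g) \<alpha> = (a \<odot>\<^bsub>B\<^esub> (f \<otimes>\<^bsub>B\<^esub> g)) \<alpha>"
    using finsum_rdistr[OF finite_exponents_below[OF \<alpha>] a conv_closed[OF f g \<alpha>]]
    by (simp add: power_series_smult_coeff[OF \<alpha>] power_series_mult_coeff[OF \<alpha>])
qed (use assms power_series_closed in auto)

lemma power_series_algebra: "algebra A B"
proof (rule algebraI)
  show "cring A" by (rule is_cring)
qed (use power_series_smult_mult in \<open>auto intro!: power_series_eqI simp: power_series_cring power_series_closed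
     power_series_add_coeff power_series_smult_coeff power_series_coeff l_distr r_distr m_assoc\<close>)

sublocale B: algebra A "power_series A n"
  by (rule power_series_algebra)

lemma power_series_finsum_coeff:
  assumes "F \<in> S \<rightarrow> carrier B" and \<alpha>: "\<alpha> \<in> exponents n"
  shows "(\<Oplus>\<^bsub>B\<^esub>i\<in>S. F i) \<alpha> = (\<Oplus>i\<in>S. F i \<alpha>)"
  using assms(1)
proof (induction S rule: infinite_finite_induct)
  case (insert x S)
  then have "(\<lambda>i. F i \<alpha>) \<in> S \<rightarrow> carrier A" using power_series_coeff[OF _ \<alpha>] by auto
  with insert show ?case
    by (simp add: power_series_add_coeff[OF \<alpha>] power_series_coeff[OF _ \<alpha>] Pi_iff)
qed (simp_all add: power_series_zero_coeff[OF \<alpha>])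

section \<open>The variables and the ideal they generate\<close>

lemma variable_closed: "variable A n j \<in> carrier B"
  unfolding variable_def by (rule power_series_carrierI) simp

lemma variable_mult_coeff:
  assumes f: "f \<in> carrier B" and \<alpha>: "\<alpha> \<in> exponents n" and j: "j < n"
  shows "(variable A n j \<otimes>\<^bsub>B\<^esub> f) \<alpha> = (if \<alpha> j = 0 then \<zero> else f (\<alpha>(j := \<alpha> j - 1)))"
proof -
  let ?e = "(\<lambda>_. 0)(j := 1::nat)"
  have e: "?e \<in> exponents n" using j by (auto simp: exponents_def)
  have eq: "(variable A n j \<otimes>\<^bsub>B\<^esub> f) \<alpha> =
      (\<Oplus>\<beta>\<in>below \<alpha>. if \<beta> = ?e then f (\<lambda>j. \<alpha> j - \<beta> j) else \<zero>)"
    unfolding power_series_mult_coeff[OF \<alpha>]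
    by (rule finsum_cong')
      (auto simp: variable_def below_exponents[OF \<alpha>] power_series_coeff[OF f] diff_exponents[OF \<alpha>])
  show ?thesis
  proof (cases "\<alpha> j = 0")
    case True
    then have "?e \<notin> below \<alpha>" by auto
    then have "(\<Oplus>\<beta>\<in>below \<alpha>. if \<beta> = ?e then f (\<lambda>j. \<alpha> j - \<beta> j) else \<zero>) = (\<Oplus>\<beta>\<in>below \<alpha>. \<zero>)"
      by (intro finsum_cong') auto
    with eq True show ?thesis by simp
  next
    case False
    then have "?e \<in> below \<alpha>" by auto
    then have "(\<Oplus>\<beta>\<in>below \<alpha>. if \<beta> = ?e then f (\<lambda>j. \<alpha> j - \<beta> j) else \<zero>) = f (\<lambda>k. \<alpha> k - ?e k)"
      by (rule add.finprod_singleton_swap)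
        (auto simp: finite_exponents_below[OF \<alpha>] power_series_coeff[OF f] diff_exponents[OF \<alpha>])
    moreover have "(\<lambda>k. \<alpha> k - ?e k) = \<alpha>(j := \<alpha> j - 1)" by auto
    ultimately show ?thesis using eq False by simp
  qed
qed

lemma power_series_decomp:
  assumes f: "f \<in> carrier B"
  obtains g where "\<And>j. g j \<in> carrier B"
    "f = f (\<lambda>_. 0) \<odot>\<^bsub>B\<^esub> \<one>\<^bsub>B\<^esub> \<oplus>\<^bsub>B\<^esub> (\<Oplus>\<^bsub>B\<^esub>j\<in>{..<n}. variable A n j \<otimes>\<^bsub>B\<^esub> g j)"
proof -
  \<comment> \<open>Every monomial \<open>\<noteq> 1\<close> is divided by the first variable that occurs in it.\<close>
  define g where "g = (\<lambda>j. \<lambda>\<alpha>\<in>exponents n.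
    if j < n \<and> (\<forall>i<j. \<alpha> i = 0) then f (\<alpha>(j := Suc (\<alpha> j))) else \<zero>)"
  have g: "g j \<in> carrier B" for j
    unfolding g_def by (rule power_series_carrierI) (simp add: exponents_upd power_series_coeff[OF f])
  have f0: "f (\<lambda>_. 0) \<in> carrier A" using power_series_coeff[OF f exponents_zero] .
  have tg: "(\<lambda>j. variable A n j \<otimes>\<^bsub>B\<^esub> g j) \<in> {..<n} \<rightarrow> carrier B"
    using g variable_closed by auto
  have "f = f (\<lambda>_. 0) \<odot>\<^bsub>B\<^esub> \<one>\<^bsub>B\<^esub> \<oplus>\<^bsub>B\<^esub> (\<Oplus>\<^bsub>B\<^esub>j\<in>{..<n}. variable A n j \<otimes>\<^bsub>B\<^esub> g j)"
  proof (rule power_series_eqI)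
    fix \<alpha> assume \<alpha>: "\<alpha> \<in> exponents n"
    have tgj: "(variable A n j \<otimes>\<^bsub>B\<^esub> g j) \<alpha> = (if \<alpha> j \<noteq> 0 \<and> (\<forall>i<j. \<alpha> i = 0) then f \<alpha> else \<zero>)"
      if j: "j < n" for j
    proof -
      have "\<alpha>(j := \<alpha> j - 1) \<in> exponents n" by (rule exponents_upd[OF \<alpha> j])
      moreover have "(\<alpha>(j := \<alpha> j - 1))(j := Suc ((\<alpha>(j := \<alpha> j - 1)) j)) = \<alpha>" if "\<alpha> j \<noteq> 0"
        using that by auto
      ultimately show ?thesis
        unfolding variable_mult_coeff[OF g \<alpha> j] using j by (auto simp: g_def)
    qed
    have "(\<Oplus>\<^bsub>B\<^esub>j\<in>{..<n}. variable A n j \<otimes>\<^bsub>B\<^esub> g j) \<alpha>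
        = (\<Oplus>j\<in>{..<n}. if \<alpha> j \<noteq> 0 \<and> (\<forall>i<j. \<alpha> i = 0) then f \<alpha> else \<zero>)"
      unfolding power_series_finsum_coeff[OF tg \<alpha>]
      by (rule finsum_cong') (auto simp: tgj power_series_coeff[OF f \<alpha>])
    also have "\<dots> = (if \<alpha> = (\<lambda>_. 0) then \<zero> else f \<alpha>)"
    proof (cases "\<alpha> = (\<lambda>_. 0)")
      case True
      then show ?thesis by simp
    next
      case False
      then obtain k where "\<alpha> k \<noteq> 0" by auto
      define m where "m = (LEAST k. \<alpha> k \<noteq> 0)"
      have m: "\<alpha> m \<noteq> 0"
        unfolding m_def by (rule LeastI[of "\<lambda>k. \<alpha> k \<noteq> 0", OF \<open>\<alpha> k \<noteq> 0\<close>])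
      have m': "\<alpha> i = 0" if "i < m" for i
        using not_less_Least[of i "\<lambda>k. \<alpha> k \<noteq> 0"] that unfolding m_def by blast
      have "m < n"
      proof (rule ccontr)
        assume "\<not> m < n"
        then have "\<alpha> m = 0" using \<alpha> by (simp add: exponents_def)
        with m show False by simp
      qed
      have "\<alpha> j \<noteq> 0 \<and> (\<forall>i<j. \<alpha> i = 0) \<longleftrightarrow> j = m" for j
        using m m' by (metis linorder_neqE_nat)
      then have "(\<Oplus>j\<in>{..<n}. if \<alpha> j \<noteq> 0 \<and> (\<forall>i<j. \<alpha> i = 0) then f \<alpha> else \<zero>)
          = (\<Oplus>j\<in>{..<n}. if j = m then f \<alpha> else \<zero>)"
        by simp
      also have "\<dots> = f \<alpha>"
        by (rule add.finprod_singleton_swap) (use \<open>m < n\<close> power_series_coeff[OF f \<alpha>] in auto)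
      finally show ?thesis using False by simp
    qed
    finally show "f \<alpha> = (f (\<lambda>_. 0) \<odot>\<^bsub>B\<^esub> \<one>\<^bsub>B\<^esub> \<oplus>\<^bsub>B\<^esub> (\<Oplus>\<^bsub>B\<^esub>j\<in>{..<n}. variable A n j \<otimes>\<^bsub>B\<^esub> g j)) \<alpha>"
      using f0 power_series_coeff[OF f \<alpha>]
      by (simp add: power_series_add_coeff[OF \<alpha>] power_series_smult_coeff[OF \<alpha>] power_series_one_coeff[OF \<alpha>])
  qed (use f f0 tg in \<open>auto intro!: B.a_closed B.finsum_closed B.smult_closed\<close>)
  with g that show ?thesis by blast
qed

lemma variable_ideal_ideal: "ideal (variable_ideal A n) B"
  unfolding variable_ideal_def by (rule B.genideal_ideal) (use variable_closed in auto)

lemma variable_in_variable_ideal: "j < n \<Longrightarrow> variable A n j \<in> variable_ideal A n"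
  unfolding variable_ideal_def by (rule B.genideal_self[THEN subsetD]) (use variable_closed in auto)

text \<open>The series with constant coefficient zero form an ideal that contains the variables, and
  the generated ideal is the least such.\<close>

lemma variable_ideal_const_coeff:
  assumes "f \<in> variable_ideal A n"
  shows "f (\<lambda>_. 0) = \<zero>"
proof -
  let ?J = "{f \<in> carrier B. f (\<lambda>_. 0) = \<zero>}"
  have b0: "below (\<lambda>_. 0) = {\<lambda>_. 0}" by auto
  have m0: "(f \<otimes>\<^bsub>B\<^esub> g) (\<lambda>_. 0) = f (\<lambda>_. 0) \<otimes> g (\<lambda>_. 0)" if "f \<in> carrier B" "g \<in> carrier B" for f g
    unfolding power_series_mult_coeff[OF exponents_zero] b0
    using that power_series_coeff[OF _ exponents_zero] by (simp add: finsum_insert)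
  have "ideal ?J B"
  proof (rule idealI)
    show "subgroup ?J (add_monoid B)"
    proof (rule B.add.subgroupI)
      \<comment> \<open>The constant coefficient of the inverse is unchanged by adding
        \<open>a\<close>, whose own is zero.\<close>
      fix a assume a: "a \<in> ?J"
      have "(\<ominus>\<^bsub>B\<^esub> a) (\<lambda>_. 0) = (\<ominus>\<^bsub>B\<^esub> a \<oplus>\<^bsub>B\<^esub> a) (\<lambda>_. 0)"
        using a power_series_coeff[OF _ exponents_zero, of "\<ominus>\<^bsub>B\<^esub> a"] by (simp add: power_series_add_coeff[OF exponents_zero])
      also have "\<dots> = \<zero>" using a by (simp add: B.l_neg power_series_zero_coeff[OF exponents_zero])
      finally show "\<ominus>\<^bsub>B\<^esub> a \<in> ?J" using a by simp
    qed (use B.zero_closed in \<open>auto simp: power_series_add_coeff[OF exponents_zero] power_series_zero_coeff[OF exponents_zero]\<close>)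
  qed (auto simp: m0 B.ring_axioms power_series_coeff[OF _ exponents_zero])
  then have "variable_ideal A n \<subseteq> ?J"
    unfolding variable_ideal_def
  proof (rule B.genideal_minimal, intro image_subsetI CollectI conjI)
    show "variable A n j (\<lambda>_. 0) = \<zero>" for j
      by (auto simp: variable_def exponents_zero fun_eq_iff)
  qed (rule variable_closed)
  then show ?thesis using assms by auto
qed

text \<open>The constant term is gone, so \<open>power_series_decomp\<close> leaves a finite
  combination of the variables, without limits. This makes b^(i+1) M the sum of the t_j b^i
  M.\<close>

lemma variable_ideal_decomp:
  assumes f: "f \<in> variable_ideal A n"
  obtains g where "\<And>j. g j \<in> carrier B" "f = (\<Oplus>\<^bsub>B\<^esub>j\<in>{..<n}. variable A n j \<otimes>\<^bsub>B\<^esub> g j)"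
proof -
  have fB: "f \<in> carrier B" using ideal.Icarr[OF variable_ideal_ideal f] .
  obtain g where g: "\<And>j. g j \<in> carrier B"
    "f = f (\<lambda>_. 0) \<odot>\<^bsub>B\<^esub> \<one>\<^bsub>B\<^esub> \<oplus>\<^bsub>B\<^esub> (\<Oplus>\<^bsub>B\<^esub>j\<in>{..<n}. variable A n j \<otimes>\<^bsub>B\<^esub> g j)"
    using power_series_decomp[OF fB] by blast
  have "(\<Oplus>\<^bsub>B\<^esub>j\<in>{..<n}. variable A n j \<otimes>\<^bsub>B\<^esub> g j) \<in> carrier B"
    by (rule B.finsum_closed) (use g(1) variable_closed in auto)
  with g(2) have "f = (\<Oplus>\<^bsub>B\<^esub>j\<in>{..<n}. variable A n j \<otimes>\<^bsub>B\<^esub> g j)"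
    unfolding variable_ideal_const_coeff[OF f] by simp
  with g(1) that show ?thesis by blast
qed

section \<open>The filtration of power series by total degree\<close>

definition vanishing :: "nat \<Rightarrow> ((nat \<Rightarrow> nat) \<Rightarrow> 'a) set"
  where "vanishing k = {f \<in> carrier B. \<forall>\<alpha>\<in>exponents n. sum \<alpha> {..<n} < k \<longrightarrow> f \<alpha> = \<zero>}"

lemma vanishing_finsum:
  "F \<in> S \<rightarrow> vanishing k \<Longrightarrow> (\<Oplus>\<^bsub>B\<^esub>i\<in>S. F i) \<in> vanishing k"
proof -
  assume F: "F \<in> S \<rightarrow> vanishing k"
  then have F': "F \<in> S \<rightarrow> carrier B" by (auto simp: vanishing_def)
  have "(\<Oplus>\<^bsub>B\<^esub>i\<in>S. F i) \<alpha> = \<zero>" if "\<alpha> \<in> exponents n" "sum \<alpha> {..<n} < k" for \<alpha>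
    unfolding power_series_finsum_coeff[OF F' that(1)]
    by (rule add.finprod_one_eqI) (use F that in \<open>auto simp: vanishing_def\<close>)
  then show ?thesis using B.finsum_closed[OF F'] by (auto simp: vanishing_def)
qed

lemma vanishing_variable_mult:
  assumes f: "f \<in> vanishing k" and j: "j < n"
  shows "variable A n j \<otimes>\<^bsub>B\<^esub> f \<in> vanishing (Suc k)"
proof -
  have fB: "f \<in> carrier B" using f by (simp add: vanishing_def)
  have "(variable A n j \<otimes>\<^bsub>B\<^esub> f) \<alpha> = \<zero>" if \<alpha>: "\<alpha> \<in> exponents n" and s: "sum \<alpha> {..<n} < Suc k" for \<alpha>
  proof (cases "\<alpha> j = 0")
    case True
    then show ?thesis by (simp add: variable_mult_coeff[OF fB \<alpha> j])
  next
    case False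
    have "sum \<alpha> {..<n} = \<alpha> j + sum \<alpha> ({..<n} - {j})"
      using j by (intro sum.remove) auto
    moreover have "sum (\<alpha>(j := \<alpha> j - 1)) {..<n} = (\<alpha> j - 1) + sum (\<alpha>(j := \<alpha> j - 1)) ({..<n} - {j})"
      using j by (subst sum.remove[of _ j]) auto
    moreover have "sum (\<alpha>(j := \<alpha> j - 1)) ({..<n} - {j}) = sum \<alpha> ({..<n} - {j})"
      by (intro sum.cong) auto
    ultimately have "sum (\<alpha>(j := \<alpha> j - 1)) {..<n} < k" using s False by linarith
    then have "f (\<alpha>(j := \<alpha> j - 1)) = \<zero>"
      using f exponents_upd[OF \<alpha> j] unfolding vanishing_def by blast
    then show ?thesis by (simp add: variable_mult_coeff[OF fB \<alpha> j])
  qed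
  then show ?thesis using fB variable_closed by (auto simp: vanishing_def)
qed

text \<open>A coefficient of degree d is killed by membership in stage d + 1. This is the test by
  which \<open>ops_order_1\<close> shows a series to be zero.\<close>

lemma vanishing_separated:
  assumes "\<And>k. f \<in> vanishing k"
  shows "f = \<zero>\<^bsub>B\<^esub>"
proof (rule power_series_eqI)
  fix \<alpha> assume \<alpha>: "\<alpha> \<in> exponents n"
  show "f \<alpha> = \<zero>\<^bsub>B\<^esub> \<alpha>"
    using assms[of "Suc (sum \<alpha> {..<n})"] \<alpha> by (simp add: vanishing_def power_series_zero_coeff)
qed (use assms[of 0] in \<open>auto simp: vanishing_def\<close>)

section \<open>Partial derivatives of power series\<close>

lemma partial_coeff:
  "\<lbrakk>f \<in> carrier B; \<alpha> \<in> exponents n\<rbrakk> \<Longrightarrow> partial A n j f \<alpha> = [Suc (\<alpha> j)] \<cdot>\<^bsub>A\<^esub> f (\<alpha>(j := Suc (\<alpha> j)))"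
  by (simp add: partial_def)

lemma partial_closed:
  assumes f: "f \<in> carrier B" and j: "j < n"
  shows "partial A n j f \<in> carrier B"
proof -
  have "(\<lambda>\<alpha>\<in>exponents n. [Suc (\<alpha> j)] \<cdot>\<^bsub>A\<^esub> f (\<alpha>(j := Suc (\<alpha> j)))) \<in> carrier B"
    by (rule power_series_carrierI)
      (intro add.nat_pow_closed power_series_coeff[OF f] exponents_upd j)
  then show ?thesis using f by (simp add: partial_def)
qed

lemma partial_add:
  assumes f: "f \<in> carrier B" and g: "g \<in> carrier B" and j: "j < n"
  shows "partial A n j (f \<oplus>\<^bsub>B\<^esub> g) = partial A n j f \<oplus>\<^bsub>B\<^esub> partial A n j g"
proof (rule power_series_eqI)
  fix \<alpha> assume \<alpha>: "\<alpha> \<in> exponents n"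
  show "partial A n j (f \<oplus>\<^bsub>B\<^esub> g) \<alpha> = (partial A n j f \<oplus>\<^bsub>B\<^esub> partial A n j g) \<alpha>"
    using f g \<alpha> exponents_upd[OF \<alpha> j, of "Suc (\<alpha> j)"]
    by (simp add: partial_coeff power_series_add_coeff power_series_coeff add.nat_pow_distrib del: add.nat_pow_Suc)
qed (use assms partial_closed in auto)

lemma partial_smult:
  assumes a: "a \<in> carrier A" and f: "f \<in> carrier B" and j: "j < n"
  shows "partial A n j (a \<odot>\<^bsub>B\<^esub> f) = a \<odot>\<^bsub>B\<^esub> partial A n j f"
proof (rule power_series_eqI)
  fix \<alpha> assume \<alpha>: "\<alpha> \<in> exponents n"
  show "partial A n j (a \<odot>\<^bsub>B\<^esub> f) \<alpha> = (a \<odot>\<^bsub>B\<^esub> partial A n j f) \<alpha>"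
    using a f \<alpha> exponents_upd[OF \<alpha> j, of "Suc (\<alpha> j)"]
    by (simp add: partial_coeff power_series_smult_coeff power_series_coeff add_pow_rdistr del: add.nat_pow_Suc)
qed (use assms partial_closed in auto)

lemma partial_partial_commute:
  assumes f: "f \<in> carrier B" and i: "i < n" and j: "j < n"
  shows "partial A n i (partial A n j f) = partial A n j (partial A n i f)"
proof (rule power_series_eqI)
  fix \<alpha> assume \<alpha>: "\<alpha> \<in> exponents n"
  have ij: "\<alpha>(i := k) \<in> exponents n" "\<alpha>(j := k) \<in> exponents n" "\<alpha>(i := k, j := l) \<in> exponents n" for k l
    using \<alpha> i j by (auto intro!: exponents_upd)
  show "partial A n i (partial A n j f) \<alpha> = partial A n j (partial A n i f) \<alpha>"
  proof (cases "i = j")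
    case False
    then have "\<alpha>(j := Suc (\<alpha> j), i := Suc (\<alpha> i)) = \<alpha>(i := Suc (\<alpha> i), j := Suc (\<alpha> j))"
      by (simp add: fun_upd_twist)
    then show ?thesis using f i j \<alpha> ij False
      by (simp add: partial_coeff partial_closed add.nat_pow_pow mult.commute power_series_coeff del: add.nat_pow_Suc)
  qed simp
qed (use assms partial_closed in auto)


text \<open>The weight \<alpha>'_j - \<beta>_j is the exponent of t_j contributed by
  \<open>g\<close>, so the sum is the part of the derivative that falls on \<open>g\<close>. The
  terms with \<beta>_j = \<alpha>'_j, the only ones not below \<alpha>, have weight 0.\<close>

lemma conv_partial:
  assumes f: "f \<in> carrier B" and g: "g \<in> carrier B" and j: "j < n" and \<alpha>: "\<alpha> \<in> exponents n"
  defines "\<alpha>' \<equiv> \<alpha>(j := Suc (\<alpha> j))"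
  shows "(\<Oplus>\<beta>\<in>below \<alpha>'. [(\<alpha>' j - \<beta> j)] \<cdot>\<^bsub>A\<^esub> (f \<beta> \<otimes> g (\<lambda>k. \<alpha>' k - \<beta> k))) = (f \<otimes>\<^bsub>B\<^esub> partial A n j g) \<alpha>"
proof -
  have \<alpha>': "\<alpha>' \<in> exponents n" unfolding \<alpha>'_def by (rule exponents_upd[OF \<alpha> j])
  have cl: "f \<beta> \<otimes> g (\<lambda>k. \<alpha>' k - \<beta> k) \<in> carrier A" if "\<beta> \<in> below \<alpha>'" for \<beta>
    using conv_closed[OF f g \<alpha>'] that by auto
  have sub: "below \<alpha> \<subseteq> below \<alpha>'"
    unfolding \<alpha>'_def by (auto intro: le_SucI)
  have "(\<Oplus>\<beta>\<in>below \<alpha>'. [(\<alpha>' j - \<beta> j)] \<cdot>\<^bsub>A\<^esub> (f \<beta> \<otimes> g (\<lambda>k. \<alpha>' k - \<beta> k)))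
      = (\<Oplus>\<beta>\<in>below \<alpha>. f \<beta> \<otimes> partial A n j g (\<lambda>k. \<alpha> k - \<beta> k))"
  proof (rule add.finprod_mono_neutral_cong_right)
    show "finite (below \<alpha>')" by (rule finite_exponents_below[OF \<alpha>'])
    show "(\<lambda>\<beta>. [(\<alpha>' j - \<beta> j)] \<cdot>\<^bsub>A\<^esub> (f \<beta> \<otimes> g (\<lambda>k. \<alpha>' k - \<beta> k))) \<in> below \<alpha>' \<rightarrow> carrier A"
      using cl by (auto intro!: add.nat_pow_closed)
    show "[(\<alpha>' j - \<beta> j)] \<cdot>\<^bsub>A\<^esub> (f \<beta> \<otimes> g (\<lambda>k. \<alpha>' k - \<beta> k)) = \<zero>" if "\<beta> \<in> below \<alpha>' - below \<alpha>" for \<beta>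
    proof -
      from that obtain k where "\<not> \<beta> k \<le> \<alpha> k" "\<beta> k \<le> \<alpha>' k" by auto
      then have "k = j" unfolding \<alpha>'_def by (auto split: if_splits)
      then have "\<alpha>' j - \<beta> j = 0" using \<open>\<not> \<beta> k \<le> \<alpha> k\<close> unfolding \<alpha>'_def by auto
      then show ?thesis by simp
    qed
    fix \<beta> assume \<beta>: "\<beta> \<in> below \<alpha>"
    then have le: "\<beta> j \<le> \<alpha> j" by auto
    have "(\<lambda>k. \<alpha> k - \<beta> k)(j := Suc (\<alpha> j - \<beta> j)) = (\<lambda>k. \<alpha>' k - \<beta> k)"
      using le unfolding \<alpha>'_def by (auto simp: fun_eq_iff)
    moreover have "\<alpha>' j - \<beta> j = Suc (\<alpha> j - \<beta> j)" using le unfolding \<alpha>'_def by auto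
    moreover have "f \<beta> \<in> carrier A" "g (\<lambda>k. \<alpha>' k - \<beta> k) \<in> carrier A"
      using power_series_coeff[OF f below_exponents[OF \<alpha> \<beta>]] power_series_coeff[OF g diff_exponents[OF \<alpha>']] .
    ultimately show "[(\<alpha>' j - \<beta> j)] \<cdot>\<^bsub>A\<^esub> (f \<beta> \<otimes> g (\<lambda>k. \<alpha>' k - \<beta> k))
        = f \<beta> \<otimes> partial A n j g (\<lambda>k. \<alpha> k - \<beta> k)"
      by (simp add: partial_coeff[OF g diff_exponents[OF \<alpha>]] add_pow_rdistr del: add.nat_pow_Suc)
  qed (use sub in auto)
  then show ?thesis by (simp add: power_series_mult_coeff[OF \<alpha>])
qed

text \<open>The factor \<alpha>'_j = \<alpha>_j + 1 produced by differentiation is split as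
  \<beta>_j + (\<alpha>'_j - \<beta>_j), the exponents of t_j in the two factors. The second part is
  handled by \<open>conv_partial\<close>; the first becomes an instance of it with \<open>f\<close>
  and \<open>g\<close> exchanged after the reflection \<open>conv_flip\<close>.\<close>

lemma partial_mult:
  assumes f: "f \<in> carrier B" and g: "g \<in> carrier B" and j: "j < n"
  shows "partial A n j (f \<otimes>\<^bsub>B\<^esub> g) = partial A n j f \<otimes>\<^bsub>B\<^esub> g \<oplus>\<^bsub>B\<^esub> f \<otimes>\<^bsub>B\<^esub> partial A n j g"
proof (rule power_series_eqI)
  fix \<alpha> assume \<alpha>: "\<alpha> \<in> exponents n"
  define \<alpha>' where "\<alpha>' = \<alpha>(j := Suc (\<alpha> j))"
  have \<alpha>': "\<alpha>' \<in> exponents n" unfolding \<alpha>'_def by (rule exponents_upd[OF \<alpha> j])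
  let ?F = "\<lambda>\<beta>. f \<beta> \<otimes> g (\<lambda>k. \<alpha>' k - \<beta> k)"
  have cl: "?F \<beta> \<in> carrier A" if "\<beta> \<in> below \<alpha>'" for \<beta>
    using conv_closed[OF f g \<alpha>'] that by auto
  have pd: "[\<alpha>' j] \<cdot>\<^bsub>A\<^esub> (\<Oplus>\<beta>\<in>S. ?F \<beta>) = (\<Oplus>\<beta>\<in>S. [\<alpha>' j] \<cdot>\<^bsub>A\<^esub> ?F \<beta>)" if "finite S" "S \<subseteq> below \<alpha>'" for S
    using that
  proof (induction S rule: finite_induct)
    case (insert x S)
    then have "?F \<in> S \<rightarrow> carrier A" "?F x \<in> carrier A" using cl by blast+
    moreover have "(\<lambda>\<beta>. [\<alpha>' j] \<cdot>\<^bsub>A\<^esub> ?F \<beta>) \<in> S \<rightarrow> carrier A" "[\<alpha>' j] \<cdot>\<^bsub>A\<^esub> ?F x \<in> carrier A"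
      using calculation by (auto intro!: add.nat_pow_closed simp: Pi_iff)
    ultimately show ?case using insert
      by (simp add: finsum_insert add.nat_pow_distrib finsum_closed)
  qed simp
  have "partial A n j (f \<otimes>\<^bsub>B\<^esub> g) \<alpha> = [\<alpha>' j] \<cdot>\<^bsub>A\<^esub> (\<Oplus>\<beta>\<in>below \<alpha>'. ?F \<beta>)"
    using power_series_mult_coeff[OF \<alpha>', of f g]
    by (simp add: partial_coeff[OF B.m_closed[OF f g] \<alpha>] \<alpha>'_def del: add.nat_pow_Suc)
  also have "\<dots> = (\<Oplus>\<beta>\<in>below \<alpha>'. [\<alpha>' j] \<cdot>\<^bsub>A\<^esub> ?F \<beta>)"
    by (rule pd) (use finite_exponents_below[OF \<alpha>'] in auto)
  also have "\<dots> = (\<Oplus>\<beta>\<in>below \<alpha>'. [\<beta> j] \<cdot>\<^bsub>A\<^esub> ?F \<beta> \<oplus> [(\<alpha>' j - \<beta> j)] \<cdot>\<^bsub>A\<^esub> ?F \<beta>)"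
    by (rule finsum_cong') (use cl in \<open>auto simp: add.nat_pow_mult intro!: add.nat_pow_closed\<close>)
  also have "\<dots> = (\<Oplus>\<beta>\<in>below \<alpha>'. [\<beta> j] \<cdot>\<^bsub>A\<^esub> ?F \<beta>) \<oplus> (\<Oplus>\<beta>\<in>below \<alpha>'. [(\<alpha>' j - \<beta> j)] \<cdot>\<^bsub>A\<^esub> ?F \<beta>)"
    by (rule finsum_addf) (use cl in \<open>auto intro!: add.nat_pow_closed\<close>)
  also have "(\<Oplus>\<beta>\<in>below \<alpha>'. [\<beta> j] \<cdot>\<^bsub>A\<^esub> ?F \<beta>)
      = (\<Oplus>\<beta>\<in>below \<alpha>'. [(\<alpha>' j - \<beta> j)] \<cdot>\<^bsub>A\<^esub> ?F (\<lambda>k. \<alpha>' k - \<beta> k))"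
    by (rule conv_flip[OF \<alpha>']) (use cl in \<open>auto intro!: add.nat_pow_closed\<close>)
  also have "\<dots> = (\<Oplus>\<beta>\<in>below \<alpha>'. [(\<alpha>' j - \<beta> j)] \<cdot>\<^bsub>A\<^esub> (g \<beta> \<otimes> f (\<lambda>k. \<alpha>' k - \<beta> k)))"
  proof (rule finsum_cong')
    fix \<beta> assume \<beta>: "\<beta> \<in> below \<alpha>'"
    then have "(\<lambda>k. \<alpha>' k - (\<alpha>' k - \<beta> k)) = \<beta>" by auto
    then show "[(\<alpha>' j - \<beta> j)] \<cdot>\<^bsub>A\<^esub> ?F (\<lambda>k. \<alpha>' k - \<beta> k) = [(\<alpha>' j - \<beta> j)] \<cdot>\<^bsub>A\<^esub> (g \<beta> \<otimes> f (\<lambda>k. \<alpha>' k - \<beta> k))"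
      using power_series_coeff[OF f diff_exponents[OF \<alpha>']] power_series_coeff[OF g below_exponents[OF \<alpha>' \<beta>]]
      by (simp add: m_comm)
  qed (use conv_closed[OF g f \<alpha>'] in \<open>auto intro!: add.nat_pow_closed simp: Pi_iff\<close>)
  also have "\<dots> = (g \<otimes>\<^bsub>B\<^esub> partial A n j f) \<alpha>"
    using conv_partial[OF g f j \<alpha>] unfolding \<alpha>'_def .
  also have "(\<Oplus>\<beta>\<in>below \<alpha>'. [(\<alpha>' j - \<beta> j)] \<cdot>\<^bsub>A\<^esub> ?F \<beta>) = (f \<otimes>\<^bsub>B\<^esub> partial A n j g) \<alpha>"
    using conv_partial[OF f g j \<alpha>] unfolding \<alpha>'_def .
  finally show "partial A n j (f \<otimes>\<^bsub>B\<^esub> g) \<alpha> = (partial A n j f \<otimes>\<^bsub>B\<^esub> g \<oplus>\<^bsub>B\<^esub> f \<otimes>\<^bsub>B\<^esub> partial A n j g) \<alpha>"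
    using f g j by (simp add: power_series_add_coeff[OF \<alpha>] B.m_comm partial_closed)
qed (use assms partial_closed in auto)

text \<open>The Leibniz rule for 1 = 1 \<cdot> 1 gives \<partial>1 = \<partial>1 +
  \<partial>1.\<close>

lemma partial_one: "j < n \<Longrightarrow> partial A n j \<one>\<^bsub>B\<^esub> = \<zero>\<^bsub>B\<^esub>"
  using partial_mult[of "\<one>\<^bsub>B\<^esub>" "\<one>\<^bsub>B\<^esub>" j] partial_closed[of "\<one>\<^bsub>B\<^esub>" j]
  by (metis B.add.l_cancel_one' B.l_one B.one_closed B.r_one)

lemma partial_variable:
  assumes i: "i < n"
  shows "partial A n i (variable A n j) = (if i = j then \<one>\<^bsub>B\<^esub> else \<zero>\<^bsub>B\<^esub>)"
proof (rule power_series_eqI)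
  fix \<alpha> assume \<alpha>: "\<alpha> \<in> exponents n"
  have "\<alpha>(i := Suc (\<alpha> i)) = (\<lambda>_. 0)(j := 1) \<longleftrightarrow> i = j \<and> \<alpha> = (\<lambda>_. 0)"
    by (auto simp: fun_eq_iff split: if_splits)
  then show "partial A n i (variable A n j) \<alpha> = (if i = j then \<one>\<^bsub>B\<^esub> else \<zero>\<^bsub>B\<^esub>) \<alpha>"
    unfolding partial_coeff[OF variable_closed \<alpha>]
    using exponents_upd[OF \<alpha> i, of "Suc (\<alpha> i)"]
    by (simp add: variable_def power_series_one_coeff[OF \<alpha>] power_series_zero_coeff[OF \<alpha>])
qed (use i partial_closed variable_closed in auto)

end

section \<open>Adic filtrations and the Euler operator\<close>

lemmas (in abelian_group) minus_ac = minus_eq minus_add a_ac r_neg1 r_neg2 minus_minus r_neg l_neg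

lemma (in module) smult_minus_distr:
  "\<lbrakk>a \<in> carrier R; x \<in> carrier M; y \<in> carrier M\<rbrakk> \<Longrightarrow> a \<odot>\<^bsub>M\<^esub> (x \<ominus>\<^bsub>M\<^esub> y) = a \<odot>\<^bsub>M\<^esub> x \<ominus>\<^bsub>M\<^esub> a \<odot>\<^bsub>M\<^esub> y"
  by (simp add: M.minus_eq smult_r_distr smult_r_minus)

lemma (in module) add_pow_smult:
  "\<lbrakk>a \<in> carrier R; x \<in> carrier M\<rbrakk> \<Longrightarrow> ([(k::nat)] \<cdot>\<^bsub>R\<^esub> a) \<odot>\<^bsub>M\<^esub> x = [k] \<cdot>\<^bsub>M\<^esub> (a \<odot>\<^bsub>M\<^esub> x)"
  by (induction k) (simp_all add: smult_l_distr)

lemma (in module) smult_add_pow: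
  "\<lbrakk>a \<in> carrier R; x \<in> carrier M\<rbrakk> \<Longrightarrow> a \<odot>\<^bsub>M\<^esub> ([(k::nat)] \<cdot>\<^bsub>M\<^esub> x) = [k] \<cdot>\<^bsub>M\<^esub> (a \<odot>\<^bsub>M\<^esub> x)"
  by (induction k) (simp_all add: smult_r_distr)

section \<open>The filtration of a module by the powers of an ideal\<close>

locale adic_module = module R M
  for R :: "('b, 'x) ring_scheme" (structure) and M :: "('b, 'm, 'y) module_scheme" (structure) +
  fixes I
  assumes I: "ideal I R"
begin

abbreviation F where "F \<equiv> adic_filtration R I M"

lemma I_pow: "ideal (I [^]\<^bsub>ideals_set R\<^esub> (i::nat)) R"
proof (induction i)
  case 0
  show ?case by (simp add: ideals_set_def R.oneideal)
next
  case (Suc i)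
  then show ?case using R.ideal_prod_is_ideal[OF Suc I] by (simp add: ideals_set_def)
qed

lemma F_gen_carrier: "{b \<odot>\<^bsub>M\<^esub> x | b x. b \<in> I [^]\<^bsub>ideals_set R\<^esub> (i::nat) \<and> x \<in> carrier M} \<subseteq> carrier M"
  using ideal.Icarr[OF I_pow] by auto

lemma F_subgroup: "subgroup (F i) (add_monoid M)"
  unfolding adic_filtration_def ideal_smult_def
  by (rule M.add.generate_is_subgroup[OF F_gen_carrier])

lemma F_add: "\<lbrakk>x \<in> F i; y \<in> F i\<rbrakk> \<Longrightarrow> x \<oplus>\<^bsub>M\<^esub> y \<in> F i"
  using subgroup.m_closed[OF F_subgroup] by simp

lemma F_zero: "\<zero>\<^bsub>M\<^esub> \<in> F i"
  using subgroup.one_closed[OF F_subgroup] by simp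

lemma F_uminus: "x \<in> F i \<Longrightarrow> \<ominus>\<^bsub>M\<^esub> x \<in> F i"
  using subgroup.m_inv_closed[OF F_subgroup] by (simp add: a_inv_def)

lemma F_minus: "\<lbrakk>x \<in> F i; y \<in> F i\<rbrakk> \<Longrightarrow> x \<ominus>\<^bsub>M\<^esub> y \<in> F i"
  by (simp add: a_minus_def F_add F_uminus)

lemma F_carrier: "x \<in> F i \<Longrightarrow> x \<in> carrier M"
  using subgroup.subset[OF F_subgroup] by auto

lemma F_cong: "\<lbrakk>x \<ominus>\<^bsub>M\<^esub> y \<in> F i; x \<in> carrier M; y \<in> F i\<rbrakk> \<Longrightarrow> x \<in> F i"
  using F_add[of "x \<ominus>\<^bsub>M\<^esub> y" i y] F_carrier[of y i]
  by (simp add: M.minus_eq M.a_assoc M.l_neg)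

lemma F_trans:
  assumes "x \<ominus>\<^bsub>M\<^esub> y \<in> F i" "y \<ominus>\<^bsub>M\<^esub> z \<in> F i" and "x \<in> carrier M" "y \<in> carrier M" "z \<in> carrier M"
  shows "x \<ominus>\<^bsub>M\<^esub> z \<in> F i"
proof -
  have "x \<ominus>\<^bsub>M\<^esub> z = (x \<ominus>\<^bsub>M\<^esub> y) \<oplus>\<^bsub>M\<^esub> (y \<ominus>\<^bsub>M\<^esub> z)"
    using assms(3-) by (simp add: M.minus_eq M.a_assoc M.r_neg1)
  then show ?thesis using F_add[OF assms(1,2)] by simp
qed

lemma F_sym: "\<lbrakk>x \<ominus>\<^bsub>M\<^esub> y \<in> F i; x \<in> carrier M; y \<in> carrier M\<rbrakk> \<Longrightarrow> y \<ominus>\<^bsub>M\<^esub> x \<in> F i"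
  using F_uminus[of "x \<ominus>\<^bsub>M\<^esub> y" i] by (simp add: M.minus_eq M.minus_add M.a_comm)

lemma F_finsum: "(\<And>j. j \<in> S \<Longrightarrow> f j \<in> F i) \<Longrightarrow> (\<Oplus>\<^bsub>M\<^esub>j\<in>S. f j) \<in> F i"
proof (induction S rule: infinite_finite_induct)
  case (insert x S)
  then have "f \<in> S \<rightarrow> carrier M" "f x \<in> carrier M" using F_carrier by blast+
  with insert show ?case by (simp add: F_add)
qed (auto simp: F_zero)

lemma F_incl: "\<lbrakk>b \<in> I [^]\<^bsub>ideals_set R\<^esub> i; x \<in> carrier M\<rbrakk> \<Longrightarrow> b \<odot>\<^bsub>M\<^esub> x \<in> F i"
  unfolding adic_filtration_def ideal_smult_def by (rule generate.incl) auto

text \<open>The generated subgroup is reached by sums alone: the negative of a generator b y is (-b)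
  y, again a generator, and zero is 0 y. The induction therefore has no cases for inverses and for
  zero.\<close>

lemma F_induct [consumes 1, case_names smult add]:
  assumes "x \<in> F i"
    and "\<And>b y. \<lbrakk>b \<in> I [^]\<^bsub>ideals_set R\<^esub> i; y \<in> carrier M\<rbrakk> \<Longrightarrow> P (b \<odot>\<^bsub>M\<^esub> y)"
    and "\<And>x y. \<lbrakk>x \<in> F i; y \<in> F i; P x; P y\<rbrakk> \<Longrightarrow> P (x \<oplus>\<^bsub>M\<^esub> y)"
  shows "P x"
proof -
  let ?G = "{b \<odot>\<^bsub>M\<^esub> x | b x. b \<in> I [^]\<^bsub>ideals_set R\<^esub> i \<and> x \<in> carrier M}"
  have zI: "\<zero> \<in> I [^]\<^bsub>ideals_set R\<^esub> i"
    using additive_subgroup.zero_closed[OF ideal.axioms(1)[OF I_pow]] .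
  have "x \<in> F i \<and> P x" using assms(1)[unfolded adic_filtration_def ideal_smult_def]
  proof (induction x rule: generate.induct)
    case one
    have "P (\<zero> \<odot>\<^bsub>M\<^esub> \<zero>\<^bsub>M\<^esub>)" by (rule assms(2)[OF zI]) simp
    then show ?case by (simp add: F_zero)
  next
    case (incl h)
    then show ?case using assms(2) F_incl by auto
  next
    case (inv h)
    then obtain b y where h: "h = b \<odot>\<^bsub>M\<^esub> y" "b \<in> I [^]\<^bsub>ideals_set R\<^esub> i" "y \<in> carrier M" by auto
    have b: "b \<in> carrier R" using ideal.Icarr[OF I_pow h(2)] .
    have "\<ominus> b \<in> I [^]\<^bsub>ideals_set R\<^esub> i"
      using additive_subgroup.a_inv_closed[OF ideal.axioms(1)[OF I_pow] h(2)] .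
    moreover have "inv\<^bsub>add_monoid M\<^esub> h = (\<ominus> b) \<odot>\<^bsub>M\<^esub> y"
      using b h by (simp add: smult_l_minus a_inv_def[symmetric])
    ultimately show ?case using assms(2) F_incl h(3) by simp
  next
    case (eng h1 h2)
    then show ?case using assms(3) F_add by simp
  qed
  then show ?thesis by simp
qed

lemma F_0: "F 0 = carrier M"
proof
  show "carrier M \<subseteq> F 0"
  proof
    fix x assume x: "x \<in> carrier M"
    have "\<one> \<odot>\<^bsub>M\<^esub> x \<in> F 0" by (rule F_incl) (simp_all add: x ideals_set_def)
    then show "x \<in> F 0" using x by simp
  qed
qed (use F_carrier in auto)

lemma F_smult:
  assumes "x \<in> F i" and b: "b \<in> carrier R" shows "b \<odot>\<^bsub>M\<^esub> x \<in> F i"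
  using assms(1)
proof (induction rule: F_induct)
  case (smult c y)
  have "c \<in> carrier R" using ideal.Icarr[OF I_pow smult(1)] .
  moreover have "b \<otimes> c \<in> I [^]\<^bsub>ideals_set R\<^esub> i" using ideal.I_l_closed[OF I_pow smult(1) b] .
  ultimately show ?case using F_incl[OF _ smult(2)] b smult(2) by (simp add: smult_assoc1[symmetric])
next
  case (add x y)
  then show ?case using F_carrier b by (simp add: smult_r_distr F_add)
qed

lemma F_Suc_smult:
  assumes "x \<in> F i" and b: "b \<in> I" shows "b \<odot>\<^bsub>M\<^esub> x \<in> F (Suc i)"
  using assms(1)
proof (induction rule: F_induct)
  case (smult c y)
  have c: "c \<in> carrier R" "b \<in> carrier R" using ideal.Icarr[OF I_pow smult(1)] ideal.Icarr[OF I b] .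
  have "c \<otimes> b \<in> I [^]\<^bsub>ideals_set R\<^esub> (Suc i)"
    using ideal_prod.prod[OF smult(1) b] by (simp add: ideals_set_def)
  then show ?case using F_incl[OF _ smult(2)] c smult(2)
    by (simp add: smult_assoc1[symmetric] R.m_comm)
next
  case (add x y)
  then show ?case using F_carrier ideal.Icarr[OF I b] by (simp add: smult_r_distr F_add)
qed

text \<open>The power I^(i+1) is the product ideal of I^i and I, and a product c d acts on y as d (c
  y), where c y already lies in \<open>F i\<close>.\<close>

lemma F_Suc_induct [consumes 1, case_names smult add]:
  assumes "x \<in> F (Suc i)"
    and "\<And>b y. \<lbrakk>b \<in> I; y \<in> F i\<rbrakk> \<Longrightarrow> P (b \<odot>\<^bsub>M\<^esub> y)"
    and "\<And>x y. \<lbrakk>x \<in> F (Suc i); y \<in> F (Suc i); P x; P y\<rbrakk> \<Longrightarrow> P (x \<oplus>\<^bsub>M\<^esub> y)"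
  shows "P x"
  using assms(1)
proof (induction rule: F_induct)
  case (smult b y)
  then have "b \<in> (I [^]\<^bsub>ideals_set R\<^esub> i) \<cdot> I" by (simp add: ideals_set_def)
  then show ?case
  proof (induction b rule: ideal_prod.induct)
    case (prod c d)
    have "c \<in> carrier R" "d \<in> carrier R"
      using ideal.Icarr[OF I_pow prod(1)] ideal.Icarr[OF I prod(2)] .
    moreover have "P (d \<odot>\<^bsub>M\<^esub> (c \<odot>\<^bsub>M\<^esub> y))"
      by (rule assms(2)[OF prod(2) F_incl[OF prod(1) smult(2)]])
    ultimately show ?case using smult(2) by (simp add: smult_assoc1[symmetric] R.m_comm)
  next
    case (sum c d)
    have cd: "c \<in> I [^]\<^bsub>ideals_set R\<^esub> Suc i" "d \<in> I [^]\<^bsub>ideals_set R\<^esub> Suc i"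
      using sum by (simp_all add: ideals_set_def)
    then have "c \<in> carrier R" "d \<in> carrier R" using ideal.Icarr[OF I_pow] by blast+
    then show ?case using assms(3)[OF F_incl[OF cd(1) smult(2)] F_incl[OF cd(2) smult(2)] sum(3,4)] smult(2)
      by (simp add: smult_l_distr)
  qed
qed (rule assms(3))

lemma F_Suc_subset: "F (Suc i) \<subseteq> F i"
proof
  fix x assume "x \<in> F (Suc i)"
  then show "x \<in> F i"
    by (induction rule: F_Suc_induct) (auto intro: F_smult F_add ideal.Icarr[OF I])
qed

lemma F_antimono: "i \<le> j \<Longrightarrow> x \<in> F j \<Longrightarrow> x \<in> F i"
  by (induction j rule: dec_induct) (use F_Suc_subset in auto)

end

text \<open>What M and B \<otimes> M^hor have in common. The operators \<open>D j\<close> stand for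
  the \<partial>_j, and their only relation to the scalars is the commutator [\<partial>_i, t_j],
  which is 1 for i = j and 0 otherwise; \<open>divisible\<close> comes from the rationals in A. That
  the \<partial>_j commute with each other is a hypothesis of
  \<open>horizontal_step\<close>.\<close>

locale euler_module = adic_module R M I
  for R :: "('b, 'x) ring_scheme" (structure) and M :: "('b, 'm, 'y) module_scheme" (structure) and I +
  fixes n :: nat and t :: "nat \<Rightarrow> 'b" and D :: "nat \<Rightarrow> 'm \<Rightarrow> 'm"
  assumes t_in: "\<And>j. j < n \<Longrightarrow> t j \<in> I"
    and I_decomp: "\<And>b. b \<in> I \<Longrightarrow> \<exists>g. (\<forall>j. g j \<in> carrier R) \<and> b = (\<Oplus>j\<in>{..<n}. t j \<otimes> g j)"
    and divisible: "\<And>k. 0 < k \<Longrightarrow> \<exists>q\<in>carrier R. [(k::nat)] \<cdot>\<^bsub>R\<^esub> q = \<one>"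
    and D_closed: "\<And>j x. \<lbrakk>j < n; x \<in> carrier M\<rbrakk> \<Longrightarrow> D j x \<in> carrier M"
    and D_add: "\<And>j x y. \<lbrakk>j < n; x \<in> carrier M; y \<in> carrier M\<rbrakk> \<Longrightarrow> D j (x \<oplus>\<^bsub>M\<^esub> y) = D j x \<oplus>\<^bsub>M\<^esub> D j y"
    and D_smult: "\<And>i j x. \<lbrakk>i < n; j < n; x \<in> carrier M\<rbrakk> \<Longrightarrow>
      D i (t j \<odot>\<^bsub>M\<^esub> x) = t j \<odot>\<^bsub>M\<^esub> D i x \<oplus>\<^bsub>M\<^esub> (if i = j then x else \<zero>\<^bsub>M\<^esub>)"
begin

lemma t_carrier: "j < n \<Longrightarrow> t j \<in> carrier R"
  using ideal.Icarr[OF I t_in] .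

text \<open>As b = \<Sum> t_j g_j, the element b y is \<Sum> t_j (g_j y) with g_j y still in
  \<open>F i\<close>. Induction over single variables is what brings \<open>D_smult\<close> into
  play, which speaks of the t_j only.\<close>

lemma F_variable_induct [consumes 1, case_names smult zero add]:
  assumes "x \<in> F (Suc i)"
    and "\<And>j y. \<lbrakk>j < n; y \<in> F i\<rbrakk> \<Longrightarrow> P (t j \<odot>\<^bsub>M\<^esub> y)"
    and "P \<zero>\<^bsub>M\<^esub>"
    and "\<And>x y. \<lbrakk>x \<in> F (Suc i); y \<in> F (Suc i); P x; P y\<rbrakk> \<Longrightarrow> P (x \<oplus>\<^bsub>M\<^esub> y)"
  shows "P x"
  using assms(1)
proof (induction rule: F_Suc_induct)
  case (smult b y)
  then obtain g where g: "\<And>j. g j \<in> carrier R" "b = (\<Oplus>j\<in>{..<n}. t j \<otimes> g j)"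
    using I_decomp by blast
  have y: "y \<in> carrier M" using F_carrier[OF smult(2)] .
  have "P ((\<Oplus>j\<in>S. t j \<otimes> g j) \<odot>\<^bsub>M\<^esub> y) \<and> (\<Oplus>j\<in>S. t j \<otimes> g j) \<odot>\<^bsub>M\<^esub> y \<in> F (Suc i)"
    if "finite S" "S \<subseteq> {..<n}" for S
    using that
  proof (induction S rule: finite_induct)
    case empty
    show ?case using assms(3) y F_zero by simp
  next
    case (insert j S)
    have j: "j < n" and S: "S \<subseteq> {..<n}" using insert by auto
    have tg: "(\<lambda>j. t j \<otimes> g j) \<in> S \<rightarrow> carrier R" "t j \<otimes> g j \<in> carrier R"
      using g(1) t_carrier S j by auto
    have gy: "g j \<odot>\<^bsub>M\<^esub> y \<in> F i" using F_smult[OF smult(2) g(1)] .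
    have "(\<Oplus>k\<in>insert j S. t k \<otimes> g k) \<odot>\<^bsub>M\<^esub> y =
        t j \<odot>\<^bsub>M\<^esub> (g j \<odot>\<^bsub>M\<^esub> y) \<oplus>\<^bsub>M\<^esub> (\<Oplus>k\<in>S. t k \<otimes> g k) \<odot>\<^bsub>M\<^esub> y"
      using insert(1,2) tg y g(1) t_carrier[OF j]
      by (simp add: smult_l_distr smult_assoc1 R.finsum_closed)
    then show ?case
      using assms(2)[OF j gy] assms(4)[OF F_Suc_smult[OF gy t_in[OF j]]] insert.IH[OF S]
        F_add[OF F_Suc_smult[OF gy t_in[OF j]]] by simp
  qed
  from this[of "{..<n}"] show ?case using g(2) by simp
qed (rule assms(4))

lemma D_zero: "j < n \<Longrightarrow> D j \<zero>\<^bsub>M\<^esub> = \<zero>\<^bsub>M\<^esub>"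
  using D_add[of j "\<zero>\<^bsub>M\<^esub>" "\<zero>\<^bsub>M\<^esub>"] D_closed[of j "\<zero>\<^bsub>M\<^esub>"]
  by (metis M.add.l_cancel_one' M.l_zero M.zero_closed)

lemma D_uminus:
  assumes "j < n" "x \<in> carrier M"
  shows "D j (\<ominus>\<^bsub>M\<^esub> x) = \<ominus>\<^bsub>M\<^esub> D j x"
proof -
  have "D j (\<ominus>\<^bsub>M\<^esub> x) \<oplus>\<^bsub>M\<^esub> D j x = \<zero>\<^bsub>M\<^esub>"
    using D_add[of j "\<ominus>\<^bsub>M\<^esub> x" x] D_zero assms by (simp add: M.l_neg)
  then show ?thesis using assms D_closed by (simp add: M.minus_equality)
qed

lemma D_minus: "\<lbrakk>j < n; x \<in> carrier M; y \<in> carrier M\<rbrakk> \<Longrightarrow> D j (x \<ominus>\<^bsub>M\<^esub> y) = D j x \<ominus>\<^bsub>M\<^esub> D j y"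
  by (simp add: M.minus_eq D_add D_uminus)

lemma D_finsum:
  assumes "j < n" "f \<in> S \<rightarrow> carrier M"
  shows "D j (\<Oplus>\<^bsub>M\<^esub>i\<in>S. f i) = (\<Oplus>\<^bsub>M\<^esub>i\<in>S. D j (f i))"
  using assms(2)
proof (induction S rule: infinite_finite_induct)
  case (insert x S)
  then have "(\<lambda>i. D j (f i)) \<in> S \<rightarrow> carrier M" using D_closed[OF assms(1)] by auto
  with insert show ?case by (simp add: D_add[OF assms(1)] D_closed[OF assms(1)] Pi_iff)
qed (simp_all add: D_zero[OF assms(1)])

lemma D_add_pow: "\<lbrakk>j < n; x \<in> carrier M\<rbrakk> \<Longrightarrow> D j ([(k::nat)] \<cdot>\<^bsub>M\<^esub> x) = [k] \<cdot>\<^bsub>M\<^esub> D j x"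
  by (induction k) (simp_all add: D_zero D_add D_closed)

lemma inverse_smult:
  assumes "q \<in> carrier R" "[(k::nat)] \<cdot>\<^bsub>R\<^esub> q = \<one>" "x \<in> carrier M"
  shows "q \<odot>\<^bsub>M\<^esub> ([k] \<cdot>\<^bsub>M\<^esub> x) = x" "[k] \<cdot>\<^bsub>M\<^esub> (q \<odot>\<^bsub>M\<^esub> x) = x"
  using add_pow_smult[OF assms(1,3), of k] assms by (simp_all add: smult_add_pow)

text \<open>No Leibniz rule for general scalars is at hand here, but q is the inverse of an integer
  k, and the additive map \<open>D j\<close> commutes with multiplication by k.\<close>

lemma D_inverse_smult:
  assumes "j < n" "q \<in> carrier R" "[(k::nat)] \<cdot>\<^bsub>R\<^esub> q = \<one>" "x \<in> carrier M"
  shows "D j (q \<odot>\<^bsub>M\<^esub> x) = q \<odot>\<^bsub>M\<^esub> D j x"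
proof -
  have "D j (q \<odot>\<^bsub>M\<^esub> x) = q \<odot>\<^bsub>M\<^esub> ([k] \<cdot>\<^bsub>M\<^esub> D j (q \<odot>\<^bsub>M\<^esub> x))"
    using assms by (simp add: inverse_smult D_closed)
  also have "\<dots> = q \<odot>\<^bsub>M\<^esub> D j x"
    using assms by (simp add: D_add_pow[symmetric] inverse_smult)
  finally show ?thesis .
qed

text \<open>In D_j (t_k y) = t_k D_j y + \<delta>_jk y the second term has lost one variable, and in
  the first one t_k makes up for the one that \<open>D j\<close> removes from y.\<close>

lemma D_F: "\<lbrakk>x \<in> F (Suc i); j < n\<rbrakk> \<Longrightarrow> D j x \<in> F i"
proof (induction i arbitrary: x)
  case 0
  then show ?case using D_closed F_carrier by (simp add: F_0)
next
  case (Suc i)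
  from Suc.prems(1) show ?case
  proof (induction rule: F_variable_induct)
    case (smult k y)
    have "t k \<odot>\<^bsub>M\<^esub> D j y \<in> F (Suc i)" using F_Suc_smult[OF Suc.IH[OF smult(2) Suc.prems(2)] t_in[OF smult(1)]] .
    then show ?case using smult F_zero Suc.prems(2) F_carrier by (simp add: D_smult F_add)
  next
    case zero
    show ?case using Suc.prems(2) by (simp add: D_zero F_zero)
  next
    case (add x y)
    then show ?case using F_carrier Suc.prems(2) by (simp add: D_add F_add)
  qed
qed

section \<open>The Euler operator and its eigenvalues\<close>

definition E where "E x = (\<Oplus>\<^bsub>M\<^esub>j\<in>{..<n}. t j \<odot>\<^bsub>M\<^esub> D j x)"

lemma tD_closed: "x \<in> carrier M \<Longrightarrow> (\<lambda>j. t j \<odot>\<^bsub>M\<^esub> D j x) \<in> {..<n} \<rightarrow> carrier M"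
  by (simp add: D_closed t_carrier)

lemma E_closed: "x \<in> carrier M \<Longrightarrow> E x \<in> carrier M"
  unfolding E_def by (rule M.finsum_closed[OF tD_closed])

lemma E_add: "\<lbrakk>x \<in> carrier M; y \<in> carrier M\<rbrakk> \<Longrightarrow> E (x \<oplus>\<^bsub>M\<^esub> y) = E x \<oplus>\<^bsub>M\<^esub> E y"
proof -
  assume xy: "x \<in> carrier M" "y \<in> carrier M"
  have "E (x \<oplus>\<^bsub>M\<^esub> y) = (\<Oplus>\<^bsub>M\<^esub>j\<in>{..<n}. t j \<odot>\<^bsub>M\<^esub> D j x \<oplus>\<^bsub>M\<^esub> t j \<odot>\<^bsub>M\<^esub> D j y)"
    unfolding E_def by (rule M.finsum_cong') (use xy in \<open>auto simp: D_add D_closed t_carrier smult_r_distr\<close>)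
  then show ?thesis unfolding E_def using xy tD_closed by (simp add: M.finsum_addf)
qed

lemma delta_sum:
  assumes "i < n" "y \<in> carrier M"
  shows "(\<Oplus>\<^bsub>M\<^esub>j\<in>{..<n}. t j \<odot>\<^bsub>M\<^esub> (if j = i then y else \<zero>\<^bsub>M\<^esub>)) = t i \<odot>\<^bsub>M\<^esub> y"
    and "(\<Oplus>\<^bsub>M\<^esub>j\<in>{..<n}. if i = j then y else \<zero>\<^bsub>M\<^esub>) = y"
proof -
  have "(\<Oplus>\<^bsub>M\<^esub>j\<in>{..<n}. t j \<odot>\<^bsub>M\<^esub> (if j = i then y else \<zero>\<^bsub>M\<^esub>))
      = (\<Oplus>\<^bsub>M\<^esub>j\<in>{..<n}. if j = i then t j \<odot>\<^bsub>M\<^esub> y else \<zero>\<^bsub>M\<^esub>)"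
    by (rule M.finsum_cong') (use assms t_carrier in auto)
  also have "\<dots> = t i \<odot>\<^bsub>M\<^esub> y"
    by (rule M.add.finprod_singleton_swap) (use assms t_carrier in auto)
  finally show "(\<Oplus>\<^bsub>M\<^esub>j\<in>{..<n}. t j \<odot>\<^bsub>M\<^esub> (if j = i then y else \<zero>\<^bsub>M\<^esub>)) = t i \<odot>\<^bsub>M\<^esub> y" .
  show "(\<Oplus>\<^bsub>M\<^esub>j\<in>{..<n}. if i = j then y else \<zero>\<^bsub>M\<^esub>) = y"
    by (rule M.add.finprod_singleton) (use assms in auto)
qed

lemma E_variable_smult:
  assumes i: "i < n" and y: "y \<in> carrier M"
  shows "E (t i \<odot>\<^bsub>M\<^esub> y) = t i \<odot>\<^bsub>M\<^esub> E y \<oplus>\<^bsub>M\<^esub> t i \<odot>\<^bsub>M\<^esub> y"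
proof -
  let ?d = "\<lambda>j. t j \<odot>\<^bsub>M\<^esub> (if j = i then y else \<zero>\<^bsub>M\<^esub>)"
  have c: "(\<lambda>j. t i \<odot>\<^bsub>M\<^esub> (t j \<odot>\<^bsub>M\<^esub> D j y)) \<in> {..<n} \<rightarrow> carrier M" "?d \<in> {..<n} \<rightarrow> carrier M"
    using assms by (auto simp: D_closed t_carrier)
  have "t j \<odot>\<^bsub>M\<^esub> D j (t i \<odot>\<^bsub>M\<^esub> y) = t i \<odot>\<^bsub>M\<^esub> (t j \<odot>\<^bsub>M\<^esub> D j y) \<oplus>\<^bsub>M\<^esub> ?d j" if "j < n" for j
    using that assms
    by (simp add: D_smult smult_r_distr D_closed t_carrier smult_assoc1[symmetric] R.m_comm)
  then have "E (t i \<odot>\<^bsub>M\<^esub> y) = (\<Oplus>\<^bsub>M\<^esub>j\<in>{..<n}. t i \<odot>\<^bsub>M\<^esub> (t j \<odot>\<^bsub>M\<^esub> D j y) \<oplus>\<^bsub>M\<^esub> ?d j)"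
    unfolding E_def using c by (intro M.finsum_cong') (auto simp: Pi_iff)
  also have "\<dots> = t i \<odot>\<^bsub>M\<^esub> E y \<oplus>\<^bsub>M\<^esub> t i \<odot>\<^bsub>M\<^esub> y"
    unfolding E_def M.finsum_addf[OF c] delta_sum(1)[OF assms]
    by (simp add: finsum_smult_ldistr[OF _ t_carrier[OF i] tD_closed[OF y]])
  finally show ?thesis .
qed

text \<open>The commutator of E with t_j is t_j, so each variable raises the eigenvalue by one: E
  (t_j y) - (i + 1) t_j y = t_j (E y - i y). In degree 0 the claim is only that \<open>E x\<close>
  lies in F^1.\<close>

lemma E_eigen: "x \<in> F i \<Longrightarrow> E x \<ominus>\<^bsub>M\<^esub> [i] \<cdot>\<^bsub>M\<^esub> x \<in> F (Suc i)"
proof (induction i arbitrary: x)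
  case 0
  then have x: "x \<in> carrier M" by (simp add: F_0)
  have "E x \<in> F (Suc 0)"
    unfolding E_def by (rule F_finsum) (use x F_Suc_smult F_0 D_closed t_in in auto)
  then show ?case using x F_minus[OF _ F_zero] by simp
next
  case (Suc i)
  from Suc.prems show ?case
  proof (induction rule: F_variable_induct)
    case (smult j y)
    then have y: "y \<in> carrier M" and t: "t j \<in> carrier R" using F_carrier t_carrier by auto
    have "E (t j \<odot>\<^bsub>M\<^esub> y) \<ominus>\<^bsub>M\<^esub> [Suc i] \<cdot>\<^bsub>M\<^esub> (t j \<odot>\<^bsub>M\<^esub> y) = t j \<odot>\<^bsub>M\<^esub> (E y \<ominus>\<^bsub>M\<^esub> [i] \<cdot>\<^bsub>M\<^esub> y)"
      using y t smult(1) E_closed[OF y]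
      by (subst smult_minus_distr) (auto simp: E_variable_smult smult_add_pow M.minus_ac)
    then show ?case using F_Suc_smult[OF Suc.IH[OF smult(2)] t_in[OF smult(1)]] by simp
  next
    case zero
    have "E \<zero>\<^bsub>M\<^esub> = \<zero>\<^bsub>M\<^esub>"
      unfolding E_def by (rule M.add.finprod_one_eqI) (simp add: D_zero t_carrier)
    then show ?case using F_minus[OF F_zero F_zero] by simp
  next
    case (add x y)
    have xy: "x \<in> carrier M" "y \<in> carrier M" using add F_carrier by auto
    have "E (x \<oplus>\<^bsub>M\<^esub> y) \<ominus>\<^bsub>M\<^esub> [Suc i] \<cdot>\<^bsub>M\<^esub> (x \<oplus>\<^bsub>M\<^esub> y) =
      (E x \<ominus>\<^bsub>M\<^esub> [Suc i] \<cdot>\<^bsub>M\<^esub> x) \<oplus>\<^bsub>M\<^esub> (E y \<ominus>\<^bsub>M\<^esub> [Suc i] \<cdot>\<^bsub>M\<^esub> y)"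
      using xy E_closed by (simp add: E_add M.add.nat_pow_distrib M.minus_ac del: M.add.nat_pow_Suc)
    then show ?case using add F_add by simp
  qed
qed

lemma F_divide:
  assumes "[(k::nat)] \<cdot>\<^bsub>M\<^esub> x \<in> F i" "0 < k" "x \<in> carrier M"
  shows "x \<in> F i"
proof -
  obtain q where "q \<in> carrier R" "[k] \<cdot>\<^bsub>R\<^esub> q = \<one>" using divisible assms(2) by blast
  then show ?thesis using F_smult[OF assms(1), of q] inverse_smult assms(3) by simp
qed

text \<open>Modulo F^(i+2), E x is zero, as each D_j x lies in F^(i+1) and gains a factor t_j; it is
  also (i + 1) x, and i + 1 is invertible. The index starts at \<open>Suc i\<close> because the
  eigenvalue in degree 0 is 0.\<close>

lemma F_Suc_of_D:
  assumes x: "x \<in> F (Suc i)" and D: "\<And>j. j < n \<Longrightarrow> D j x \<in> F (Suc i)"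
  shows "x \<in> F (Suc (Suc i))"
proof (rule F_divide)
  have xM: "x \<in> carrier M" using F_carrier[OF x] .
  have Ex: "E x \<in> F (Suc (Suc i))"
    unfolding E_def by (rule F_finsum) (use F_Suc_smult D t_in in auto)
  have "E x \<ominus>\<^bsub>M\<^esub> [Suc i] \<cdot>\<^bsub>M\<^esub> x \<in> F (Suc (Suc i))" using E_eigen[OF x] .
  from F_minus[OF Ex this] show "[Suc i] \<cdot>\<^bsub>M\<^esub> x \<in> F (Suc (Suc i))"
    using E_closed[OF xM] xM by (simp add: M.minus_ac del: M.add.nat_pow_Suc)
qed (use F_carrier[OF x] in auto)

text \<open>All derivatives vanish, so once the element is in F^1, \<open>F_Suc_of_D\<close> raises
  it without end.\<close>

lemma horizontal_F:
  assumes "x \<in> F (Suc 0)" "\<And>j. j < n \<Longrightarrow> D j x = \<zero>\<^bsub>M\<^esub>"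
  shows "x \<in> F i"
proof (cases i)
  case 0
  then show ?thesis using F_carrier[OF assms(1)] by (simp add: F_0)
next
  case (Suc k)
  have "x \<in> F (Suc k)"
    by (induction k) (use assms F_zero in \<open>auto intro: F_Suc_of_D\<close>)
  then show ?thesis using Suc by simp
qed

text \<open>Since the derivations commute, D_i (E s) = E (D_i s) + D_i s, and E is multiplication by
  k on D_i s modulo F^(k+1). So D_i (E s) is (k + 1) D_i s up to F^(k+1), which is where the divisor
  k + 1 comes from.\<close>

lemma horizontal_step:
  assumes comm: "\<And>i j x. \<lbrakk>i < n; j < n; x \<in> carrier M\<rbrakk> \<Longrightarrow> D i (D j x) = D j (D i x)"
    and s: "s \<in> carrier M" "\<And>j. j < n \<Longrightarrow> D j s \<in> F k"
  obtains s' where "s' \<in> carrier M" "\<And>j. j < n \<Longrightarrow> D j s' \<in> F (Suc k)" "s' \<ominus>\<^bsub>M\<^esub> s \<in> F (Suc k)"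
proof -
  obtain q where q: "q \<in> carrier R" "[Suc k] \<cdot>\<^bsub>R\<^esub> q = \<one>" using divisible by blast
  define s' where "s' = s \<ominus>\<^bsub>M\<^esub> q \<odot>\<^bsub>M\<^esub> E s"
  have Es: "E s \<in> F (Suc k)"
    unfolding E_def by (rule F_finsum) (use F_Suc_smult s t_in in auto)
  have s': "s' \<in> carrier M" unfolding s'_def using s q by (simp add: E_closed)
  have "s' \<ominus>\<^bsub>M\<^esub> s = \<ominus>\<^bsub>M\<^esub> (q \<odot>\<^bsub>M\<^esub> E s)"
    unfolding s'_def using s q E_closed[OF s(1)] by (simp add: M.minus_ac)
  then have 1: "s' \<ominus>\<^bsub>M\<^esub> s \<in> F (Suc k)" using F_uminus[OF F_smult[OF Es q(1)]] by simp
  have "D i s' \<in> F (Suc k)" if i: "i < n" for i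
  proof -
    have Dis: "D i s \<in> carrier M" by (rule D_closed[OF i s(1)])
    have "D i (E s) = (\<Oplus>\<^bsub>M\<^esub>j\<in>{..<n}. D i (t j \<odot>\<^bsub>M\<^esub> D j s))"
      unfolding E_def by (rule D_finsum[OF i tD_closed[OF s(1)]])
    also have "\<dots> = (\<Oplus>\<^bsub>M\<^esub>j\<in>{..<n}. t j \<odot>\<^bsub>M\<^esub> D j (D i s) \<oplus>\<^bsub>M\<^esub> (if i = j then D i s else \<zero>\<^bsub>M\<^esub>))"
      by (rule M.finsum_cong') (use i s Dis in \<open>auto simp: D_smult comm D_closed t_carrier\<close>)
    also have "\<dots> = E (D i s) \<oplus>\<^bsub>M\<^esub> D i s"
      unfolding E_def using delta_sum(2)[OF i Dis] tD_closed[OF Dis] Dis by (subst M.finsum_addf) auto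
    finally have DE: "D i (E s) = E (D i s) \<oplus>\<^bsub>M\<^esub> D i s" .
    have "D i s' = D i s \<ominus>\<^bsub>M\<^esub> q \<odot>\<^bsub>M\<^esub> D i (E s)"
      unfolding s'_def using i s q E_closed by (simp add: D_minus D_inverse_smult[OF i q])
    \<comment> \<open>With q = 1 / (k + 1) in front of both terms, q can be taken out, and what
      remains is the eigenvalue estimate for \<open>D i s\<close>.\<close>
    also have "D i s = q \<odot>\<^bsub>M\<^esub> ([Suc k] \<cdot>\<^bsub>M\<^esub> D i s)" using inverse_smult(1)[OF q Dis] by simp
    also have "q \<odot>\<^bsub>M\<^esub> ([Suc k] \<cdot>\<^bsub>M\<^esub> D i s) \<ominus>\<^bsub>M\<^esub> q \<odot>\<^bsub>M\<^esub> D i (E s)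
        = q \<odot>\<^bsub>M\<^esub> ([Suc k] \<cdot>\<^bsub>M\<^esub> D i s \<ominus>\<^bsub>M\<^esub> D i (E s))"
      using q Dis D_closed[OF i E_closed[OF s(1)]] by (subst smult_minus_distr) auto
    also have "[Suc k] \<cdot>\<^bsub>M\<^esub> D i s \<ominus>\<^bsub>M\<^esub> D i (E s) = \<ominus>\<^bsub>M\<^esub> (E (D i s) \<ominus>\<^bsub>M\<^esub> [k] \<cdot>\<^bsub>M\<^esub> D i s)"
      unfolding DE using Dis E_closed[OF Dis] by (simp add: M.minus_ac)
    finally show ?thesis using F_smult[OF F_uminus[OF E_eigen[OF s(2)[OF i]]] q(1)] by simp
  qed
  with 1 s' that show ?thesis by blast
qed

text \<open>The hypotheses \<open>separated\<close> and \<open>limit\<close> are the two halves of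
  completeness. The horizontal element is the limit of the corrections from
  \<open>horizontal_step\<close>, started at \<open>m\<close>.\<close>

lemma horizontal_approximation:
  assumes comm: "\<And>i j x. \<lbrakk>i < n; j < n; x \<in> carrier M\<rbrakk> \<Longrightarrow> D i (D j x) = D j (D i x)"
    and separated: "\<And>x. (\<And>i. x \<in> F i) \<Longrightarrow> x = \<zero>\<^bsub>M\<^esub>"
    and limit: "\<And>s. \<lbrakk>\<And>k. s k \<in> carrier M; \<And>k. s (Suc k) \<ominus>\<^bsub>M\<^esub> s k \<in> F k\<rbrakk>
      \<Longrightarrow> \<exists>l\<in>carrier M. \<forall>k. l \<ominus>\<^bsub>M\<^esub> s k \<in> F k"
    and m: "m \<in> carrier M"
  shows "\<exists>l\<in>carrier M. (\<forall>j<n. D j l = \<zero>\<^bsub>M\<^esub>) \<and> l \<ominus>\<^bsub>M\<^esub> m \<in> F (Suc 0)"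
proof -
  \<comment> \<open>The clause for k = 0 fixes the first term of the sequence as
    \<open>m\<close>.\<close>
  have "\<exists>s. \<forall>k. (s k \<in> carrier M \<and> (\<forall>j<n. D j (s k) \<in> F k) \<and> (k = 0 \<longrightarrow> s k = m)) \<and>
      s (Suc k) \<ominus>\<^bsub>M\<^esub> s k \<in> F (Suc k)"
  proof (rule dependent_nat_choice)
    show "\<exists>x. x \<in> carrier M \<and> (\<forall>j<n. D j x \<in> F 0) \<and> (0 = (0::nat) \<longrightarrow> x = m)"
      using m D_closed by (auto simp: F_0)
  next
    fix x k assume "x \<in> carrier M \<and> (\<forall>j<n. D j x \<in> F k) \<and> (k = 0 \<longrightarrow> x = m)"
    then obtain s' where "s' \<in> carrier M" "\<And>j. j < n \<Longrightarrow> D j s' \<in> F (Suc k)" "s' \<ominus>\<^bsub>M\<^esub> x \<in> F (Suc k)"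
      using horizontal_step[OF comm, of x k] by blast
    then show "\<exists>y. (y \<in> carrier M \<and> (\<forall>j<n. D j y \<in> F (Suc k)) \<and> (Suc k = 0 \<longrightarrow> y = m)) \<and>
        y \<ominus>\<^bsub>M\<^esub> x \<in> F (Suc k)" by blast
  qed
  then obtain s where s: "\<And>k. s k \<in> carrier M" "\<And>k j. j < n \<Longrightarrow> D j (s k) \<in> F k" "s 0 = m"
    "\<And>k. s (Suc k) \<ominus>\<^bsub>M\<^esub> s k \<in> F (Suc k)" by blast
  have "s (Suc k) \<ominus>\<^bsub>M\<^esub> s k \<in> F k" for k using s(4) F_Suc_subset by blast
  then obtain l where l: "l \<in> carrier M" "\<And>k. l \<ominus>\<^bsub>M\<^esub> s k \<in> F k" using limit[of s] s(1) by blast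
  have "D j l = \<zero>\<^bsub>M\<^esub>" if j: "j < n" for j
  proof (rule separated)
    \<comment> \<open>\<open>D_F\<close> loses one index, so \<open>l\<close> is compared with the
      term of index \<open>Suc i\<close>.\<close>
    fix i
    have "D j l \<ominus>\<^bsub>M\<^esub> D j (s (Suc i)) \<in> F i"
      using D_F[OF l(2)[of "Suc i"] j] l(1) s(1) j by (simp add: D_minus)
    moreover have "D j (s (Suc i)) \<in> F i" using s(2)[OF j] F_Suc_subset by blast
    ultimately show "D j l \<in> F i" using F_cong D_closed[OF j l(1)] by blast
  qed
  \<comment> \<open>Only the first step of the sequence matters: l - m = (l - s_1) + (s_1 - s_0),
    and both differences lie in F^1.\<close>
  moreover have "l \<ominus>\<^bsub>M\<^esub> m \<in> F (Suc 0)"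
    using F_trans[OF l(2)[of "Suc 0"] s(4)[of 0]] l(1) s(1) s(3) m by metis
  ultimately show ?thesis using l(1) by blast
qed

end

text \<open>The map \<phi> will be the evaluation B \<otimes> M^hor \<rightarrow> M. Each of the two
  main results below extends a statement modulo F^1 to all F^i: \<open>\<phi>_reflects_F\<close> by
  differentiation, \<open>\<phi>_dense\<close> by multiplication with the variables.\<close>

locale euler_module_hom = N: euler_module R N I n t D + M: euler_module R M I n t D'
  for R :: "('b, 'x) ring_scheme" and N :: "('b, 'k, 'w) module_scheme"
    and M :: "('b, 'm, 'y) module_scheme" and I n t D D' +
  fixes \<phi>
  assumes \<phi>_closed: "u \<in> carrier N \<Longrightarrow> \<phi> u \<in> carrier M"
    and \<phi>_add: "\<lbrakk>u \<in> carrier N; v \<in> carrier N\<rbrakk> \<Longrightarrow> \<phi> (u \<oplus>\<^bsub>N\<^esub> v) = \<phi> u \<oplus>\<^bsub>M\<^esub> \<phi> v"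
    and \<phi>_smult: "\<lbrakk>b \<in> carrier R; u \<in> carrier N\<rbrakk> \<Longrightarrow> \<phi> (b \<odot>\<^bsub>N\<^esub> u) = b \<odot>\<^bsub>M\<^esub> \<phi> u"
    and \<phi>_D: "\<lbrakk>j < n; u \<in> carrier N\<rbrakk> \<Longrightarrow> \<phi> (D j u) = D' j (\<phi> u)"
begin

lemma \<phi>_uminus:
  assumes u: "u \<in> carrier N" shows "\<phi> (\<ominus>\<^bsub>N\<^esub> u) = \<ominus>\<^bsub>M\<^esub> \<phi> u"
proof -
  have "\<ominus>\<^bsub>N\<^esub> u = (\<ominus>\<^bsub>R\<^esub> \<one>\<^bsub>R\<^esub>) \<odot>\<^bsub>N\<^esub> u" using u by (simp add: N.smult_l_minus)
  then show ?thesis using u \<phi>_closed by (simp add: \<phi>_smult M.smult_l_minus)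
qed

lemma \<phi>_minus: "\<lbrakk>u \<in> carrier N; v \<in> carrier N\<rbrakk> \<Longrightarrow> \<phi> (u \<ominus>\<^bsub>N\<^esub> v) = \<phi> u \<ominus>\<^bsub>M\<^esub> \<phi> v"
  by (simp add: a_minus_def \<phi>_add \<phi>_uminus)

lemma \<phi>_F: "u \<in> N.F i \<Longrightarrow> \<phi> u \<in> M.F i"
proof (induction rule: N.F_induct)
  case (smult b y)
  then show ?case using ideal.Icarr[OF N.I_pow smult(1)] by (simp add: \<phi>_smult M.F_incl \<phi>_closed)
next
  case (add x y)
  then show ?case using N.F_carrier by (simp add: \<phi>_add M.F_add)
qed

lemma \<phi>_reflects_F:
  assumes base: "\<And>u. \<lbrakk>u \<in> carrier N; \<phi> u \<in> M.F (Suc 0)\<rbrakk> \<Longrightarrow> u \<in> N.F (Suc 0)"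
  shows "\<lbrakk>u \<in> carrier N; \<phi> u \<in> M.F i\<rbrakk> \<Longrightarrow> u \<in> N.F i"
proof (induction i arbitrary: u)
  case 0
  then show ?case by (simp add: N.F_0)
next
  case (Suc i)
  show ?case
  proof (cases i)
    case 0
    then show ?thesis using base Suc.prems by simp
  next
    case (Suc k)
    have u: "u \<in> N.F (Suc k)" using Suc.IH Suc.prems M.F_Suc_subset Suc by blast
    have "D j u \<in> N.F (Suc k)" if j: "j < n" for j
      using Suc.IH[of "D j u"] \<open>u \<in> carrier N\<close> M.D_F[OF Suc.prems(2) j] j Suc
      by (simp add: N.D_closed \<phi>_D)
    with u show ?thesis using N.F_Suc_of_D Suc by blast
  qed
qed

text \<open>An element of F^i is a sum of elements of M multiplied by i variables; approximating
  these elements modulo F^1 approximates it modulo F^(i+1), which is \<open>graded\<close>. The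
  error of an approximation modulo F^i can then itself be approximated.\<close>

lemma \<phi>_dense:
  assumes base: "\<And>m. m \<in> carrier M \<Longrightarrow> \<exists>u\<in>carrier N. \<phi> u \<ominus>\<^bsub>M\<^esub> m \<in> M.F (Suc 0)"
    and m: "m \<in> carrier M"
  shows "\<exists>u\<in>carrier N. \<phi> u \<ominus>\<^bsub>M\<^esub> m \<in> M.F i"
proof -
  have graded: "\<exists>u\<in>carrier N. \<phi> u \<ominus>\<^bsub>M\<^esub> x \<in> M.F (Suc i)" if "x \<in> M.F i" for x i
    using that
  proof (induction i arbitrary: x)
    case 0
    then show ?case using base by (simp add: M.F_0)
  next
    case (Suc i)
    from Suc.prems show ?case
    proof (induction rule: M.F_variable_induct)
      case (smult j y)
      then obtain u where u: "u \<in> carrier N" "\<phi> u \<ominus>\<^bsub>M\<^esub> y \<in> M.F (Suc i)" using Suc.IH by blast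
      have "\<phi> (t j \<odot>\<^bsub>N\<^esub> u) \<ominus>\<^bsub>M\<^esub> t j \<odot>\<^bsub>M\<^esub> y = t j \<odot>\<^bsub>M\<^esub> (\<phi> u \<ominus>\<^bsub>M\<^esub> y)"
        using u M.F_carrier[OF smult(2)] M.t_carrier[OF smult(1)]
        by (simp add: \<phi>_smult \<phi>_closed M.smult_minus_distr)
      then show ?case using M.F_Suc_smult[OF u(2) M.t_in[OF smult(1)]] u(1) M.t_carrier[OF smult(1)]
        by (intro bexI[of _ "t j \<odot>\<^bsub>N\<^esub> u"]) auto
    next
      case zero
      have "\<phi> \<zero>\<^bsub>N\<^esub> = \<zero>\<^bsub>M\<^esub>"
        using \<phi>_smult[of "\<zero>\<^bsub>R\<^esub>" "\<zero>\<^bsub>N\<^esub>"] \<phi>_closed[of "\<zero>\<^bsub>N\<^esub>"] by simp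
      then show ?case using M.F_minus[OF M.F_zero M.F_zero] by (intro bexI[of _ "\<zero>\<^bsub>N\<^esub>"]) auto
    next
      case (add x y)
      then obtain u v where uv: "u \<in> carrier N" "\<phi> u \<ominus>\<^bsub>M\<^esub> x \<in> M.F (Suc (Suc i))"
        "v \<in> carrier N" "\<phi> v \<ominus>\<^bsub>M\<^esub> y \<in> M.F (Suc (Suc i))" by blast
      have "\<phi> (u \<oplus>\<^bsub>N\<^esub> v) \<ominus>\<^bsub>M\<^esub> (x \<oplus>\<^bsub>M\<^esub> y) = (\<phi> u \<ominus>\<^bsub>M\<^esub> x) \<oplus>\<^bsub>M\<^esub> (\<phi> v \<ominus>\<^bsub>M\<^esub> y)"
        using uv add M.F_carrier \<phi>_closed by (simp add: \<phi>_add M.minus_ac)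
      then show ?case using M.F_add[OF uv(2,4)] uv
        by (intro bexI[of _ "u \<oplus>\<^bsub>N\<^esub> v"]) auto
    qed
  qed
  show ?thesis
  proof (induction i)
    case 0
    have "\<phi> \<zero>\<^bsub>N\<^esub> \<ominus>\<^bsub>M\<^esub> m \<in> M.F 0" using m \<phi>_closed[of "\<zero>\<^bsub>N\<^esub>"] by (simp add: M.F_0)
    then show ?case by blast
  next
    case (Suc i)
    then obtain u where u: "u \<in> carrier N" "\<phi> u \<ominus>\<^bsub>M\<^esub> m \<in> M.F i" by blast
    obtain v where v: "v \<in> carrier N" "\<phi> v \<ominus>\<^bsub>M\<^esub> (\<phi> u \<ominus>\<^bsub>M\<^esub> m) \<in> M.F (Suc i)" using graded[OF u(2)] by blast
    \<comment> \<open>The element \<open>v\<close> approximates the error \<phi> u - m, so it is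
      subtracted from \<open>u\<close>.\<close>
    have "\<phi> (u \<ominus>\<^bsub>N\<^esub> v) \<ominus>\<^bsub>M\<^esub> m = \<ominus>\<^bsub>M\<^esub> (\<phi> v \<ominus>\<^bsub>M\<^esub> (\<phi> u \<ominus>\<^bsub>M\<^esub> m))"
      using u(1) v(1) m \<phi>_closed by (simp add: \<phi>_minus M.minus_ac)
    then show ?case using M.F_uminus[OF v(2)] u v
      by (intro bexI[of _ "u \<ominus>\<^bsub>N\<^esub> v"]) auto
  qed
qed

end

section \<open>Differential operators on power series\<close>

text \<open>Closure of the differential operators under sum and composition enters as the assumption
  that they form a ring; it is supplied by \<open>left_module\<close>, which includes
  \<open>ring\<close>.\<close>

locale diff_ring = power_series_ring A n + D: ring "diff_op_ring A (power_series A n)"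
  for A :: "('a, 'x) ring_scheme" (structure) and n :: nat
begin

abbreviation D where "D \<equiv> diff_op_ring A (power_series A n)"
abbreviation End where "End \<equiv> End_ring A (power_series A n)"
abbreviation T where "T \<equiv> mult_op (power_series A n)"
abbreviation P where "P \<equiv> partial A n"
abbreviation t where "t \<equiv> variable A n"

section \<open>Endomorphisms and differential operators, evaluated pointwise\<close>

lemma End_sel:
  "\<zero>\<^bsub>End\<^esub> = (\<lambda>x\<in>carrier B. \<zero>\<^bsub>B\<^esub>)" "\<one>\<^bsub>End\<^esub> = (\<lambda>x\<in>carrier B. x)"
  "\<theta> \<oplus>\<^bsub>End\<^esub> \<eta> = (\<lambda>x\<in>carrier B. \<theta> x \<oplus>\<^bsub>B\<^esub> \<eta> x)" "\<theta> \<otimes>\<^bsub>End\<^esub> \<eta> = compose (carrier B) \<theta> \<eta>"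
  by (simp_all add: End_ring_def)

lemma D_sel:
  "\<zero>\<^bsub>D\<^esub> = (\<lambda>x\<in>carrier B. \<zero>\<^bsub>B\<^esub>)" "\<one>\<^bsub>D\<^esub> = (\<lambda>x\<in>carrier B. x)"
  "\<theta> \<oplus>\<^bsub>D\<^esub> \<eta> = (\<lambda>x\<in>carrier B. \<theta> x \<oplus>\<^bsub>B\<^esub> \<eta> x)" "\<theta> \<otimes>\<^bsub>D\<^esub> \<eta> = compose (carrier B) \<theta> \<eta>"
  by (simp_all add: diff_op_ring_def End_ring_def)

lemma D_carrier: "carrier D = (\<Union>k. diff_ops A B k)"
  by (simp add: diff_op_ring_def)

lemma diff_ops_D: "\<theta> \<in> diff_ops A B k \<Longrightarrow> \<theta> \<in> carrier D"
  unfolding D_carrier by blast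

lemma End_iff:
  "\<theta> \<in> carrier End \<longleftrightarrow> \<theta> \<in> extensional (carrier B) \<and> (\<forall>x\<in>carrier B. \<theta> x \<in> carrier B) \<and>
    (\<forall>x\<in>carrier B. \<forall>y\<in>carrier B. \<theta> (x \<oplus>\<^bsub>B\<^esub> y) = \<theta> x \<oplus>\<^bsub>B\<^esub> \<theta> y) \<and>
    (\<forall>a\<in>carrier A. \<forall>x\<in>carrier B. \<theta> (a \<odot>\<^bsub>B\<^esub> x) = a \<odot>\<^bsub>B\<^esub> \<theta> x)"
  by (auto simp: End_ring_def lmodule_hom_def)

lemma diff_ops_End: "\<theta> \<in> diff_ops A B k \<Longrightarrow> \<theta> \<in> carrier End"
  by (cases k) auto

lemma D_End: "\<theta> \<in> carrier D \<Longrightarrow> \<theta> \<in> carrier End"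
  using diff_ops_End unfolding D_carrier by blast

lemma End_closed: "\<lbrakk>\<theta> \<in> carrier End; x \<in> carrier B\<rbrakk> \<Longrightarrow> \<theta> x \<in> carrier B"
  and End_add: "\<lbrakk>\<theta> \<in> carrier End; x \<in> carrier B; y \<in> carrier B\<rbrakk> \<Longrightarrow> \<theta> (x \<oplus>\<^bsub>B\<^esub> y) = \<theta> x \<oplus>\<^bsub>B\<^esub> \<theta> y"
  and End_smult: "\<lbrakk>\<theta> \<in> carrier End; a \<in> carrier A; x \<in> carrier B\<rbrakk> \<Longrightarrow> \<theta> (a \<odot>\<^bsub>B\<^esub> x) = a \<odot>\<^bsub>B\<^esub> \<theta> x"
  by (simp_all add: End_iff)

lemma End_eqI:
  "\<lbrakk>\<theta> \<in> carrier End; \<eta> \<in> carrier End; \<And>x. x \<in> carrier B \<Longrightarrow> \<theta> x = \<eta> x\<rbrakk> \<Longrightarrow> \<theta> = \<eta>"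
  unfolding End_iff by (blast intro: extensionalityI)

lemma B_add_interchange:
  "\<lbrakk>x \<in> carrier B; y \<in> carrier B; u \<in> carrier B; v \<in> carrier B\<rbrakk> \<Longrightarrow>
    x \<oplus>\<^bsub>B\<^esub> y \<oplus>\<^bsub>B\<^esub> (u \<oplus>\<^bsub>B\<^esub> v) = x \<oplus>\<^bsub>B\<^esub> u \<oplus>\<^bsub>B\<^esub> (y \<oplus>\<^bsub>B\<^esub> v)"
  by (simp add: B.a_ac)

text \<open>\<open>diff_ops\<close> subtracts operators in \<open>End\<close>; to evaluate such a
  difference at a series, additive inverses in \<open>End\<close> must be known to exist.\<close>

lemma End_abelian_group: "abelian_group End"
proof (rule abelian_groupI)
  show add: "\<theta> \<oplus>\<^bsub>End\<^esub> \<eta> \<in> carrier End" if "\<theta> \<in> carrier End" "\<eta> \<in> carrier End" for \<theta> \<eta>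
    using that unfolding End_sel by (auto simp: End_iff B_add_interchange B.smult_r_distr)
  show zero: "\<zero>\<^bsub>End\<^esub> \<in> carrier End"
    by (auto simp: End_iff End_sel)
  fix \<theta> assume th: "\<theta> \<in> carrier End"
  show "\<exists>\<eta>\<in>carrier End. \<eta> \<oplus>\<^bsub>End\<^esub> \<theta> = \<zero>\<^bsub>End\<^esub>"
  proof
    show "(\<lambda>x\<in>carrier B. \<ominus>\<^bsub>B\<^esub> \<theta> x) \<in> carrier End"
      using th by (auto simp: End_iff B.minus_add B.smult_r_minus B.a_comm)
    show "(\<lambda>x\<in>carrier B. \<ominus>\<^bsub>B\<^esub> \<theta> x) \<oplus>\<^bsub>End\<^esub> \<theta> = \<zero>\<^bsub>End\<^esub>"
      using th by (auto simp: End_iff End_sel B.l_neg)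
  qed
  show "\<zero>\<^bsub>End\<^esub> \<oplus>\<^bsub>End\<^esub> \<theta> = \<theta>"
    by (rule End_eqI[OF add[OF zero th] th]) (simp add: End_sel End_closed[OF th])
  fix \<eta> assume eta: "\<eta> \<in> carrier End"
  show "\<theta> \<oplus>\<^bsub>End\<^esub> \<eta> = \<eta> \<oplus>\<^bsub>End\<^esub> \<theta>"
    by (rule End_eqI) (use th eta add in \<open>auto simp: End_sel End_closed B.a_comm\<close>)
  fix \<zeta> assume zeta: "\<zeta> \<in> carrier End"
  show "\<theta> \<oplus>\<^bsub>End\<^esub> \<eta> \<oplus>\<^bsub>End\<^esub> \<zeta> = \<theta> \<oplus>\<^bsub>End\<^esub> (\<eta> \<oplus>\<^bsub>End\<^esub> \<zeta>)"
    by (rule End_eqI[OF add[OF add[OF th eta] zeta] add[OF th add[OF eta zeta]]])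
      (use th eta zeta in \<open>simp add: End_sel End_closed B.a_assoc\<close>)
qed

sublocale End: abelian_group "End_ring A (power_series A n)"
  by (rule End_abelian_group)

text \<open>Additive inverses are taken relative to the carrier, so those of \<open>End\<close> and
  of \<open>D\<close> are different terms. Each is inverse for pointwise addition and hence equals
  the pointwise inverse.\<close>

lemma pointwise_uminus:
  assumes "abelian_group S" "carrier S \<subseteq> carrier End" "\<theta> \<in> carrier S" "x \<in> carrier B"
    and "\<And>\<theta> \<eta>. \<theta> \<oplus>\<^bsub>S\<^esub> \<eta> = \<theta> \<oplus>\<^bsub>End\<^esub> \<eta>" "\<zero>\<^bsub>S\<^esub> = \<zero>\<^bsub>End\<^esub>"
  shows "(\<ominus>\<^bsub>S\<^esub> \<theta>) x = \<ominus>\<^bsub>B\<^esub> \<theta> x"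
proof -
  interpret S: abelian_group S by fact
  have "\<ominus>\<^bsub>S\<^esub> \<theta> \<in> carrier S" using assms(3) by simp
  then have c: "\<ominus>\<^bsub>S\<^esub> \<theta> \<in> carrier End" "\<theta> \<in> carrier End" using assms by auto
  have "(\<ominus>\<^bsub>S\<^esub> \<theta> \<oplus>\<^bsub>S\<^esub> \<theta>) x = \<zero>\<^bsub>S\<^esub> x" using S.l_neg[OF assms(3)] by simp
  then have "(\<ominus>\<^bsub>S\<^esub> \<theta>) x \<oplus>\<^bsub>B\<^esub> \<theta> x = \<zero>\<^bsub>B\<^esub>" using assms(4) by (simp add: assms(5,6) End_sel)
  then show ?thesis using B.minus_equality End_closed[OF c(1)] End_closed[OF c(2)] assms(4) by simp
qed

lemma End_minus_apply:
  "\<lbrakk>\<theta> \<in> carrier End; \<eta> \<in> carrier End; x \<in> carrier B\<rbrakk> \<Longrightarrow> (\<theta> \<ominus>\<^bsub>End\<^esub> \<eta>) x = \<theta> x \<ominus>\<^bsub>B\<^esub> \<eta> x"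
  using pointwise_uminus[OF End_abelian_group, of \<eta> x] by (simp add: a_minus_def End_sel)

lemma D_minus_apply:
  "\<lbrakk>\<theta> \<in> carrier D; \<eta> \<in> carrier D; x \<in> carrier B\<rbrakk> \<Longrightarrow> (\<theta> \<ominus>\<^bsub>D\<^esub> \<eta>) x = \<theta> x \<ominus>\<^bsub>B\<^esub> \<eta> x"
  using pointwise_uminus[OF D.abelian_group_axioms subsetI[OF D_End], of \<eta> x]
  by (simp add: a_minus_def D_sel End_sel)

lemma End_compose: "\<lbrakk>\<theta> \<in> carrier End; \<eta> \<in> carrier End\<rbrakk> \<Longrightarrow> \<theta> \<otimes>\<^bsub>End\<^esub> \<eta> \<in> carrier End"
  by (simp add: End_iff End_sel compose_def)

lemma mult_op_apply: "x \<in> carrier B \<Longrightarrow> T b x = b \<otimes>\<^bsub>B\<^esub> x"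
  by (simp add: mult_op_def)

lemma mult_op_diff_ops: "b \<in> carrier B \<Longrightarrow> T b \<in> diff_ops A B 0"
  by (auto simp: End_iff mult_op_def B.r_distr B.m_lcomm)
    (metis B.m_comm B.smult_assoc2 B.smult_closed)

lemma mult_op_D: "b \<in> carrier B \<Longrightarrow> T b \<in> carrier D"
  using mult_op_diff_ops diff_ops_D by blast

lemma partial_End: "j < n \<Longrightarrow> P j \<in> carrier End"
  by (auto simp: End_iff partial_closed partial_add partial_smult) (auto simp: partial_def)

text \<open>By the Leibniz rule the commutator of b and \<partial>_j is multiplication by
  -\<partial>_j b.\<close>

lemma partial_diff_ops:
  assumes j: "j < n" shows "P j \<in> diff_ops A B (Suc 0)"
proof -
  have "T b \<otimes>\<^bsub>End\<^esub> P j \<ominus>\<^bsub>End\<^esub> P j \<otimes>\<^bsub>End\<^esub> T b \<in> diff_ops A B 0" if b: "b \<in> carrier B" for b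
  proof -
    have c: "T b \<in> carrier End" using diff_ops_End[OF mult_op_diff_ops[OF b]] .
    have Pb: "P j b \<in> carrier B" by (rule partial_closed[OF b j])
    then have c': "T (\<ominus>\<^bsub>B\<^esub> P j b) \<in> carrier End" using diff_ops_End[OF mult_op_diff_ops] by simp
    have "T b \<otimes>\<^bsub>End\<^esub> P j \<ominus>\<^bsub>End\<^esub> P j \<otimes>\<^bsub>End\<^esub> T b = T (\<ominus>\<^bsub>B\<^esub> P j b)"
    proof (rule End_eqI)
      fix x assume x: "x \<in> carrier B"
      have "(T b \<otimes>\<^bsub>End\<^esub> P j \<ominus>\<^bsub>End\<^esub> P j \<otimes>\<^bsub>End\<^esub> T b) x = b \<otimes>\<^bsub>B\<^esub> P j x \<ominus>\<^bsub>B\<^esub> P j (b \<otimes>\<^bsub>B\<^esub> x)"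
        using c partial_End[OF j] x End_compose
        by (simp add: End_minus_apply) (simp add: End_sel compose_def mult_op_apply partial_closed[OF _ j])
      also have "\<dots> = \<ominus>\<^bsub>B\<^esub> P j b \<otimes>\<^bsub>B\<^esub> x"
        using b x Pb partial_closed[OF x j] by (simp add: partial_mult[OF b x j] B.minus_ac B.l_minus)
      finally show "(T b \<otimes>\<^bsub>End\<^esub> P j \<ominus>\<^bsub>End\<^esub> P j \<otimes>\<^bsub>End\<^esub> T b) x = T (\<ominus>\<^bsub>B\<^esub> P j b) x"
        using x by (simp add: mult_op_apply)
    qed (use c c' partial_End[OF j] End_compose in auto)
    then show ?thesis using mult_op_diff_ops Pb by simp
  qed
  then show ?thesis using partial_End[OF j] by simp
qed

lemma partial_D: "j < n \<Longrightarrow> P j \<in> carrier D"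
  using partial_diff_ops diff_ops_D by blast

lemma D_apply_closed: "\<lbrakk>\<theta> \<in> carrier D; x \<in> carrier B\<rbrakk> \<Longrightarrow> \<theta> x \<in> carrier B"
  using D_End End_closed by blast

lemma D_eqI:
  "\<lbrakk>\<theta> \<in> carrier D; \<eta> \<in> carrier D; \<And>x. x \<in> carrier B \<Longrightarrow> \<theta> x = \<eta> x\<rbrakk> \<Longrightarrow> \<theta> = \<eta>"
  using D_End End_eqI by blast

lemma D_mult_apply: "x \<in> carrier B \<Longrightarrow> (\<theta> \<otimes>\<^bsub>D\<^esub> \<eta>) x = \<theta> (\<eta> x)"
  and D_add_apply: "x \<in> carrier B \<Longrightarrow> (\<theta> \<oplus>\<^bsub>D\<^esub> \<eta>) x = \<theta> x \<oplus>\<^bsub>B\<^esub> \<eta> x"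
  and D_zero_apply: "x \<in> carrier B \<Longrightarrow> \<zero>\<^bsub>D\<^esub> x = \<zero>\<^bsub>B\<^esub>"
  and D_one_apply: "x \<in> carrier B \<Longrightarrow> \<one>\<^bsub>D\<^esub> x = x"
  by (simp_all add: D_sel compose_def)

lemmas D_apply = D_mult_apply D_add_apply D_zero_apply D_one_apply mult_op_apply

section \<open>Relations between multiplications and derivations\<close>

lemma mult_op_add: "\<lbrakk>b \<in> carrier B; c \<in> carrier B\<rbrakk> \<Longrightarrow> T (b \<oplus>\<^bsub>B\<^esub> c) = T b \<oplus>\<^bsub>D\<^esub> T c"
  by (rule D_eqI) (simp_all add: D_apply mult_op_D B.l_distr)

lemma mult_op_mult: "\<lbrakk>b \<in> carrier B; c \<in> carrier B\<rbrakk> \<Longrightarrow> T (b \<otimes>\<^bsub>B\<^esub> c) = T b \<otimes>\<^bsub>D\<^esub> T c"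
  by (rule D_eqI) (simp_all add: D_apply mult_op_D B.m_assoc)

lemma mult_op_one: "T \<one>\<^bsub>B\<^esub> = \<one>\<^bsub>D\<^esub>"
  by (rule D_eqI) (simp_all add: D_apply mult_op_D)

lemma mult_op_zero: "T \<zero>\<^bsub>B\<^esub> = \<zero>\<^bsub>D\<^esub>"
  by (rule D_eqI) (simp_all add: D_apply mult_op_D)

lemma partial_mult_op:
  "\<lbrakk>j < n; b \<in> carrier B\<rbrakk> \<Longrightarrow> P j \<otimes>\<^bsub>D\<^esub> T b = T b \<otimes>\<^bsub>D\<^esub> P j \<oplus>\<^bsub>D\<^esub> T (P j b)"
  by (rule D_eqI) (simp_all add: D_apply mult_op_D partial_D partial_closed partial_mult B.a_comm)

lemma partial_variable_op:
  "\<lbrakk>i < n; j < n\<rbrakk> \<Longrightarrow> P i \<otimes>\<^bsub>D\<^esub> T (t j) = T (t j) \<otimes>\<^bsub>D\<^esub> P i \<oplus>\<^bsub>D\<^esub> (if i = j then \<one>\<^bsub>D\<^esub> else \<zero>\<^bsub>D\<^esub>)"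
  by (simp add: partial_mult_op variable_closed partial_variable mult_op_one mult_op_zero)

lemma partial_partial_op: "\<lbrakk>i < n; j < n\<rbrakk> \<Longrightarrow> P i \<otimes>\<^bsub>D\<^esub> P j = P j \<otimes>\<^bsub>D\<^esub> P i"
  by (rule D_eqI) (simp_all add: D_apply partial_D partial_partial_commute)

section \<open>Commutators with multiplications and the order of an operator\<close>

definition comm :: "((nat \<Rightarrow> nat) \<Rightarrow> 'a) \<Rightarrow> (((nat \<Rightarrow> nat) \<Rightarrow> 'a) \<Rightarrow> ((nat \<Rightarrow> nat) \<Rightarrow> 'a)) \<Rightarrow> ((nat \<Rightarrow> nat) \<Rightarrow> 'a) \<Rightarrow> ((nat \<Rightarrow> nat) \<Rightarrow> 'a)"
  where "comm b \<theta> = T b \<otimes>\<^bsub>D\<^esub> \<theta> \<ominus>\<^bsub>D\<^esub> \<theta> \<otimes>\<^bsub>D\<^esub> T b"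

lemma comm_closed: "\<lbrakk>b \<in> carrier B; \<theta> \<in> carrier D\<rbrakk> \<Longrightarrow> comm b \<theta> \<in> carrier D"
  by (simp add: comm_def mult_op_D)

text \<open>\<open>diff_ops\<close> forms the commutator in \<open>End\<close>, \<open>comm\<close>
  forms it in \<open>D\<close>; the two agree because both differences are pointwise.\<close>

lemma comm_diff_ops:
  assumes th: "\<theta> \<in> diff_ops A B (Suc k)" and b: "b \<in> carrier B"
  shows "comm b \<theta> \<in> diff_ops A B k"
proof -
  have c: "\<theta> \<in> carrier D" "T b \<in> carrier D" using diff_ops_D[OF th] mult_op_D[OF b] .
  have "comm b \<theta> = T b \<otimes>\<^bsub>End\<^esub> \<theta> \<ominus>\<^bsub>End\<^esub> \<theta> \<otimes>\<^bsub>End\<^esub> T b"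
  proof (rule End_eqI)
    show "comm b \<theta> \<in> carrier End" using D_End comm_closed c b by blast
    show "T b \<otimes>\<^bsub>End\<^esub> \<theta> \<ominus>\<^bsub>End\<^esub> \<theta> \<otimes>\<^bsub>End\<^esub> T b \<in> carrier End" using D_End End_compose c by simp
    fix x assume x: "x \<in> carrier B"
    show "comm b \<theta> x = (T b \<otimes>\<^bsub>End\<^esub> \<theta> \<ominus>\<^bsub>End\<^esub> \<theta> \<otimes>\<^bsub>End\<^esub> T b) x"
      using x c D_End End_compose
      by (simp add: comm_def D_minus_apply End_minus_apply) (simp add: D_sel End_sel)
  qed
  then show ?thesis using th b by simp
qed

lemma comm_diff_ops_0:
  assumes "\<theta> \<in> diff_ops A B 0" "b \<in> carrier B" shows "comm b \<theta> = \<zero>\<^bsub>D\<^esub>"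
proof (rule D_eqI)
  have c: "\<theta> \<in> carrier D" using diff_ops_D[OF assms(1)] .
  then show "comm b \<theta> \<in> carrier D" using comm_closed assms by blast
  fix x assume "x \<in> carrier B"
  then show "comm b \<theta> x = \<zero>\<^bsub>D\<^esub> x"
    using assms c D_apply_closed[OF c] by (simp add: comm_def D_minus_apply mult_op_D D_apply B.r_neg B.minus_eq)
qed simp

lemma comm_add: "\<lbrakk>b \<in> carrier B; \<theta> \<in> carrier D; \<eta> \<in> carrier D\<rbrakk> \<Longrightarrow> comm b (\<theta> \<oplus>\<^bsub>D\<^esub> \<eta>) = comm b \<theta> \<oplus>\<^bsub>D\<^esub> comm b \<eta>"
  by (simp add: comm_def mult_op_D D.r_distr D.l_distr D.minus_ac)

lemma comm_zero: "b \<in> carrier B \<Longrightarrow> comm b \<zero>\<^bsub>D\<^esub> = \<zero>\<^bsub>D\<^esub>"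
  by (simp add: comm_def mult_op_D D.minus_eq)

lemma comm_add_pow: "\<lbrakk>b \<in> carrier B; \<theta> \<in> carrier D\<rbrakk> \<Longrightarrow> comm b ([(k::nat)] \<cdot>\<^bsub>D\<^esub> \<theta>) = [k] \<cdot>\<^bsub>D\<^esub> comm b \<theta>"
  by (induction k) (simp_all add: comm_add comm_zero)

lemma comm_finsum:
  assumes "b \<in> carrier B" "f \<in> S \<rightarrow> carrier D"
  shows "comm b (\<Oplus>\<^bsub>D\<^esub>i\<in>S. f i) = (\<Oplus>\<^bsub>D\<^esub>i\<in>S. comm b (f i))"
  using assms(2)
proof (induction S rule: infinite_finite_induct)
  case (insert x S)
  then have "(\<lambda>i. comm b (f i)) \<in> S \<rightarrow> carrier D" using comm_closed[OF assms(1)] by auto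
  with insert show ?case by (simp add: comm_add assms(1) comm_closed Pi_iff)
qed (simp_all add: comm_zero assms(1))

lemma comm_comm:
  assumes "b \<in> carrier B" "c \<in> carrier B" and th: "\<theta> \<in> carrier D"
  shows "comm b (comm c \<theta>) = comm c (comm b \<theta>)"
proof -
  have T: "T b \<in> carrier D" "T c \<in> carrier D" using assms mult_op_D by auto
  have bc: "T b \<otimes>\<^bsub>D\<^esub> T c = T c \<otimes>\<^bsub>D\<^esub> T b"
    using assms by (simp add: mult_op_mult[symmetric] B.m_comm)
  have "T b \<otimes>\<^bsub>D\<^esub> (T c \<otimes>\<^bsub>D\<^esub> \<theta>) = T c \<otimes>\<^bsub>D\<^esub> (T b \<otimes>\<^bsub>D\<^esub> \<theta>)"
    using T th bc by (simp add: D.m_assoc[symmetric])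
  then show ?thesis using T th bc
    by (simp add: comm_def D.minus_eq D.r_distr D.l_distr D.r_minus D.l_minus D.minus_add D.m_assoc D.a_ac)
qed

lemma comm_mult_partial:
  assumes i: "i < n" and j: "j < n" and th: "\<theta> \<in> carrier D"
  shows "comm (t i) (\<theta> \<otimes>\<^bsub>D\<^esub> P j) = comm (t i) \<theta> \<otimes>\<^bsub>D\<^esub> P j \<ominus>\<^bsub>D\<^esub> (if i = j then \<theta> else \<zero>\<^bsub>D\<^esub>)"
proof -
  have T: "T (t i) \<in> carrier D" "P j \<in> carrier D" using mult_op_D variable_closed partial_D[OF j] by auto
  have "\<theta> \<otimes>\<^bsub>D\<^esub> P j \<otimes>\<^bsub>D\<^esub> T (t i) = \<theta> \<otimes>\<^bsub>D\<^esub> T (t i) \<otimes>\<^bsub>D\<^esub> P j \<oplus>\<^bsub>D\<^esub> (if i = j then \<theta> else \<zero>\<^bsub>D\<^esub>)"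
    using T th by (simp add: D.m_assoc partial_variable_op[OF j i] D.r_distr)
  then show ?thesis using T th
    by (simp add: comm_def D.minus_ac D.l_distr D.l_minus D.m_assoc)
qed

text \<open>The counterpart of the Euler operator for the filtration by order: modulo operators of
  lower order, \<open>op_euler\<close> is multiplication by \<open>-k\<close> on operators of order \<open>k\<close>.\<close>

definition op_euler :: "(((nat \<Rightarrow> nat) \<Rightarrow> 'a) \<Rightarrow> ((nat \<Rightarrow> nat) \<Rightarrow> 'a)) \<Rightarrow> ((nat \<Rightarrow> nat) \<Rightarrow> 'a) \<Rightarrow> ((nat \<Rightarrow> nat) \<Rightarrow> 'a)"
  where "op_euler \<theta> = (\<Oplus>\<^bsub>D\<^esub>j\<in>{..<n}. comm (t j) \<theta> \<otimes>\<^bsub>D\<^esub> P j)"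

lemma op_euler_summand: "\<theta> \<in> carrier D \<Longrightarrow> (\<lambda>j. comm (t j) \<theta> \<otimes>\<^bsub>D\<^esub> P j) \<in> {..<n} \<rightarrow> carrier D"
  by (simp add: comm_closed variable_closed partial_D)

lemma op_euler_closed: "\<theta> \<in> carrier D \<Longrightarrow> op_euler \<theta> \<in> carrier D"
  unfolding op_euler_def by (rule D.finsum_closed[OF op_euler_summand])

text \<open>The counterpart of \<open>E_variable_smult\<close>: the commutator of t_i with
  \<partial>_j is -1 for i = j and 0 otherwise, so passing to commutators with t_i shifts
  \<open>op_euler\<close> by -1.\<close>

lemma comm_op_euler:
  assumes i: "i < n" and th: "\<theta> \<in> carrier D"
  shows "comm (t i) (op_euler \<theta>) = op_euler (comm (t i) \<theta>) \<ominus>\<^bsub>D\<^esub> comm (t i) \<theta>"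
proof -
  have Ci: "comm (t i) \<theta> \<in> carrier D" using comm_closed variable_closed th by blast
  let ?d = "\<lambda>j. if i = j then \<ominus>\<^bsub>D\<^esub> comm (t j) \<theta> else \<zero>\<^bsub>D\<^esub>"
  have "comm (t i) (op_euler \<theta>) = (\<Oplus>\<^bsub>D\<^esub>j\<in>{..<n}. comm (t i) (comm (t j) \<theta> \<otimes>\<^bsub>D\<^esub> P j))"
    unfolding op_euler_def by (rule comm_finsum[OF variable_closed op_euler_summand[OF th]])
  also have "\<dots> = (\<Oplus>\<^bsub>D\<^esub>j\<in>{..<n}. comm (t j) (comm (t i) \<theta>) \<otimes>\<^bsub>D\<^esub> P j \<oplus>\<^bsub>D\<^esub> ?d j)"
    by (rule D.finsum_cong')
      (use i th in \<open>auto simp: comm_mult_partial comm_closed variable_closed partial_D D.minus_eq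
        comm_comm[OF variable_closed variable_closed th, of i]\<close>)
  also have "\<dots> = op_euler (comm (t i) \<theta>) \<oplus>\<^bsub>D\<^esub> (\<Oplus>\<^bsub>D\<^esub>j\<in>{..<n}. ?d j)"
    unfolding op_euler_def
    by (rule D.finsum_addf[OF op_euler_summand[OF Ci]]) (use th in \<open>auto simp: comm_closed variable_closed\<close>)
  also have "(\<Oplus>\<^bsub>D\<^esub>j\<in>{..<n}. ?d j) = \<ominus>\<^bsub>D\<^esub> comm (t i) \<theta>"
    by (rule D.add.finprod_singleton) (use i th in \<open>auto simp: comm_closed variable_closed\<close>)
  finally show ?thesis by (simp add: D.minus_eq)
qed

text \<open>The order is tested on the variables alone, since these are the series that
  \<open>comm_op_euler\<close> speaks of. The index is shifted: stage \<open>Suc k\<close> contains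
  the operators of order at most k, and stage 0 is zero, so that \<open>op_euler_order\<close> makes
  sense for order 0 too.\<close>

primrec ops_order :: "nat \<Rightarrow> (((nat \<Rightarrow> nat) \<Rightarrow> 'a) \<Rightarrow> ((nat \<Rightarrow> nat) \<Rightarrow> 'a)) set" where
  "ops_order 0 = {\<zero>\<^bsub>D\<^esub>}"
| "ops_order (Suc k) = {\<theta> \<in> carrier D. \<forall>j<n. comm (t j) \<theta> \<in> ops_order k}"

lemma diff_ops_ops_order: "\<theta> \<in> diff_ops A B k \<Longrightarrow> \<theta> \<in> ops_order (Suc k)"
proof (induction k arbitrary: \<theta>)
  case 0
  then show ?case using comm_diff_ops_0[OF 0 variable_closed] diff_ops_D[OF 0] by simp
next
  case (Suc k)
  have "comm (t j) \<theta> \<in> ops_order (Suc k)" for j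
    by (rule Suc.IH[OF comm_diff_ops[OF Suc.prems variable_closed]])
  moreover have "\<theta> \<in> carrier D" using diff_ops_D[OF Suc.prems] .
  ultimately show ?case by simp
qed

text \<open>The commutator of t_i with \<open>op_euler \<theta>\<close> + (k + 1) \<theta> is the
  same expression with k in place of k + 1 for the commutator of t_i with \<theta>; the shift in
  \<open>comm_op_euler\<close> absorbs the difference.\<close>

lemma op_euler_order:
  "\<theta> \<in> ops_order (Suc k) \<Longrightarrow> op_euler \<theta> \<oplus>\<^bsub>D\<^esub> [k] \<cdot>\<^bsub>D\<^esub> \<theta> \<in> ops_order k"
proof (induction k arbitrary: \<theta>)
  case 0
  have "op_euler \<theta> = \<zero>\<^bsub>D\<^esub>"
    unfolding op_euler_def by (rule D.add.finprod_one_eqI) (use 0 in \<open>auto simp: partial_D\<close>)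
  with 0 show ?case by simp
next
  case (Suc k)
  then have th: "\<theta> \<in> carrier D" by simp
  have "comm (t i) (op_euler \<theta> \<oplus>\<^bsub>D\<^esub> [Suc k] \<cdot>\<^bsub>D\<^esub> \<theta>) \<in> ops_order k" if i: "i < n" for i
  proof -
    have Ci: "comm (t i) \<theta> \<in> carrier D" using comm_closed variable_closed th by blast
    have "comm (t i) (op_euler \<theta> \<oplus>\<^bsub>D\<^esub> [Suc k] \<cdot>\<^bsub>D\<^esub> \<theta>)
        = op_euler (comm (t i) \<theta>) \<ominus>\<^bsub>D\<^esub> comm (t i) \<theta> \<oplus>\<^bsub>D\<^esub> [Suc k] \<cdot>\<^bsub>D\<^esub> comm (t i) \<theta>"
      using th op_euler_closed[OF th] by (subst comm_add) (simp_all add: variable_closed comm_add_pow comm_op_euler[OF i] del: D.add.nat_pow_Suc)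
    also have "\<dots> = op_euler (comm (t i) \<theta>) \<oplus>\<^bsub>D\<^esub> [k] \<cdot>\<^bsub>D\<^esub> comm (t i) \<theta>"
      using Ci op_euler_closed[OF Ci] by (simp add: D.minus_ac)
    finally show ?thesis using Suc.IH[of "comm (t i) \<theta>"] Suc.prems i by simp
  qed
  then show ?case using th op_euler_closed[OF th] by simp
qed

lemma finsum_additive:
  assumes "abelian_group G" and \<delta>: "\<And>x y. \<lbrakk>x \<in> carrier B; y \<in> carrier B\<rbrakk> \<Longrightarrow> \<delta> (x \<oplus>\<^bsub>B\<^esub> y) = \<delta> x \<oplus>\<^bsub>G\<^esub> \<delta> y"
    "\<And>x. x \<in> carrier B \<Longrightarrow> \<delta> x \<in> carrier G" and f: "f \<in> S \<rightarrow> carrier B"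
  shows "\<delta> (\<Oplus>\<^bsub>B\<^esub>i\<in>S. f i) = (\<Oplus>\<^bsub>G\<^esub>i\<in>S. \<delta> (f i))"
proof -
  interpret G: abelian_group G by fact
  have z: "\<delta> \<zero>\<^bsub>B\<^esub> = \<zero>\<^bsub>G\<^esub>"
    using \<delta>(1)[of "\<zero>\<^bsub>B\<^esub>" "\<zero>\<^bsub>B\<^esub>"] \<delta>(2)[of "\<zero>\<^bsub>B\<^esub>"] by (metis B.l_zero B.zero_closed G.add.l_cancel_one')
  show ?thesis using f
  proof (induction S rule: infinite_finite_induct)
    case (insert x S)
    then have "(\<lambda>i. \<delta> (f i)) \<in> S \<rightarrow> carrier G" using \<delta>(2) by auto
    with insert show ?case by (simp add: \<delta> Pi_iff)
  qed (simp_all add: z)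
qed

text \<open>Commuting with the variables gives linearity over polynomials, and no continuity of
  \<theta> is known that would extend it to series. The defect \<delta> x = \<theta> x - x
  \<theta>(1) is additive, commutes with the t_j and kills constants. Writing x = a + \<Sum> t_j g_j
  yields \<delta> x = \<Sum> t_j (\<delta> g_j), so if all values of \<delta> vanish to degree k,
  they vanish to degree k + 1, and hence \<delta> is zero.\<close>

lemma ops_order_1:
  assumes "\<theta> \<in> ops_order (Suc 0)"
  shows "\<theta> = T (\<theta> \<one>\<^bsub>B\<^esub>)"
proof (rule D_eqI)
  from assms show th: "\<theta> \<in> carrier D" by simp
  note thE = D_End[OF th]
  have th1: "\<theta> \<one>\<^bsub>B\<^esub> \<in> carrier B" using D_apply_closed[OF th] by simp
  then show "T (\<theta> \<one>\<^bsub>B\<^esub>) \<in> carrier D" by (rule mult_op_D)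
  have tt: "\<theta> (t j \<otimes>\<^bsub>B\<^esub> x) = t j \<otimes>\<^bsub>B\<^esub> \<theta> x" if "j < n" "x \<in> carrier B" for j x
  proof -
    have "comm (t j) \<theta> x = \<zero>\<^bsub>B\<^esub>" using assms that by (simp add: D_apply)
    then have "t j \<otimes>\<^bsub>B\<^esub> \<theta> x \<ominus>\<^bsub>B\<^esub> \<theta> (t j \<otimes>\<^bsub>B\<^esub> x) = \<zero>\<^bsub>B\<^esub>"
      using that th by (simp add: comm_def D_minus_apply mult_op_D variable_closed D_apply D_apply_closed)
    then show ?thesis using that th D_apply_closed variable_closed by simp
  qed
  define \<delta> where "\<delta> x = \<theta> x \<ominus>\<^bsub>B\<^esub> x \<otimes>\<^bsub>B\<^esub> \<theta> \<one>\<^bsub>B\<^esub>" for x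
  have \<delta>_closed: "\<delta> x \<in> carrier B" if "x \<in> carrier B" for x
    using that th1 D_apply_closed[OF th] by (simp add: \<delta>_def)
  have \<delta>_add: "\<delta> (x \<oplus>\<^bsub>B\<^esub> y) = \<delta> x \<oplus>\<^bsub>B\<^esub> \<delta> y" if "x \<in> carrier B" "y \<in> carrier B" for x y
    using that th1 D_apply_closed[OF th] by (simp add: \<delta>_def End_add[OF thE] B.l_distr B.minus_ac)
  have \<delta>_t: "\<delta> (t j \<otimes>\<^bsub>B\<^esub> x) = t j \<otimes>\<^bsub>B\<^esub> \<delta> x" if "j < n" "x \<in> carrier B" for j x
    using that th1 D_apply_closed[OF th]
    by (simp add: \<delta>_def tt variable_closed B.minus_eq B.r_distr B.r_minus B.m_assoc)
  have \<delta>_const: "\<delta> (a \<odot>\<^bsub>B\<^esub> \<one>\<^bsub>B\<^esub>) = \<zero>\<^bsub>B\<^esub>" if "a \<in> carrier A" for a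
    using that th1 by (simp add: \<delta>_def End_smult[OF thE] B.smult_assoc2 B.r_neg B.minus_eq)
  have "\<delta> x \<in> vanishing k" if "x \<in> carrier B" for x k
    using that
  proof (induction k arbitrary: x)
    case 0
    then show ?case using \<delta>_closed by (simp add: vanishing_def)
  next
    case (Suc k)
    obtain g where g: "\<And>j. g j \<in> carrier B"
      "x = x (\<lambda>_. 0) \<odot>\<^bsub>B\<^esub> \<one>\<^bsub>B\<^esub> \<oplus>\<^bsub>B\<^esub> (\<Oplus>\<^bsub>B\<^esub>j\<in>{..<n}. t j \<otimes>\<^bsub>B\<^esub> g j)"
      using power_series_decomp[OF Suc.prems] by blast
    have x0: "x (\<lambda>_. 0) \<in> carrier A" using power_series_coeff[OF Suc.prems exponents_zero] .
    have tg: "(\<lambda>j. t j \<otimes>\<^bsub>B\<^esub> g j) \<in> {..<n} \<rightarrow> carrier B" using g variable_closed by auto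
    have "\<delta> x = \<delta> (x (\<lambda>_. 0) \<odot>\<^bsub>B\<^esub> \<one>\<^bsub>B\<^esub>) \<oplus>\<^bsub>B\<^esub> \<delta> (\<Oplus>\<^bsub>B\<^esub>j\<in>{..<n}. t j \<otimes>\<^bsub>B\<^esub> g j)"
      by (subst g(2), rule \<delta>_add) (use x0 B.finsum_closed[OF tg] in auto)
    also have "\<dots> = \<delta> (\<Oplus>\<^bsub>B\<^esub>j\<in>{..<n}. t j \<otimes>\<^bsub>B\<^esub> g j)"
      using \<delta>_const[OF x0] \<delta>_closed B.finsum_closed[OF tg] by simp
    also have "\<dots> = (\<Oplus>\<^bsub>B\<^esub>j\<in>{..<n}. \<delta> (t j \<otimes>\<^bsub>B\<^esub> g j))"
      by (rule finsum_additive[OF power_series_abelian_group \<delta>_add \<delta>_closed tg])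
    also have "\<dots> \<in> vanishing (Suc k)"
      by (rule vanishing_finsum)
        (use g(1) in \<open>auto simp: \<delta>_t intro!: vanishing_variable_mult Suc.IH\<close>)
    finally show ?case .
  qed
  then have \<delta>_0: "\<delta> x = \<zero>\<^bsub>B\<^esub>" if "x \<in> carrier B" for x using vanishing_separated that by blast
  show "\<theta> x = T (\<theta> \<one>\<^bsub>B\<^esub>) x" if "x \<in> carrier B" for x
    using \<delta>_0[OF that] that th1 D_apply_closed[OF th that]
    by (simp add: \<delta>_def D_apply B.m_comm)
qed

end

lemma rational_inverse:
  assumes "cring A" "contains_rationals A" "0 < (k::nat)"
  shows "\<exists>q\<in>carrier A. [k] \<cdot>\<^bsub>A\<^esub> q = \<one>\<^bsub>A\<^esub>"
proof -
  interpret cring A by fact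
  obtain h where h: "h \<in> ring_hom (ring_of_type_algebra :: rat ring) A"
    using assms(2) unfolding contains_rationals_def by blast
  have hc: "h x \<in> carrier A" for x
    using ring_hom_closed[OF h] by (simp add: ring_of_type_algebra_def)
  have ha: "h (x + y) = h x \<oplus>\<^bsub>A\<^esub> h y" for x y
    using ring_hom_add[OF h, of x y] by (simp add: ring_of_type_algebra_def)
  have h1: "h 1 = \<one>\<^bsub>A\<^esub>"
    using ring_hom_one[OF h] by (simp add: ring_of_type_algebra_def)
  have h0: "h 0 = \<zero>\<^bsub>A\<^esub>"
    using ha[of 0 0] hc[of 0] by (metis add.l_cancel_one' add_0 zero_closed)
  have "[m] \<cdot>\<^bsub>A\<^esub> h x = h (of_nat m * x)" for m :: nat and x
    by (induction m) (simp_all add: h0 ha[symmetric] algebra_simps)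
  from this[of k "1 / of_nat k"] have "[k] \<cdot>\<^bsub>A\<^esub> h (1 / of_nat k) = \<one>\<^bsub>A\<^esub>"
    using assms(3) h1 by simp
  with hc show ?thesis by blast
qed

section \<open>Left modules over the differential operators\<close>

locale diff_module = power_series_ring A n + DM: left_module "diff_op_ring A (power_series A n)" M
  for A :: "('a, 'x) ring_scheme" (structure) and n :: nat
    and M :: "(((nat \<Rightarrow> nat) \<Rightarrow> 'a) \<Rightarrow> ((nat \<Rightarrow> nat) \<Rightarrow> 'a), 'm, 'z) module_scheme" +
  assumes rationals: "contains_rationals A"

sublocale diff_module \<subseteq> diff_ring A n
  by unfold_locales

context diff_module begin

abbreviation U where "U \<equiv> underlying_module (power_series A n) M"

lemma U_sel:
  "carrier U = carrier M" "x \<oplus>\<^bsub>U\<^esub> y = x \<oplus>\<^bsub>M\<^esub> y" "\<zero>\<^bsub>U\<^esub> = \<zero>\<^bsub>M\<^esub>" "b \<odot>\<^bsub>U\<^esub> x = T b \<odot>\<^bsub>M\<^esub> x"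
  "\<ominus>\<^bsub>U\<^esub> x = \<ominus>\<^bsub>M\<^esub> x" "x \<ominus>\<^bsub>U\<^esub> y = x \<ominus>\<^bsub>M\<^esub> y" "[(k::nat)] \<cdot>\<^bsub>U\<^esub> x = [k] \<cdot>\<^bsub>M\<^esub> x"
  by (simp_all add: underlying_module_def restrict_scalars_def a_minus_def a_inv_def m_inv_def
      add_pow_def nat_pow_def)

lemma U_abelian_group: "abelian_group U"
proof (rule abelian_groupI)
  fix x assume "x \<in> carrier U"
  then show "\<exists>y\<in>carrier U. y \<oplus>\<^bsub>U\<^esub> x = \<zero>\<^bsub>U\<^esub>"
    by (intro bexI[of _ "\<ominus>\<^bsub>M\<^esub> x"]) (simp_all add: U_sel DM.M.l_neg)
qed (simp_all add: U_sel DM.M.a_ac)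

lemma U_module: "module B U"
  by (rule moduleI[OF power_series_cring U_abelian_group])
    (simp_all add: U_sel DM.smult_closed DM.smult_l_distr DM.smult_r_distr DM.smult_assoc DM.smult_one
      mult_op_D mult_op_add mult_op_mult mult_op_one)

lemma D_zero_smult: "x \<in> carrier M \<Longrightarrow> \<zero>\<^bsub>D\<^esub> \<odot>\<^bsub>M\<^esub> x = \<zero>\<^bsub>M\<^esub>"
  using DM.smult_l_distr[of "\<zero>\<^bsub>D\<^esub>" "\<zero>\<^bsub>D\<^esub>" x] DM.smult_closed[of "\<zero>\<^bsub>D\<^esub>" x]
  by (metis DM.R.l_zero DM.R.zero_closed DM.M.add.l_cancel_one')

lemma D_smult_zero: "\<theta> \<in> carrier D \<Longrightarrow> \<theta> \<odot>\<^bsub>M\<^esub> \<zero>\<^bsub>M\<^esub> = \<zero>\<^bsub>M\<^esub>"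
  using DM.smult_r_distr[of \<theta> "\<zero>\<^bsub>M\<^esub>" "\<zero>\<^bsub>M\<^esub>"] DM.smult_closed[of \<theta> "\<zero>\<^bsub>M\<^esub>"]
  by (metis DM.M.l_zero DM.M.zero_closed DM.M.add.l_cancel_one')

lemma D_smult_uminus:
  assumes "\<theta> \<in> carrier D" "x \<in> carrier M"
  shows "\<theta> \<odot>\<^bsub>M\<^esub> (\<ominus>\<^bsub>M\<^esub> x) = \<ominus>\<^bsub>M\<^esub> (\<theta> \<odot>\<^bsub>M\<^esub> x)"
proof -
  have "\<theta> \<odot>\<^bsub>M\<^esub> (\<ominus>\<^bsub>M\<^esub> x) \<oplus>\<^bsub>M\<^esub> \<theta> \<odot>\<^bsub>M\<^esub> x = \<zero>\<^bsub>M\<^esub>"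
    using assms by (simp add: DM.smult_r_distr[symmetric] DM.M.l_neg D_smult_zero)
  then show ?thesis using assms DM.smult_closed by (simp add: DM.M.minus_equality)
qed

lemma D_smult_minus:
  "\<lbrakk>\<theta> \<in> carrier D; x \<in> carrier M; y \<in> carrier M\<rbrakk> \<Longrightarrow> \<theta> \<odot>\<^bsub>M\<^esub> (x \<ominus>\<^bsub>M\<^esub> y) = \<theta> \<odot>\<^bsub>M\<^esub> x \<ominus>\<^bsub>M\<^esub> \<theta> \<odot>\<^bsub>M\<^esub> y"
  by (simp add: DM.M.minus_eq DM.smult_r_distr D_smult_uminus)

lemma D_add_pow_smult:
  "\<lbrakk>\<theta> \<in> carrier D; x \<in> carrier M\<rbrakk> \<Longrightarrow> ([(k::nat)] \<cdot>\<^bsub>D\<^esub> \<theta>) \<odot>\<^bsub>M\<^esub> x = [k] \<cdot>\<^bsub>M\<^esub> (\<theta> \<odot>\<^bsub>M\<^esub> x)"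
  by (induction k) (simp_all add: D_zero_smult DM.smult_l_distr)

lemma divisible_B:
  assumes "0 < (k::nat)" shows "\<exists>q\<in>carrier B. [k] \<cdot>\<^bsub>B\<^esub> q = \<one>\<^bsub>B\<^esub>"
proof -
  obtain q where q: "q \<in> carrier A" "[k] \<cdot>\<^bsub>A\<^esub> q = \<one>"
    using rational_inverse[OF is_cring rationals assms] by blast
  have "[k] \<cdot>\<^bsub>B\<^esub> (q \<odot>\<^bsub>B\<^esub> \<one>\<^bsub>B\<^esub>) = \<one>\<^bsub>B\<^esub>"
    using B.add_pow_smult[OF q(1), of "\<one>\<^bsub>B\<^esub>" k] q(2) by simp
  then show ?thesis using q(1) by (intro bexI[of _ "q \<odot>\<^bsub>B\<^esub> \<one>\<^bsub>B\<^esub>"]) auto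
qed

lemma U_euler_module: "euler_module B U (variable_ideal A n) n t (\<lambda>j x. P j \<odot>\<^bsub>M\<^esub> x)"
proof (intro euler_module.intro adic_module.intro adic_module_axioms.intro euler_module_axioms.intro)
  show "module B U" by (rule U_module)
  show "ideal (variable_ideal A n) B" by (rule variable_ideal_ideal)
  show "\<exists>g. (\<forall>j. g j \<in> carrier B) \<and> b = (\<Oplus>\<^bsub>B\<^esub>j\<in>{..<n}. t j \<otimes>\<^bsub>B\<^esub> g j)" if b: "b \<in> variable_ideal A n" for b
  proof -
    obtain g where "\<And>j. g j \<in> carrier B" "b = (\<Oplus>\<^bsub>B\<^esub>j\<in>{..<n}. t j \<otimes>\<^bsub>B\<^esub> g j)"
      using variable_ideal_decomp[OF b] by blast
    then show ?thesis by (intro exI[of _ g]) simp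
  qed
  show "P i \<odot>\<^bsub>M\<^esub> (t j \<odot>\<^bsub>U\<^esub> x) = t j \<odot>\<^bsub>U\<^esub> (P i \<odot>\<^bsub>M\<^esub> x) \<oplus>\<^bsub>U\<^esub> (if i = j then x else \<zero>\<^bsub>U\<^esub>)"
    if ij: "i < n" "j < n" "x \<in> carrier U" for i j x
  proof -
    have x: "x \<in> carrier M" using ij by (simp add: U_sel)
    have c: "P i \<in> carrier D" "T (t j) \<in> carrier D" using partial_D ij mult_op_D variable_closed by auto
    have "P i \<odot>\<^bsub>M\<^esub> (T (t j) \<odot>\<^bsub>M\<^esub> x) = (P i \<otimes>\<^bsub>D\<^esub> T (t j)) \<odot>\<^bsub>M\<^esub> x"
      using c x by (simp add: DM.smult_assoc)
    also have "\<dots> = T (t j) \<odot>\<^bsub>M\<^esub> (P i \<odot>\<^bsub>M\<^esub> x) \<oplus>\<^bsub>M\<^esub> (if i = j then \<one>\<^bsub>D\<^esub> else \<zero>\<^bsub>D\<^esub>) \<odot>\<^bsub>M\<^esub> x"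
      unfolding partial_variable_op[OF ij(1,2)] using c x by (simp add: DM.smult_assoc DM.smult_l_distr)
    finally show ?thesis using x by (simp add: U_sel DM.smult_one D_zero_smult)
  qed
qed (use divisible_B variable_in_variable_ideal in
    \<open>auto simp: U_sel DM.smult_closed DM.smult_r_distr partial_D\<close>)

sublocale U: euler_module "power_series A n" "underlying_module (power_series A n) M"
  "variable_ideal A n" n "variable A n" "\<lambda>j x. partial A n j \<odot>\<^bsub>M\<^esub> x"
  by (rule U_euler_module)

lemma partial_smult_commute:
  "\<lbrakk>i < n; j < n; x \<in> carrier M\<rbrakk> \<Longrightarrow> P i \<odot>\<^bsub>M\<^esub> (P j \<odot>\<^bsub>M\<^esub> x) = P j \<odot>\<^bsub>M\<^esub> (P i \<odot>\<^bsub>M\<^esub> x)"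
  by (simp add: DM.smult_assoc[symmetric] partial_D partial_partial_op)

text \<open>Continuity, by induction on the order and then on i, from \<theta> (b y) = b (\<theta>
  y) - [b, \<theta>] y. In the first term b restores the factor taken from the argument; in the
  second the order has dropped by one instead. An operator of order 0 is multiplication by a
  series.\<close>

lemma diff_ops_smult_F:
  "\<lbrakk>\<theta> \<in> diff_ops A B k; x \<in> U.F (i + k)\<rbrakk> \<Longrightarrow> \<theta> \<odot>\<^bsub>M\<^esub> x \<in> U.F i"
proof (induction k arbitrary: \<theta> i x)
  case 0
  have th: "\<theta> \<in> carrier D" using diff_ops_D[OF 0(1)] .
  have "\<theta> = T (\<theta> \<one>\<^bsub>B\<^esub>)" using ops_order_1 diff_ops_ops_order[OF 0(1)] by blast
  then have "\<theta> \<odot>\<^bsub>M\<^esub> x = \<theta> \<one>\<^bsub>B\<^esub> \<odot>\<^bsub>U\<^esub> x" by (simp add: U_sel)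
  then show ?case using U.F_smult[of x i "\<theta> \<one>\<^bsub>B\<^esub>"] 0 D_apply_closed[OF th] by simp
next
  case (Suc k)
  have th: "\<theta> \<in> carrier D" using diff_ops_D[OF Suc.prems(1)] .
  from Suc.prems(2) show ?case
  proof (induction i arbitrary: x)
    case 0
    then show ?case using U.F_carrier DM.smult_closed[OF th] by (simp add: U.F_0 U_sel)
  next
    case (Suc i)
    from Suc.prems have "x \<in> U.F (Suc (i + Suc k))" by simp
    then show ?case
    proof (induction rule: U.F_Suc_induct)
      case (smult b y)
      have y: "y \<in> carrier M" using U.F_carrier[OF smult(2)] by (simp add: U_sel)
      have b: "b \<in> carrier B" using ideal.Icarr[OF variable_ideal_ideal smult(1)] .
      note Tb = mult_op_D[OF b]
      have "comm b \<theta> \<oplus>\<^bsub>D\<^esub> \<theta> \<otimes>\<^bsub>D\<^esub> T b = T b \<otimes>\<^bsub>D\<^esub> \<theta>"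
        using Tb th by (simp add: comm_def DM.R.minus_eq DM.R.a_assoc DM.R.l_neg)
      then have "T b \<odot>\<^bsub>M\<^esub> (\<theta> \<odot>\<^bsub>M\<^esub> y) = comm b \<theta> \<odot>\<^bsub>M\<^esub> y \<oplus>\<^bsub>M\<^esub> \<theta> \<odot>\<^bsub>M\<^esub> (T b \<odot>\<^bsub>M\<^esub> y)"
        using Tb th y comm_closed[OF b th] DM.smult_l_distr[of "comm b \<theta>" "\<theta> \<otimes>\<^bsub>D\<^esub> T b" y]
        by (simp add: DM.smult_assoc)
      then have eq: "\<theta> \<odot>\<^bsub>M\<^esub> (b \<odot>\<^bsub>U\<^esub> y) = b \<odot>\<^bsub>U\<^esub> (\<theta> \<odot>\<^bsub>M\<^esub> y) \<ominus>\<^bsub>U\<^esub> comm b \<theta> \<odot>\<^bsub>M\<^esub> y"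
        using DM.smult_closed[OF comm_closed[OF b th] y] DM.smult_closed[OF th DM.smult_closed[OF Tb y]]
        by (simp add: U_sel DM.M.minus_ac)
      have "\<theta> \<odot>\<^bsub>M\<^esub> y \<in> U.F i" using Suc.IH smult(2) by simp
      then have "b \<odot>\<^bsub>U\<^esub> (\<theta> \<odot>\<^bsub>M\<^esub> y) \<in> U.F (Suc i)" using U.F_Suc_smult smult(1) by blast
      \<comment> \<open>The induction hypothesis on the order is quoted in full, since
        \<open>Suc.IH\<close> now names the one on i.\<close>
      moreover have "comm b \<theta> \<odot>\<^bsub>M\<^esub> y \<in> U.F (Suc i)"
        using \<open>\<And>\<theta> i x. \<lbrakk>\<theta> \<in> diff_ops A B k; x \<in> U.F (i + k)\<rbrakk> \<Longrightarrow> \<theta> \<odot>\<^bsub>M\<^esub> x \<in> U.F i\<close>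
          comm_diff_ops[OF \<open>\<theta> \<in> diff_ops A B (Suc k)\<close> b] smult(2) by simp
      ultimately show ?case unfolding eq by (rule U.F_minus)
    next
      case (add x y)
      then have "x \<in> carrier M" "y \<in> carrier M" using U.F_carrier U_sel by auto
      then show ?case using U.F_add[OF add(3,4)] by (simp add: U_sel DM.smult_r_distr[OF th])
    qed
  qed
qed

text \<open>Both l and the series 1 are killed by the \<partial>_j, hence by
  \<open>op_euler \<theta>\<close>. So \<open>H\<close> = \<open>op_euler \<theta>\<close> + (k + 1)
  \<theta> acts on each of them as (k + 1) \<theta>, while having smaller order. The induction
  hypothesis for \<open>H\<close> gives the claim up to the invertible factor k + 1.\<close>

lemma ops_order_horizontal:
  assumes l: "l \<in> carrier M" "\<And>j. j < n \<Longrightarrow> P j \<odot>\<^bsub>M\<^esub> l = \<zero>\<^bsub>M\<^esub>"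
  shows "\<theta> \<in> ops_order (Suc k) \<Longrightarrow> \<theta> \<odot>\<^bsub>M\<^esub> l = T (\<theta> \<one>\<^bsub>B\<^esub>) \<odot>\<^bsub>M\<^esub> l"
proof (induction k arbitrary: \<theta>)
  case 0
  show ?case by (rule arg_cong[of _ _ "\<lambda>\<theta>. \<theta> \<odot>\<^bsub>M\<^esub> l", OF ops_order_1[OF 0]])
next
  case (Suc k)
  then have th: "\<theta> \<in> carrier D" by simp
  have th1: "\<theta> \<one>\<^bsub>B\<^esub> \<in> carrier B" using D_apply_closed[OF th] by simp
  \<comment> \<open>Every summand of \<open>op_euler \<theta>\<close> applies some \<partial>_j
    first.\<close>
  have ann: "(\<Oplus>\<^bsub>D\<^esub>j\<in>S. comm (t j) \<theta> \<otimes>\<^bsub>D\<^esub> P j) \<odot>\<^bsub>M\<^esub> l = \<zero>\<^bsub>M\<^esub> \<and>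
      (\<Oplus>\<^bsub>D\<^esub>j\<in>S. comm (t j) \<theta> \<otimes>\<^bsub>D\<^esub> P j) \<one>\<^bsub>B\<^esub> = \<zero>\<^bsub>B\<^esub>" if "finite S" "S \<subseteq> {..<n}" for S
    using that
  proof (induction S rule: finite_induct)
    case empty
    show ?case using l by (simp add: D_zero_smult D_apply)
  next
    case (insert j S)
    have c: "(\<lambda>j. comm (t j) \<theta> \<otimes>\<^bsub>D\<^esub> P j) \<in> S \<rightarrow> carrier D" "j < n" "P j \<in> carrier D" "comm (t j) \<theta> \<in> carrier D"
      using insert op_euler_summand[OF th] comm_closed[OF variable_closed th] partial_D by auto
    have "comm (t j) \<theta> (P j \<one>\<^bsub>B\<^esub>) = \<zero>\<^bsub>B\<^esub>"
      using D_apply_closed[OF c(4), of "\<zero>\<^bsub>B\<^esub>"] End_add[OF D_End[OF c(4)], of "\<zero>\<^bsub>B\<^esub>" "\<zero>\<^bsub>B\<^esub>"] partial_one[OF c(2)]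
      by (metis B.add.l_cancel_one' B.l_zero B.zero_closed)
    then show ?case using insert c l
      by (simp add: DM.smult_l_distr DM.R.finsum_closed DM.smult_assoc D_smult_zero D_apply)
  qed
  define H where "H = op_euler \<theta> \<oplus>\<^bsub>D\<^esub> [Suc k] \<cdot>\<^bsub>D\<^esub> \<theta>"
  have "H \<in> ops_order (Suc k)" unfolding H_def by (rule op_euler_order[OF Suc.prems])
  then have H: "H \<odot>\<^bsub>M\<^esub> l = T (H \<one>\<^bsub>B\<^esub>) \<odot>\<^bsub>M\<^esub> l" by (rule Suc.IH)
  have e: "op_euler \<theta> \<odot>\<^bsub>M\<^esub> l = \<zero>\<^bsub>M\<^esub>" "op_euler \<theta> \<one>\<^bsub>B\<^esub> = \<zero>\<^bsub>B\<^esub>"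
    using ann[of "{..<n}"] by (simp_all add: op_euler_def)
  have "([m] \<cdot>\<^bsub>D\<^esub> \<theta>) \<one>\<^bsub>B\<^esub> = [m] \<cdot>\<^bsub>B\<^esub> \<theta> \<one>\<^bsub>B\<^esub>" for m :: nat
    by (induction m) (simp_all add: D_apply)
  then have "H \<one>\<^bsub>B\<^esub> = [Suc k] \<cdot>\<^bsub>B\<^esub> \<theta> \<one>\<^bsub>B\<^esub>"
    unfolding H_def using e(2) th1 by (simp add: D_apply del: DM.R.add.nat_pow_Suc B.add.nat_pow_Suc)
  then have "T (H \<one>\<^bsub>B\<^esub>) \<odot>\<^bsub>M\<^esub> l = [Suc k] \<cdot>\<^bsub>M\<^esub> (T (\<theta> \<one>\<^bsub>B\<^esub>) \<odot>\<^bsub>M\<^esub> l)"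
    using U.add_pow_smult[of "\<theta> \<one>\<^bsub>B\<^esub>" l "Suc k"] th1 l(1) by (simp add: U_sel)
  moreover have "H \<odot>\<^bsub>M\<^esub> l = [Suc k] \<cdot>\<^bsub>M\<^esub> (\<theta> \<odot>\<^bsub>M\<^esub> l)"
    unfolding H_def using th l op_euler_closed[OF th] e(1)
    by (simp add: DM.smult_l_distr D_add_pow_smult DM.smult_closed del: DM.R.add.nat_pow_Suc DM.M.add.nat_pow_Suc)
  ultimately have eq: "[Suc k] \<cdot>\<^bsub>M\<^esub> (\<theta> \<odot>\<^bsub>M\<^esub> l) = [Suc k] \<cdot>\<^bsub>M\<^esub> (T (\<theta> \<one>\<^bsub>B\<^esub>) \<odot>\<^bsub>M\<^esub> l)" using H by simp
  obtain q where q: "q \<in> carrier B" "[Suc k] \<cdot>\<^bsub>B\<^esub> q = \<one>\<^bsub>B\<^esub>" using divisible_B by blast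
  have "q \<odot>\<^bsub>U\<^esub> ([Suc k] \<cdot>\<^bsub>U\<^esub> (\<theta> \<odot>\<^bsub>M\<^esub> l)) = q \<odot>\<^bsub>U\<^esub> ([Suc k] \<cdot>\<^bsub>U\<^esub> (T (\<theta> \<one>\<^bsub>B\<^esub>) \<odot>\<^bsub>M\<^esub> l))"
    using eq by (simp add: U_sel)
  then show ?case
    using U.inverse_smult(1)[OF q] DM.smult_closed[OF th l(1)] DM.smult_closed[OF mult_op_D[OF th1] l(1)]
    by (simp add: U_sel)
qed

text \<open>This is \<open>ops_order_horizontal\<close> for the composite of \<theta> with
  multiplication by b, whose value at 1 is \<theta> b.\<close>

lemma horizontal_smult:
  assumes "l \<in> carrier M" "\<And>j. j < n \<Longrightarrow> P j \<odot>\<^bsub>M\<^esub> l = \<zero>\<^bsub>M\<^esub>" and th: "\<theta> \<in> carrier D" and b: "b \<in> carrier B"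
  shows "\<theta> \<odot>\<^bsub>M\<^esub> (b \<odot>\<^bsub>U\<^esub> l) = \<theta> b \<odot>\<^bsub>U\<^esub> l"
proof -
  have "\<theta> \<otimes>\<^bsub>D\<^esub> T b \<in> carrier D" using th mult_op_D[OF b] by simp
  then obtain k where "\<theta> \<otimes>\<^bsub>D\<^esub> T b \<in> ops_order (Suc k)" using diff_ops_ops_order D_carrier by blast
  from ops_order_horizontal[OF assms(1,2) this]
  show ?thesis using th b assms(1) by (simp add: U_sel DM.smult_assoc mult_op_D D_apply)
qed

end

section \<open>The tensor product as a module over the differential operators\<close>

locale power_series_tensor = diff_ring A n + L: module A L
  for A :: "('a, 'x) ring_scheme" (structure) and n :: nat and L :: "('a, 'l, 'y) module_scheme"
begin

abbreviation FG where "FG \<equiv> free_Abelian_group (carrier (power_series A n) \<times> carrier L)"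
abbreviation K where "K \<equiv> tensor_kernel A (power_series A n) L"
abbreviation N where "N \<equiv> tensor_product A (power_series A n) L"

text \<open>The coset is written as a translate in the additive group of formal sums, so that
  equality of classes becomes membership of a difference in the kernel.\<close>

definition cl where "cl u = (\<lambda>k. k + u) ` K"
definition pure where "pure x l = cl (frag_of (x, l))"
definition act where "act \<theta> = frag_extend (\<lambda>(x, l). frag_of (\<theta> x, l))"

lemma relations_closed: "r \<in> tensor_relations A B L \<Longrightarrow> r \<in> carrier FG"
proof -
  assume "r \<in> tensor_relations A B L"
  moreover have "frag_of (x, l) - (frag_of (y, m) + frag_of (z, k)) \<in> carrier FG"
    "frag_of (x, l) - frag_of (y, m) \<in> carrier FG"
    if "(x, l) \<in> carrier B \<times> carrier L" "(y, m) \<in> carrier B \<times> carrier L" "(z, k) \<in> carrier B \<times> carrier L"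
    for x y z l m k
    using that keys_diff[of "frag_of (x, l)" "frag_of (y, m) + frag_of (z, k)"]
      keys_diff[of "frag_of (x, l)" "frag_of (y, m)"] keys_add[of "frag_of (y, m)" "frag_of (z, k)"]
    by (auto simp: keys_frag_of)
  ultimately show ?thesis
    unfolding tensor_relations_def by (elim UnE CollectE exE conjE) (simp_all del: carrier_free_Abelian_group_iff)
qed

lemma kernel_subgroup: "subgroup K FG"
  unfolding tensor_kernel_def
  by (rule group.generate_is_subgroup[OF group_free_Abelian_group]) (use relations_closed in auto)

lemma kernel_closed: "k \<in> K \<Longrightarrow> k \<in> carrier FG"
  using subgroup.subset[OF kernel_subgroup] by blast

lemma kernel_zero: "0 \<in> K"
  using subgroup.one_closed[OF kernel_subgroup] by simp

lemma kernel_add: "\<lbrakk>k \<in> K; k' \<in> K\<rbrakk> \<Longrightarrow> k + k' \<in> K"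
  using subgroup.m_closed[OF kernel_subgroup] by simp

lemma kernel_uminus: "k \<in> K \<Longrightarrow> - k \<in> K"
  using subgroup.m_inv_closed[OF kernel_subgroup, of k] kernel_closed[of k] by simp

lemma kernel_diff: "\<lbrakk>k \<in> K; k' \<in> K\<rbrakk> \<Longrightarrow> k - k' \<in> K"
  using kernel_add[OF _ kernel_uminus, of k k'] by simp

lemma kernel_incl: "r \<in> tensor_relations A B L \<Longrightarrow> r \<in> K"
  unfolding tensor_kernel_def by (rule generate.incl)

lemma kernel_induct [consumes 1, case_names rel zero add uminus]:
  assumes "k \<in> K" "\<And>r. r \<in> tensor_relations A B L \<Longrightarrow> Q r" "Q 0"
    "\<And>u v. \<lbrakk>u \<in> carrier FG; v \<in> carrier FG; Q u; Q v\<rbrakk> \<Longrightarrow> Q (u + v)"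
    "\<And>u. \<lbrakk>u \<in> carrier FG; Q u\<rbrakk> \<Longrightarrow> Q (- u)"
  shows "Q k"
  using assms(1)[unfolded tensor_kernel_def]
proof (induction k rule: generate.induct)
  case (inv h)
  then show ?case using assms(2,5) relations_closed[OF inv] by simp
next
  case (eng u v)
  then have "u \<in> carrier FG" "v \<in> carrier FG"
    using kernel_closed unfolding tensor_kernel_def by blast+
  then show ?case using assms(4) eng by simp
qed (use assms in simp_all)

lemma cl_eq_iff: "cl u = cl v \<longleftrightarrow> u - v \<in> K"
proof
  assume "cl u = cl v"
  then have "u \<in> cl v" using kernel_zero by (force simp: cl_def)
  then show "u - v \<in> K" by (auto simp: cl_def)
next
  assume uv: "u - v \<in> K"
  have "k + u = (k + (u - v)) + v" "k + v = (k - (u - v)) + u" for k by simp_all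
  then show "cl u = cl v"
    unfolding cl_def using kernel_add[OF _ uv] kernel_diff[OF _ uv] by blast
qed

lemma mem_cl_iff: "v \<in> cl u \<longleftrightarrow> v - u \<in> K"
  unfolding cl_def by (force simp: image_iff)

lemma coset_cl: "K #>\<^bsub>FG\<^esub> u = cl u"
  by (auto simp: cl_def r_coset_def)

lemma tensor_carrier: "carrier N = cl ` carrier FG"
proof -
  have "(#>\<^bsub>FG\<^esub>) K = cl" by (rule ext) (rule coset_cl)
  then show ?thesis by (simp add: tensor_product_def Let_def carrier_FactGroup)
qed

lemma tensor_carrierI: "u \<in> carrier FG \<Longrightarrow> cl u \<in> carrier N"
  unfolding tensor_carrier by blast

lemma tensor_zero: "\<zero>\<^bsub>N\<^esub> = cl 0"
  by (simp add: tensor_product_def Let_def cl_def)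

lemma tensor_add: "cl u \<oplus>\<^bsub>N\<^esub> cl v = cl (u + v)"
proof -
  have "cl u \<oplus>\<^bsub>N\<^esub> cl v = (\<Union>h\<in>cl u. \<Union>k\<in>cl v. {h + k})"
    by (simp add: tensor_product_def Let_def set_mult_def)
  also have "\<dots> = cl (u + v)"
  proof (intro equalityI subsetI)
    fix w assume "w \<in> (\<Union>h\<in>cl u. \<Union>k\<in>cl v. {h + k})"
    then obtain h k where "h - u \<in> K" "k - v \<in> K" "w = h + k" by (auto simp: mem_cl_iff)
    then show "w \<in> cl (u + v)" using kernel_add[of "h - u" "k - v"] by (simp add: mem_cl_iff algebra_simps)
  next
    fix w assume "w \<in> cl (u + v)"
    then have "w - v \<in> cl u" "v \<in> cl v" using kernel_zero by (auto simp: mem_cl_iff algebra_simps)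
    moreover have "w = (w - v) + v" by simp
    ultimately show "w \<in> (\<Union>h\<in>cl u. \<Union>k\<in>cl v. {h + k})" by blast
  qed
  finally show ?thesis .
qed

lemma FG_closed:
  shows "0 \<in> carrier FG" "\<lbrakk>u \<in> carrier FG; v \<in> carrier FG\<rbrakk> \<Longrightarrow> u + v \<in> carrier FG"
    "\<lbrakk>u \<in> carrier FG; v \<in> carrier FG\<rbrakk> \<Longrightarrow> u - v \<in> carrier FG" "u \<in> carrier FG \<Longrightarrow> - u \<in> carrier FG"
    "\<lbrakk>x \<in> carrier B; l \<in> carrier L\<rbrakk> \<Longrightarrow> frag_of (x, l) \<in> carrier FG"
  using keys_add[of u v] keys_diff[of u v] by (auto simp del: insert_iff)

lemma tensor_abelian_group: "abelian_group N"
proof (rule abelian_groupI)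
  fix s assume s: "s \<in> carrier N"
  then obtain u where u: "u \<in> carrier FG" "s = cl u" unfolding tensor_carrier by blast
  show "\<exists>r\<in>carrier N. r \<oplus>\<^bsub>N\<^esub> s = \<zero>\<^bsub>N\<^esub>"
    by (rule bexI[of _ "cl (- u)"])
      (simp add: u tensor_add tensor_zero, rule tensor_carrierI[OF FG_closed(4)[OF u(1)]])
  show "\<zero>\<^bsub>N\<^esub> \<oplus>\<^bsub>N\<^esub> s = s" by (simp add: u(2) tensor_add tensor_zero)
  fix r assume "r \<in> carrier N"
  then obtain v where v: "v \<in> carrier FG" "r = cl v" unfolding tensor_carrier by blast
  show "s \<oplus>\<^bsub>N\<^esub> r \<in> carrier N"
    unfolding u(2) v(2) tensor_add by (rule tensor_carrierI[OF FG_closed(2)[OF u(1) v(1)]])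
  show "s \<oplus>\<^bsub>N\<^esub> r = r \<oplus>\<^bsub>N\<^esub> s" unfolding u(2) v(2) tensor_add by (simp add: add.commute)
  fix q assume "q \<in> carrier N"
  then obtain w where w: "w \<in> carrier FG" "q = cl w" unfolding tensor_carrier by blast
  show "s \<oplus>\<^bsub>N\<^esub> r \<oplus>\<^bsub>N\<^esub> q = s \<oplus>\<^bsub>N\<^esub> (r \<oplus>\<^bsub>N\<^esub> q)"
    unfolding u(2) v(2) w(2) tensor_add by (simp add: add.assoc)
next
  show "\<zero>\<^bsub>N\<^esub> \<in> carrier N" unfolding tensor_zero by (rule tensor_carrierI[OF FG_closed(1)])
qed

sublocale N: abelian_group "tensor_product A (power_series A n) L"
  by (rule tensor_abelian_group)

section \<open>Pure tensors and induction over sums of them\<close>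

lemma pure_closed: "\<lbrakk>x \<in> carrier B; l \<in> carrier L\<rbrakk> \<Longrightarrow> pure x l \<in> carrier N"
  unfolding pure_def by (rule tensor_carrierI[OF FG_closed(5)])

lemma pure_add_left:
  "\<lbrakk>x \<in> carrier B; y \<in> carrier B; l \<in> carrier L\<rbrakk> \<Longrightarrow> pure (x \<oplus>\<^bsub>B\<^esub> y) l = pure x l \<oplus>\<^bsub>N\<^esub> pure y l"
  unfolding pure_def tensor_add cl_eq_iff
  by (rule kernel_incl) (auto simp: tensor_relations_def)

lemma pure_add_right:
  "\<lbrakk>x \<in> carrier B; l \<in> carrier L; m \<in> carrier L\<rbrakk> \<Longrightarrow> pure x (l \<oplus>\<^bsub>L\<^esub> m) = pure x l \<oplus>\<^bsub>N\<^esub> pure x m"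
  unfolding pure_def tensor_add cl_eq_iff
  by (rule kernel_incl) (unfold tensor_relations_def, blast)

lemma pure_balanced:
  "\<lbrakk>a \<in> carrier A; x \<in> carrier B; l \<in> carrier L\<rbrakk> \<Longrightarrow> pure (a \<odot>\<^bsub>B\<^esub> x) l = pure x (a \<odot>\<^bsub>L\<^esub> l)"
  unfolding pure_def cl_eq_iff
  by (rule kernel_incl) (unfold tensor_relations_def, blast)

lemma pure_zero_left: "l \<in> carrier L \<Longrightarrow> pure \<zero>\<^bsub>B\<^esub> l = \<zero>\<^bsub>N\<^esub>"
  using pure_add_left[of "\<zero>\<^bsub>B\<^esub>" "\<zero>\<^bsub>B\<^esub>" l] pure_closed[of "\<zero>\<^bsub>B\<^esub>" l]
  by (metis B.l_zero B.zero_closed N.add.l_cancel_one')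

lemma pure_zero_right: "x \<in> carrier B \<Longrightarrow> pure x \<zero>\<^bsub>L\<^esub> = \<zero>\<^bsub>N\<^esub>"
  using pure_add_right[of x "\<zero>\<^bsub>L\<^esub>" "\<zero>\<^bsub>L\<^esub>"] pure_closed[of x "\<zero>\<^bsub>L\<^esub>"]
  by (metis L.M.l_zero L.M.zero_closed N.add.l_cancel_one')

lemma cl_uminus: "u \<in> carrier FG \<Longrightarrow> cl (- u) = \<ominus>\<^bsub>N\<^esub> cl u"
  using N.minus_equality[of "cl (- u)" "cl u"] tensor_carrierI FG_closed(4)[of u]
  by (simp add: tensor_add tensor_zero del: carrier_free_Abelian_group_iff)

lemma pure_uminus: "\<lbrakk>x \<in> carrier B; l \<in> carrier L\<rbrakk> \<Longrightarrow> pure (\<ominus>\<^bsub>B\<^esub> x) l = \<ominus>\<^bsub>N\<^esub> pure x l"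
  using pure_add_left[of "\<ominus>\<^bsub>B\<^esub> x" x l] pure_closed pure_zero_left
  by (simp add: B.l_neg N.minus_equality)

text \<open>Sums of pure tensors suffice, without differences, because -(x \<otimes> l) = (-x)
  \<otimes> l. Induction on the free group forms differences, so the claim is carried for
  \<open>u\<close> and \<open>- u\<close> together.\<close>

lemma tensor_induct [consumes 1, case_names pure zero add]:
  assumes "s \<in> carrier N" and pure: "\<And>x l. \<lbrakk>x \<in> carrier B; l \<in> carrier L\<rbrakk> \<Longrightarrow> Q (pure x l)"
    and zero: "Q \<zero>\<^bsub>N\<^esub>"
    and add: "\<And>s r. \<lbrakk>s \<in> carrier N; r \<in> carrier N; Q s; Q r\<rbrakk> \<Longrightarrow> Q (s \<oplus>\<^bsub>N\<^esub> r)"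
  shows "Q s"
proof -
  obtain u where u: "u \<in> carrier FG" "s = cl u" using assms(1) unfolding tensor_carrier by blast
  have "Poly_Mapping.keys u \<subseteq> carrier B \<times> carrier L" using u(1) by simp
  then have "Q (cl u) \<and> Q (cl (- u))"
  proof (induction u rule: free_Abelian_group_induct[consumes 1, case_names zero diff gen])
    case zero
    then show ?case using assms(3) by (simp add: tensor_zero)
  next
    case (diff v w)
    have c: "cl v \<in> carrier N" "cl w \<in> carrier N" "cl (- v) \<in> carrier N" "cl (- w) \<in> carrier N"
      by (rule tensor_carrierI, use diff in simp)+
    show ?case
      using add[OF c(1,4)] add[OF c(3,2)] diff by (simp add: tensor_add)
  next
    case (gen p)
    then obtain x l where p: "p = (x, l)" "x \<in> carrier B" "l \<in> carrier L" by auto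
    have "cl (- frag_of p) = pure (\<ominus>\<^bsub>B\<^esub> x) l"
      using p cl_uminus[OF FG_closed(5)] pure_uminus[of x l] by (simp add: pure_def)
    then show ?case using p pure[of x l] pure[of "\<ominus>\<^bsub>B\<^esub> x" l] by (simp add: pure_def)
  qed
  then show ?thesis using u(2) by simp
qed

section \<open>The action of the differential operators on tensors\<close>

lemma act_FG:
  assumes "\<theta> \<in> carrier D" "u \<in> carrier FG" shows "act \<theta> u \<in> carrier FG"
proof -
  have "Poly_Mapping.keys (act \<theta> u) \<subseteq> (\<Union>p\<in>Poly_Mapping.keys u. Poly_Mapping.keys ((\<lambda>(x, l). frag_of (\<theta> x, l)) p))"
    unfolding act_def by (rule keys_frag_extend)
  also have "\<dots> \<subseteq> carrier B \<times> carrier L"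
    using assms D_apply_closed[OF assms(1)] by (auto simp: keys_frag_of)
  finally show ?thesis by simp
qed

lemma act_simps:
  "act \<theta> (u + v) = act \<theta> u + act \<theta> v" "act \<theta> (u - v) = act \<theta> u - act \<theta> v" "act \<theta> (- u) = - act \<theta> u"
  "act \<theta> 0 = 0" "act \<theta> (frag_of (x, l)) = frag_of (\<theta> x, l)"
  by (simp_all add: act_def frag_extend_add frag_extend_diff frag_extend_minus)

text \<open>Additivity and A-linearity of \<theta> send each defining relation to a defining
  relation, so the action passes to classes.\<close>

lemma act_kernel:
  assumes th: "\<theta> \<in> carrier D" and "k \<in> K" shows "act \<theta> k \<in> K"
  using assms(2)
proof (induction rule: kernel_induct)
  case (rel r)
  note c = D_apply_closed[OF th]
  from rel[unfolded tensor_relations_def] have "act \<theta> r \<in> tensor_relations A B L"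
  proof (elim UnE CollectE exE conjE)
    fix x y l assume *: "r = frag_of (x \<oplus>\<^bsub>B\<^esub> y, l) - (frag_of (x, l) + frag_of (y, l))"
      "x \<in> carrier B" "y \<in> carrier B" "l \<in> carrier L"
    then have "act \<theta> r = frag_of (\<theta> x \<oplus>\<^bsub>B\<^esub> \<theta> y, l) - (frag_of (\<theta> x, l) + frag_of (\<theta> y, l))"
      by (simp add: act_simps End_add[OF D_End[OF th]])
    then show ?thesis
      unfolding tensor_relations_def using c[OF *(2)] c[OF *(3)] *(4) by blast
  next
    fix x l m assume *: "r = frag_of (x, l \<oplus>\<^bsub>L\<^esub> m) - (frag_of (x, l) + frag_of (x, m))"
      "x \<in> carrier B" "l \<in> carrier L" "m \<in> carrier L"
    then have "act \<theta> r = frag_of (\<theta> x, l \<oplus>\<^bsub>L\<^esub> m) - (frag_of (\<theta> x, l) + frag_of (\<theta> x, m))"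
      by (simp add: act_simps)
    then show ?thesis
      unfolding tensor_relations_def using c[OF *(2)] *(3,4) by blast
  next
    fix a x l assume *: "r = frag_of (a \<odot>\<^bsub>B\<^esub> x, l) - frag_of (x, a \<odot>\<^bsub>L\<^esub> l)"
      "a \<in> carrier A" "x \<in> carrier B" "l \<in> carrier L"
    then have "act \<theta> r = frag_of (a \<odot>\<^bsub>B\<^esub> \<theta> x, l) - frag_of (\<theta> x, a \<odot>\<^bsub>L\<^esub> l)"
      by (simp add: act_simps End_smult[OF D_End[OF th]])
    then show ?thesis
      unfolding tensor_relations_def using c[OF *(3)] *(2,4) by blast
  qed
  then show ?case by (rule kernel_incl)
qed (simp_all add: act_simps kernel_zero kernel_add kernel_uminus)

text \<open>The union in the definition of the scalar multiplication runs over all representatives;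
  they yield the same class, so it collapses to one coset.\<close>

lemma tensor_smult:
  assumes th: "\<theta> \<in> carrier D" shows "\<theta> \<odot>\<^bsub>N\<^esub> cl u = cl (act \<theta> u)"
proof -
  have "cl (act \<theta> v) = cl (act \<theta> u)" if "v \<in> cl u" for v
    using act_kernel[OF th, of "v - u"] that by (simp add: cl_eq_iff mem_cl_iff act_simps)
  moreover have "u \<in> cl u" using kernel_zero by (simp add: mem_cl_iff)
  moreover have "\<theta> \<odot>\<^bsub>N\<^esub> cl u = (\<Union>v\<in>cl u. cl (act \<theta> v))"
    by (simp add: tensor_product_def Let_def coset_cl act_def)
  ultimately show ?thesis by blast
qed

lemma pure_smult: "\<theta> \<in> carrier D \<Longrightarrow> \<theta> \<odot>\<^bsub>N\<^esub> pure x l = pure (\<theta> x) l"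
  by (simp add: pure_def tensor_smult act_simps)

lemma tensor_left_module: "left_module D N"
proof (intro left_module.intro left_module_axioms.intro)
  show "ring D" by (rule D.ring_axioms)
  show "abelian_group N" by (rule tensor_abelian_group)
  show closed: "\<theta> \<odot>\<^bsub>N\<^esub> s \<in> carrier N" if "\<theta> \<in> carrier D" "s \<in> carrier N" for \<theta> s
    using that(2) unfolding tensor_carrier
    by (elim imageE) (simp only: tensor_smult[OF that(1)] imageI act_FG[OF that(1)])
  show distr: "\<theta> \<odot>\<^bsub>N\<^esub> (s \<oplus>\<^bsub>N\<^esub> r) = \<theta> \<odot>\<^bsub>N\<^esub> s \<oplus>\<^bsub>N\<^esub> \<theta> \<odot>\<^bsub>N\<^esub> r"
    if "\<theta> \<in> carrier D" "s \<in> carrier N" "r \<in> carrier N" for \<theta> s r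
    using that(2,3) unfolding tensor_carrier
    by (elim imageE) (simp only: tensor_smult[OF that(1)] tensor_add act_simps)
  have zero: "\<theta> \<odot>\<^bsub>N\<^esub> \<zero>\<^bsub>N\<^esub> = \<zero>\<^bsub>N\<^esub>" if "\<theta> \<in> carrier D" for \<theta>
    by (simp add: tensor_zero tensor_smult[OF that] act_simps)
  show "\<one>\<^bsub>D\<^esub> \<odot>\<^bsub>N\<^esub> s = s" if "s \<in> carrier N" for s
    using that by (induction rule: tensor_induct) (simp_all add: pure_smult D_apply zero distr)
  fix \<theta> \<eta> s assume c: "\<theta> \<in> carrier D" "\<eta> \<in> carrier D" and s: "s \<in> carrier N"
  show "(\<theta> \<oplus>\<^bsub>D\<^esub> \<eta>) \<odot>\<^bsub>N\<^esub> s = \<theta> \<odot>\<^bsub>N\<^esub> s \<oplus>\<^bsub>N\<^esub> \<eta> \<odot>\<^bsub>N\<^esub> s"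
    using s
  proof (induction rule: tensor_induct)
    case (add s r)
    then show ?case using c closed by (simp add: distr N.a_ac)
  qed (use c in \<open>simp_all add: pure_smult D_apply zero pure_add_left D_apply_closed\<close>)
  show "(\<theta> \<otimes>\<^bsub>D\<^esub> \<eta>) \<odot>\<^bsub>N\<^esub> s = \<theta> \<odot>\<^bsub>N\<^esub> (\<eta> \<odot>\<^bsub>N\<^esub> s)"
    using s by (induction rule: tensor_induct) (use c closed in \<open>simp_all add: pure_smult D_apply zero distr\<close>)
qed

end

text \<open>As \<partial>_j (a \<cdot> 1) = 0, the operator \<partial>_j commutes with
  multiplication by the constant a, so the scalars from A preserve horizontal elements.\<close>

lemma (in diff_module) horizontal_module_module: "module A (horizontal_module A n M)"
proof -
  let ?L = "horizontal_module A n M"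
  let ?c = "\<lambda>a. a \<odot>\<^bsub>B\<^esub> \<one>\<^bsub>B\<^esub>"
  have sel: "carrier ?L = {m \<in> carrier M. \<forall>j<n. P j \<odot>\<^bsub>M\<^esub> m = \<zero>\<^bsub>M\<^esub>}" "x \<oplus>\<^bsub>?L\<^esub> y = x \<oplus>\<^bsub>M\<^esub> y"
    "\<zero>\<^bsub>?L\<^esub> = \<zero>\<^bsub>M\<^esub>" "a \<odot>\<^bsub>?L\<^esub> x = T (?c a) \<odot>\<^bsub>M\<^esub> x" for a x y
    by (simp_all add: horizontal_module_def restrict_scalars_def)
  have c: "?c a \<in> carrier B" if "a \<in> carrier A" for a using that by simp
  have Pc: "P j \<otimes>\<^bsub>D\<^esub> T (?c a) = T (?c a) \<otimes>\<^bsub>D\<^esub> P j" if "a \<in> carrier A" "j < n" for a j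
    using that partial_D[OF that(2)]
    by (simp add: partial_mult_op partial_smult partial_one mult_op_zero mult_op_D)
  show ?thesis
  proof (rule moduleI[OF is_cring])
    show "abelian_group ?L"
    proof (rule abelian_groupI)
      fix x assume "x \<in> carrier ?L"
      then show "\<exists>y\<in>carrier ?L. y \<oplus>\<^bsub>?L\<^esub> x = \<zero>\<^bsub>?L\<^esub>"
        by (intro bexI[of _ "\<ominus>\<^bsub>M\<^esub> x"]) (auto simp: sel DM.M.l_neg D_smult_uminus partial_D)
    qed (auto simp: sel DM.M.a_ac DM.smult_r_distr partial_D D_smult_zero)
    show "a \<odot>\<^bsub>?L\<^esub> x \<in> carrier ?L" if "a \<in> carrier A" "x \<in> carrier ?L" for a x
    proof -
      have "P j \<odot>\<^bsub>M\<^esub> (T (?c a) \<odot>\<^bsub>M\<^esub> x) = \<zero>\<^bsub>M\<^esub>" if j: "j < n" for j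
      proof -
        have "P j \<odot>\<^bsub>M\<^esub> (T (?c a) \<odot>\<^bsub>M\<^esub> x) = T (?c a) \<odot>\<^bsub>M\<^esub> (P j \<odot>\<^bsub>M\<^esub> x)"
          using DM.smult_assoc[OF partial_D[OF j] mult_op_D[OF c[of a]], of x]
            DM.smult_assoc[OF mult_op_D[OF c[of a]] partial_D[OF j], of x]
            \<open>a \<in> carrier A\<close> \<open>x \<in> carrier ?L\<close> Pc[OF \<open>a \<in> carrier A\<close> j] by (simp only: sel mem_Collect_eq)
        then show ?thesis using that \<open>a \<in> carrier A\<close> \<open>x \<in> carrier ?L\<close> mult_op_D[OF c[of a]]
          by (simp add: sel D_smult_zero)
      qed
      then show ?thesis using that mult_op_D[OF c[of a]] by (simp add: sel DM.smult_closed)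
    qed
    show "(a \<otimes> b) \<odot>\<^bsub>?L\<^esub> x = a \<odot>\<^bsub>?L\<^esub> (b \<odot>\<^bsub>?L\<^esub> x)" if "a \<in> carrier A" "b \<in> carrier A" "x \<in> carrier ?L" for a b x
    proof -
      have "?c (a \<otimes> b) = ?c a \<otimes>\<^bsub>B\<^esub> ?c b" using that by (simp add: B.smult_assoc1 B.smult_assoc2)
      then show ?thesis using that by (simp add: sel mult_op_mult DM.smult_assoc mult_op_D)
    qed
  qed (auto simp: sel B.smult_l_distr mult_op_add mult_op_D mult_op_one DM.smult_l_distr DM.smult_r_distr DM.smult_one)
qed

section \<open>Completions\<close>

context adic_module begin

section \<open>Cosets of the filtration\<close>

lemma coset_iff: "m \<in> carrier M \<Longrightarrow> x \<in> F i +>\<^bsub>M\<^esub> m \<longleftrightarrow> x \<in> carrier M \<and> x \<ominus>\<^bsub>M\<^esub> m \<in> F i"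
proof -
  assume m: "m \<in> carrier M"
  have "x = (x \<ominus>\<^bsub>M\<^esub> m) \<oplus>\<^bsub>M\<^esub> m" if "x \<in> carrier M"
    using that m by (simp add: M.minus_eq M.a_assoc M.l_neg)
  moreover have "h \<oplus>\<^bsub>M\<^esub> m \<ominus>\<^bsub>M\<^esub> m = h" if "h \<in> F i" for h
    using F_carrier[OF that] m by (simp add: M.minus_eq M.a_assoc M.r_neg)
  moreover have "h \<oplus>\<^bsub>M\<^esub> m \<in> carrier M" if "h \<in> F i" for h
    using F_carrier[OF that] m by simp
  ultimately show ?thesis by (auto simp: a_r_coset_def')
qed

lemma coset_eq_iff:
  assumes "m \<in> carrier M" "m' \<in> carrier M"
  shows "F i +>\<^bsub>M\<^esub> m = F i +>\<^bsub>M\<^esub> m' \<longleftrightarrow> m \<ominus>\<^bsub>M\<^esub> m' \<in> F i"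
proof
  assume "F i +>\<^bsub>M\<^esub> m = F i +>\<^bsub>M\<^esub> m'"
  moreover have "m \<in> F i +>\<^bsub>M\<^esub> m" using assms F_zero by (simp add: coset_iff M.minus_eq M.r_neg)
  ultimately show "m \<ominus>\<^bsub>M\<^esub> m' \<in> F i" using assms by (simp add: coset_iff)
next
  assume d: "m \<ominus>\<^bsub>M\<^esub> m' \<in> F i"
  show "F i +>\<^bsub>M\<^esub> m = F i +>\<^bsub>M\<^esub> m'"
  proof (intro Set.set_eqI iffI)
    fix x assume "x \<in> F i +>\<^bsub>M\<^esub> m"
    then show "x \<in> F i +>\<^bsub>M\<^esub> m'" using assms F_trans[OF _ d] by (simp add: coset_iff)
  next
    fix x assume "x \<in> F i +>\<^bsub>M\<^esub> m'"
    then show "x \<in> F i +>\<^bsub>M\<^esub> m" using assms F_trans[OF _ F_sym[OF d]] by (simp add: coset_iff)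
  qed
qed

lemma coset_self: "m \<in> carrier M \<Longrightarrow> m \<in> F i +>\<^bsub>M\<^esub> m"
  using F_zero by (simp add: coset_iff M.minus_eq M.r_neg)

lemma rcosets_iff: "S \<in> a_rcosets\<^bsub>M\<^esub> (F i) \<longleftrightarrow> (\<exists>m\<in>carrier M. S = F i +>\<^bsub>M\<^esub> m)"
  by (auto simp: A_RCOSETS_def' )

lemma set_add_iff: "x \<in> S <+>\<^bsub>M\<^esub> S' \<longleftrightarrow> (\<exists>y\<in>S. \<exists>z\<in>S'. x = y \<oplus>\<^bsub>M\<^esub> z)"
  by (auto simp: set_add_def')

lemma set_add_coset:
  assumes m: "m \<in> carrier M" and ij: "i \<le> j"
  shows "F i <+>\<^bsub>M\<^esub> (F j +>\<^bsub>M\<^esub> m) = F i +>\<^bsub>M\<^esub> m"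
proof (intro Set.set_eqI iffI)
  fix x assume "x \<in> F i <+>\<^bsub>M\<^esub> (F j +>\<^bsub>M\<^esub> m)"
  then obtain y z where yz: "y \<in> F i" "z \<in> carrier M" "z \<ominus>\<^bsub>M\<^esub> m \<in> F j" "x = y \<oplus>\<^bsub>M\<^esub> z"
    using m by (auto simp: set_add_iff coset_iff)
  have "x \<ominus>\<^bsub>M\<^esub> m = y \<oplus>\<^bsub>M\<^esub> (z \<ominus>\<^bsub>M\<^esub> m)"
    using yz m F_carrier by (simp add: M.minus_eq M.a_assoc)
  then show "x \<in> F i +>\<^bsub>M\<^esub> m"
    using yz m F_carrier F_add[OF yz(1) F_antimono[OF ij yz(3)]] by (simp add: coset_iff)
next
  fix x assume "x \<in> F i +>\<^bsub>M\<^esub> m"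
  then show "x \<in> F i <+>\<^bsub>M\<^esub> (F j +>\<^bsub>M\<^esub> m)"
    using coset_self[OF m] m unfolding set_add_iff a_r_coset_def'[of M "F i"] by blast
qed

section \<open>Elements of the completion and limits of sequences\<close>

lemma completion_carrier_iff:
  "c \<in> carrier (adic_completion R I M) \<longleftrightarrow>
    (\<forall>i. \<exists>m\<in>carrier M. c i = F i +>\<^bsub>M\<^esub> m) \<and> (\<forall>i j. i \<le> j \<longrightarrow> F i <+>\<^bsub>M\<^esub> c j = c i)"
  by (simp add: adic_completion_def quotient_module_def rcosets_iff)

lemma completion_nonempty: "c \<in> carrier (adic_completion R I M) \<Longrightarrow> c i \<noteq> {}"
  unfolding completion_carrier_iff using coset_self by (metis empty_iff)

lemma completion_mem_carrier: "\<lbrakk>c \<in> carrier (adic_completion R I M); u \<in> c i\<rbrakk> \<Longrightarrow> u \<in> carrier M"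
  unfolding completion_carrier_iff by (metis coset_iff)

lemma completion_mem_diff:
  "\<lbrakk>c \<in> carrier (adic_completion R I M); u \<in> c i; v \<in> c i\<rbrakk> \<Longrightarrow> u \<ominus>\<^bsub>M\<^esub> v \<in> F i"
  unfolding completion_carrier_iff by (metis coset_iff F_trans F_sym)

text \<open>Later cosets lie inside earlier ones, so any choice of representatives is a Cauchy
  sequence.\<close>

lemma completion_mem_Suc:
  assumes c: "c \<in> carrier (adic_completion R I M)" and u: "u \<in> c (Suc i)" shows "u \<in> c i"
proof -
  have "\<zero>\<^bsub>M\<^esub> \<oplus>\<^bsub>M\<^esub> u \<in> F i <+>\<^bsub>M\<^esub> c (Suc i)" using u F_zero unfolding set_add_iff by blast
  moreover have "F i <+>\<^bsub>M\<^esub> c (Suc i) = c i" using c unfolding completion_carrier_iff by simp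
  ultimately show ?thesis using completion_mem_carrier[OF c u] by simp
qed

lemma completion_eq_coset:
  assumes c: "c \<in> carrier (adic_completion R I M)" and u: "u \<in> c i" shows "c i = F i +>\<^bsub>M\<^esub> u"
proof -
  obtain m where m: "m \<in> carrier M" "c i = F i +>\<^bsub>M\<^esub> m" using c unfolding completion_carrier_iff by blast
  then show ?thesis using u coset_eq_iff F_sym by (metis coset_iff)
qed

text \<open>Terms k and k + 1 have to agree only modulo F^k, which is what compatibility of the
  cosets at these two levels demands.\<close>

lemma completionI:
  assumes s: "\<And>k. s k \<in> carrier M" "\<And>k. s (Suc k) \<ominus>\<^bsub>M\<^esub> s k \<in> F k"
  shows "(\<lambda>i. F i +>\<^bsub>M\<^esub> s i) \<in> carrier (adic_completion R I M)"
proof -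
  have "s j \<ominus>\<^bsub>M\<^esub> s i \<in> F i" if "i \<le> j" for i j
    using that
  proof (induction j rule: dec_induct)
    case base
    then show ?case using s F_zero by (simp add: M.minus_eq M.r_neg)
  next
    case (step j)
    then show ?case using F_trans[OF F_antimono[OF _ s(2)[of j]] step(3)] s(1) by simp
  qed
  then have "F i <+>\<^bsub>M\<^esub> (F j +>\<^bsub>M\<^esub> s j) = F i +>\<^bsub>M\<^esub> s i" if "i \<le> j" for i j
    using that s(1) by (simp add: set_add_coset coset_eq_iff)
  then show ?thesis unfolding completion_carrier_iff using s(1) by blast
qed

lemma complete_separated:
  assumes "adically_complete R I M" and x: "\<And>i. x \<in> F i"
  shows "x = \<zero>\<^bsub>M\<^esub>"
proof -
  have "inj_on (to_completion R I M) (carrier M)"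
    using assms(1) by (auto simp: adically_complete_def lmodule_iso_def bij_betw_def)
  moreover have "to_completion R I M x = to_completion R I M \<zero>\<^bsub>M\<^esub>"
  proof
    fix i
    show "to_completion R I M x i = to_completion R I M \<zero>\<^bsub>M\<^esub> i"
      using F_carrier[OF x] F_minus[OF x F_zero] by (simp add: to_completion_def coset_eq_iff)
  qed
  ultimately show ?thesis using F_carrier[OF x] by (auto dest: inj_onD)
qed

lemma complete_limit:
  assumes "adically_complete R I M" and s: "\<And>k. s k \<in> carrier M" "\<And>k. s (Suc k) \<ominus>\<^bsub>M\<^esub> s k \<in> F k"
  shows "\<exists>l\<in>carrier M. \<forall>k. l \<ominus>\<^bsub>M\<^esub> s k \<in> F k"
proof -
  have "to_completion R I M ` carrier M = carrier (adic_completion R I M)"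
    using assms(1) by (auto simp: adically_complete_def lmodule_iso_def bij_betw_def)
  then obtain l where l: "l \<in> carrier M" "(\<lambda>i. F i +>\<^bsub>M\<^esub> s i) = to_completion R I M l"
    using completionI[of s] s by blast
  have "F k +>\<^bsub>M\<^esub> l = F k +>\<^bsub>M\<^esub> s k" for k
    using fun_cong[OF l(2), of k] by (simp add: to_completion_def)
  then show ?thesis using l(1) s(1) by (auto simp: coset_eq_iff)
qed

end

section \<open>The evaluation of tensors in the module\<close>

context diff_module begin

abbreviation L where "L \<equiv> horizontal_module A n M"

lemma horizontal_sel:
  "carrier L = {m \<in> carrier M. \<forall>j<n. P j \<odot>\<^bsub>M\<^esub> m = \<zero>\<^bsub>M\<^esub>}" "x \<oplus>\<^bsub>L\<^esub> y = x \<oplus>\<^bsub>M\<^esub> y" "\<zero>\<^bsub>L\<^esub> = \<zero>\<^bsub>M\<^esub>"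
  "a \<odot>\<^bsub>L\<^esub> x = (a \<odot>\<^bsub>B\<^esub> \<one>\<^bsub>B\<^esub>) \<odot>\<^bsub>U\<^esub> x"
  by (simp_all add: horizontal_module_def restrict_scalars_def U_sel)

end

sublocale diff_module \<subseteq> tensor: power_series_tensor A n "horizontal_module A n M"
  by (intro power_series_tensor.intro diff_ring_axioms horizontal_module_module)

context diff_module begin

abbreviation N where "N \<equiv> tensor_product A (power_series A n) (horizontal_module A n M)"

text \<open>The function whose image of a coset \<open>tensor_eval\<close> takes. It is studied on
  formal sums first, to see that it is constant on each class.\<close>

definition eval_sum :: "(((nat \<Rightarrow> nat) \<Rightarrow> 'a) \<times> 'm \<Rightarrow>\<^sub>0 int) \<Rightarrow> 'm" where
  "eval_sum u = (\<Oplus>\<^bsub>U\<^esub>p\<in>Poly_Mapping.keys u. [Poly_Mapping.lookup u p] \<cdot>\<^bsub>U\<^esub> (fst p \<odot>\<^bsub>U\<^esub> snd p))"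

lemma horizontal_smult_closed: "\<lbrakk>b \<in> carrier B; l \<in> carrier L\<rbrakk> \<Longrightarrow> b \<odot>\<^bsub>U\<^esub> l \<in> carrier U"
  using U.smult_closed[of b l] by (simp add: horizontal_sel(1) U_sel(1))

lemma eval_summand_closed:
  "p \<in> carrier B \<times> carrier L \<Longrightarrow> [(k::int)] \<cdot>\<^bsub>U\<^esub> (fst p \<odot>\<^bsub>U\<^esub> snd p) \<in> carrier U"
  by (elim SigmaE) (simp add: horizontal_smult_closed)

text \<open>Cancellation can make the support of a sum smaller than the union of the supports; a
  common finite index set makes the sums comparable.\<close>

lemma eval_sum_superset:
  assumes S: "finite S" "Poly_Mapping.keys u \<subseteq> S" "S \<subseteq> carrier B \<times> carrier L"
  shows "eval_sum u = (\<Oplus>\<^bsub>U\<^esub>p\<in>S. [Poly_Mapping.lookup u p] \<cdot>\<^bsub>U\<^esub> (fst p \<odot>\<^bsub>U\<^esub> snd p))"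
  unfolding eval_sum_def
proof (rule U.M.add.finprod_mono_neutral_cong_left)
  show "[Poly_Mapping.lookup u p] \<cdot>\<^bsub>U\<^esub> (fst p \<odot>\<^bsub>U\<^esub> snd p) = \<zero>\<^bsub>U\<^esub>" if "p \<in> S - Poly_Mapping.keys u" for p
    using that by (simp add: in_keys_iff add_pow_def)
  show "(\<lambda>p. [Poly_Mapping.lookup u p] \<cdot>\<^bsub>U\<^esub> (fst p \<odot>\<^bsub>U\<^esub> snd p)) \<in> S \<rightarrow> carrier U"
    using eval_summand_closed S(3) by blast
qed (use S in auto)

lemma eval_sum_closed: "u \<in> carrier tensor.FG \<Longrightarrow> eval_sum u \<in> carrier U"
  unfolding eval_sum_def
  by (rule U.M.finsum_closed) (use eval_summand_closed in \<open>auto simp del: Product_Type.mem_Times_iff\<close>)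

lemma eval_sum_add:
  assumes "u \<in> carrier tensor.FG" "v \<in> carrier tensor.FG"
  shows "eval_sum (u + v) = eval_sum u \<oplus>\<^bsub>U\<^esub> eval_sum v"
proof -
  let ?S = "Poly_Mapping.keys u \<union> Poly_Mapping.keys v"
  have S: "finite ?S" "?S \<subseteq> carrier B \<times> carrier L" using assms by auto
  have c: "fst p \<odot>\<^bsub>U\<^esub> snd p \<in> carrier U" if "p \<in> ?S" for p
  proof -
    have "p \<in> carrier B \<times> carrier L" using that S(2) by blast
    then show ?thesis by (elim SigmaE) (simp add: horizontal_smult_closed)
  qed
  have "eval_sum (u + v) = (\<Oplus>\<^bsub>U\<^esub>p\<in>?S. [Poly_Mapping.lookup (u + v) p] \<cdot>\<^bsub>U\<^esub> (fst p \<odot>\<^bsub>U\<^esub> snd p))"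
    by (rule eval_sum_superset[OF S(1) _ S(2)]) (rule keys_add)
  also have "\<dots> = (\<Oplus>\<^bsub>U\<^esub>p\<in>?S. [Poly_Mapping.lookup u p] \<cdot>\<^bsub>U\<^esub> (fst p \<odot>\<^bsub>U\<^esub> snd p) \<oplus>\<^bsub>U\<^esub>
      [Poly_Mapping.lookup v p] \<cdot>\<^bsub>U\<^esub> (fst p \<odot>\<^bsub>U\<^esub> snd p))"
    by (rule U.M.finsum_cong') (use c in \<open>auto simp: lookup_add U.M.add.int_pow_mult\<close>)
  also have "\<dots> = (\<Oplus>\<^bsub>U\<^esub>p\<in>?S. [Poly_Mapping.lookup u p] \<cdot>\<^bsub>U\<^esub> (fst p \<odot>\<^bsub>U\<^esub> snd p)) \<oplus>\<^bsub>U\<^esub>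
      (\<Oplus>\<^bsub>U\<^esub>p\<in>?S. [Poly_Mapping.lookup v p] \<cdot>\<^bsub>U\<^esub> (fst p \<odot>\<^bsub>U\<^esub> snd p))"
    by (rule U.M.finsum_addf) (use c in auto)
  also have "\<dots> = eval_sum u \<oplus>\<^bsub>U\<^esub> eval_sum v"
    using eval_sum_superset[OF S(1) _ S(2), of u] eval_sum_superset[OF S(1) _ S(2), of v] by simp
  finally show ?thesis .
qed

lemma eval_sum_zero: "eval_sum 0 = \<zero>\<^bsub>U\<^esub>"
  by (simp add: eval_sum_def)

lemma eval_sum_uminus:
  assumes "u \<in> carrier tensor.FG" shows "eval_sum (- u) = \<ominus>\<^bsub>U\<^esub> eval_sum u"
proof -
  have "- u \<in> carrier tensor.FG" using tensor.FG_closed(4)[OF assms] .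
  then show ?thesis
    using eval_sum_add[of "- u" u] eval_sum_closed assms eval_sum_zero
    by (intro U.M.minus_equality[symmetric]) auto
qed

lemma eval_sum_diff:
  "\<lbrakk>u \<in> carrier tensor.FG; v \<in> carrier tensor.FG\<rbrakk> \<Longrightarrow> eval_sum (u - v) = eval_sum u \<ominus>\<^bsub>U\<^esub> eval_sum v"
  using eval_sum_add[of u "- v"] tensor.FG_closed(4)[of v] eval_sum_uminus[of v]
  by (simp add: U.M.minus_eq del: carrier_free_Abelian_group_iff)

lemma eval_sum_frag_of:
  assumes "b \<in> carrier B" "l \<in> carrier L" shows "eval_sum (frag_of (b, l)) = b \<odot>\<^bsub>U\<^esub> l"
proof -
  have "b \<odot>\<^bsub>U\<^esub> l \<in> carrier U" using horizontal_smult_closed[OF assms] .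
  then show ?thesis by (simp add: eval_sum_def keys_frag_of)
qed

lemma eval_sum_kernel: "k \<in> tensor.K \<Longrightarrow> eval_sum k = \<zero>\<^bsub>U\<^esub>"
proof (induction rule: tensor.kernel_induct)
  case (rel r)
  note FG = tensor.FG_closed
  have ld: "l \<in> carrier U" if "l \<in> carrier L" for l using that by (simp add: horizontal_sel U_sel(1))
  have bal: "a \<odot>\<^bsub>L\<^esub> l \<in> carrier L" if "a \<in> carrier A" "l \<in> carrier L" for a l
    using that by (rule tensor.L.smult_closed)
  from rel show ?case unfolding tensor_relations_def
  proof (elim UnE CollectE exE conjE)
    fix x y l assume "r = frag_of (x \<oplus>\<^bsub>B\<^esub> y, l) - (frag_of (x, l) + frag_of (y, l))"
      "x \<in> carrier B" "y \<in> carrier B" "l \<in> carrier L"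
    then show ?thesis using FG ld[of l]
      by (simp add: eval_sum_diff eval_sum_add eval_sum_frag_of U.smult_l_distr U.M.minus_eq U.M.r_neg
          del: carrier_free_Abelian_group_iff)
  next
    fix x l m assume *: "r = frag_of (x, l \<oplus>\<^bsub>L\<^esub> m) - (frag_of (x, l) + frag_of (x, m))"
      "x \<in> carrier B" "l \<in> carrier L" "m \<in> carrier L"
    have "l \<oplus>\<^bsub>L\<^esub> m \<in> carrier L" using *(3,4) by (rule tensor.L.M.add.m_closed)
    moreover have "l \<oplus>\<^bsub>L\<^esub> m = l \<oplus>\<^bsub>U\<^esub> m" by (simp add: horizontal_sel U_sel(2))
    ultimately show ?thesis using * FG ld[of l] ld[of m]
      by (simp add: eval_sum_diff eval_sum_add eval_sum_frag_of U.smult_r_distr U.M.minus_eq U.M.r_neg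
          del: carrier_free_Abelian_group_iff)
  next
    fix a x l assume *: "r = frag_of (a \<odot>\<^bsub>B\<^esub> x, l) - frag_of (x, a \<odot>\<^bsub>L\<^esub> l)"
      "a \<in> carrier A" "x \<in> carrier B" "l \<in> carrier L"
    have "x \<odot>\<^bsub>U\<^esub> (a \<odot>\<^bsub>L\<^esub> l) = (x \<otimes>\<^bsub>B\<^esub> (a \<odot>\<^bsub>B\<^esub> \<one>\<^bsub>B\<^esub>)) \<odot>\<^bsub>U\<^esub> l"
      using * ld[of l] by (simp add: horizontal_sel(4) U.smult_assoc1)
    also have "x \<otimes>\<^bsub>B\<^esub> (a \<odot>\<^bsub>B\<^esub> \<one>\<^bsub>B\<^esub>) = a \<odot>\<^bsub>B\<^esub> x"
      using * by (simp add: B.m_comm[of x] B.smult_assoc2)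
    finally show ?thesis using * FG ld[of l] bal[of a l]
      by (simp add: eval_sum_diff eval_sum_add eval_sum_frag_of U.M.minus_eq U.M.r_neg
          del: carrier_free_Abelian_group_iff)
  qed
next
  case (add u v)
  then show ?case by (simp add: eval_sum_add del: carrier_free_Abelian_group_iff)
next
  case (uminus u)
  then show ?case using eval_sum_zero eval_sum_uminus[of u] U.M.minus_equality[of "\<zero>\<^bsub>U\<^esub>" "\<zero>\<^bsub>U\<^esub>"]
    by simp
qed (simp add: eval_sum_zero)

abbreviation ev where "ev \<equiv> tensor_eval U"

text \<open>\<open>eval_sum\<close> vanishes on the kernel, so its image of a coset is a singleton
  and \<open>the_elem\<close> is meaningful.\<close>

lemma ev_cl:
  assumes u: "u \<in> carrier tensor.FG" shows "ev (tensor.cl u) = eval_sum u"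
proof -
  have "eval_sum v = eval_sum u" if "v \<in> tensor.cl u" for v
  proof -
    have k: "v - u \<in> tensor.K" using that by (simp add: tensor.mem_cl_iff)
    have "eval_sum ((v - u) + u) = eval_sum (v - u) \<oplus>\<^bsub>U\<^esub> eval_sum u"
      by (rule eval_sum_add[OF tensor.kernel_closed[OF k] u])
    then show ?thesis using eval_sum_kernel[OF k] eval_sum_closed[OF u] by simp
  qed
  moreover have "u \<in> tensor.cl u" using tensor.kernel_zero by (simp add: tensor.mem_cl_iff)
  ultimately have "eval_sum ` tensor.cl u = {eval_sum u}" by blast
  moreover have "ev (tensor.cl u) = the_elem (eval_sum ` tensor.cl u)"
    by (simp add: tensor_eval_def eval_sum_def[abs_def])
  ultimately show ?thesis by simp
qed

lemma ev_closed: "s \<in> carrier N \<Longrightarrow> ev s \<in> carrier U"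
  unfolding tensor.tensor_carrier using ev_cl eval_sum_closed by auto

lemma ev_add: "\<lbrakk>s \<in> carrier N; r \<in> carrier N\<rbrakk> \<Longrightarrow> ev (s \<oplus>\<^bsub>N\<^esub> r) = ev s \<oplus>\<^bsub>U\<^esub> ev r"
  unfolding tensor.tensor_carrier
  by (elim imageE) (simp only: tensor.tensor_add ev_cl eval_sum_add tensor.FG_closed)

lemma ev_pure: "\<lbrakk>b \<in> carrier B; l \<in> carrier L\<rbrakk> \<Longrightarrow> ev (tensor.pure b l) = b \<odot>\<^bsub>U\<^esub> l"
  using ev_cl[OF tensor.FG_closed(5)] eval_sum_frag_of by (simp add: tensor.pure_def)

lemma ev_zero: "ev \<zero>\<^bsub>N\<^esub> = \<zero>\<^bsub>U\<^esub>"
  using ev_cl[OF tensor.FG_closed(1)] eval_sum_zero by (simp add: tensor.tensor_zero)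

text \<open>The tensor product is itself a module over the differential operators, so its
  filtration, its Euler operator and the continuity of its operators come from the same locale as
  for M.\<close>

interpretation NM: diff_module A n "tensor_product A (power_series A n) (horizontal_module A n M)"
  by (intro diff_module.intro diff_module_axioms.intro power_series_ring_axioms
      tensor.tensor_left_module rationals)

text \<open>On pure tensors this is \<theta> (b l) = \<theta>(b) l for horizontal l, which is
  \<open>horizontal_smult\<close>.\<close>

lemma ev_smult:
  assumes "\<theta> \<in> carrier D" "s \<in> carrier N"
  shows "ev (\<theta> \<odot>\<^bsub>N\<^esub> s) = \<theta> \<odot>\<^bsub>M\<^esub> ev s"
  using assms(2)
proof (induction rule: tensor.tensor_induct)
  case (pure x l)
  then show ?case
    using horizontal_smult[OF _ _ assms(1) pure(1), of l] D_apply_closed[OF assms(1) pure(1)]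
    by (simp add: tensor.pure_smult[OF assms(1)] ev_pure horizontal_sel(1))
next
  case zero
  then show ?case using assms(1) by (simp add: NM.D_smult_zero D_smult_zero ev_zero U_sel(3))
next
  case (add s r)
  then show ?case using assms(1) ev_closed
    by (simp add: NM.DM.smult_r_distr DM.smult_r_distr ev_add NM.DM.smult_closed U_sel(1,2))
qed

end

section \<open>The canonical homomorphism\<close>

locale complete_diff_module = diff_module +
  assumes complete: "adically_complete B (variable_ideal A n) (underlying_module B M)"
begin

interpretation NM: diff_module A n "tensor_product A (power_series A n) (horizontal_module A n M)"
  by (intro diff_module.intro diff_module_axioms.intro power_series_ring_axioms
      tensor.tensor_left_module rationals)

abbreviation I where "I \<equiv> variable_ideal A n"
abbreviation V where "V \<equiv> underlying_module B N"

interpretation h: euler_module_hom B V U I n t "\<lambda>j x. P j \<odot>\<^bsub>N\<^esub> x" "\<lambda>j x. P j \<odot>\<^bsub>M\<^esub> x" ev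
proof (intro euler_module_hom.intro euler_module_hom_axioms.intro)
  show "ev (b \<odot>\<^bsub>V\<^esub> u) = b \<odot>\<^bsub>U\<^esub> ev u" if "b \<in> carrier B" "u \<in> carrier V" for b u
    using that ev_smult[OF mult_op_D[of b], of u] by (simp add: NM.U_sel U_sel(4))
qed (use NM.U_euler_module U_euler_module ev_closed ev_add ev_smult[OF partial_D] in
    \<open>simp_all add: NM.U_sel(1,2)\<close>)

section \<open>Comparison of the filtrations on both sides of the evaluation\<close>

lemma separated: "(\<And>i. x \<in> U.F i) \<Longrightarrow> x = \<zero>\<^bsub>U\<^esub>"
  by (rule U.complete_separated[OF complete])

text \<open>Writing x = a + \<Sum> t_j g_j, the tensor x \<otimes> l is 1 \<otimes> a l plus
  multiples of the variables. Constants move across the tensor sign, so a single horizontal element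
  represents any tensor modulo b.\<close>

lemma tensor_eq_constant_mod:
  "u \<in> carrier N \<Longrightarrow> \<exists>l\<in>carrier L. u \<ominus>\<^bsub>V\<^esub> tensor.pure \<one>\<^bsub>B\<^esub> l \<in> NM.U.F (Suc 0)"
proof (induction rule: tensor.tensor_induct)
  case (pure x l)
  obtain g where g: "\<And>j. g j \<in> carrier B"
    "x = x (\<lambda>_. 0) \<odot>\<^bsub>B\<^esub> \<one>\<^bsub>B\<^esub> \<oplus>\<^bsub>B\<^esub> (\<Oplus>\<^bsub>B\<^esub>j\<in>{..<n}. t j \<otimes>\<^bsub>B\<^esub> g j)"
    using power_series_decomp[OF pure(1)] by blast
  let ?a = "x (\<lambda>_. 0)" and ?s = "\<lambda>S. \<Oplus>\<^bsub>B\<^esub>j\<in>S. t j \<otimes>\<^bsub>B\<^esub> g j"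
  have a: "?a \<in> carrier A" using power_series_coeff[OF pure(1) exponents_zero] .
  have "?s S \<odot>\<^bsub>V\<^esub> tensor.pure \<one>\<^bsub>B\<^esub> l \<in> NM.U.F (Suc 0) \<and> ?s S \<in> carrier B" if "finite S" "S \<subseteq> {..<n}" for S
    using that
  proof (induction S rule: finite_induct)
    case empty
    have "tensor.pure \<one>\<^bsub>B\<^esub> l \<in> carrier V" using tensor.pure_closed[OF _ pure(2)] by (simp add: NM.U_sel(1))
    then show ?case using NM.U.F_zero by simp
  next
    case (insert j S)
    have p: "tensor.pure \<one>\<^bsub>B\<^esub> l \<in> carrier V" using tensor.pure_closed[OF _ pure(2)] by (simp add: NM.U_sel(1))
    have tg: "(\<lambda>j. t j \<otimes>\<^bsub>B\<^esub> g j) \<in> S \<rightarrow> carrier B" "t j \<otimes>\<^bsub>B\<^esub> g j \<in> carrier B" "g j \<in> carrier B"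
      using g(1) variable_closed by auto
    have j: "j < n" using insert by simp
    have "t j \<otimes>\<^bsub>B\<^esub> g j \<in> I"
      using ideal.I_r_closed[OF variable_ideal_ideal variable_in_variable_ideal[OF j] tg(3)] .
    then have "(t j \<otimes>\<^bsub>B\<^esub> g j) \<odot>\<^bsub>V\<^esub> tensor.pure \<one>\<^bsub>B\<^esub> l \<in> NM.U.F (Suc 0)"
      using NM.U.F_Suc_smult p by (simp add: NM.U.F_0)
    then show ?case using insert tg p by (simp add: NM.U.smult_l_distr NM.U.F_add)
  qed
  from this[of "{..<n}"] have s: "?s {..<n} \<odot>\<^bsub>V\<^esub> tensor.pure \<one>\<^bsub>B\<^esub> l \<in> NM.U.F (Suc 0)" "?s {..<n} \<in> carrier B"
    by auto
  have al: "?a \<odot>\<^bsub>L\<^esub> l \<in> carrier L" by (rule tensor.L.smult_closed[OF a pure(2)])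
  have "tensor.pure x l = tensor.pure (?a \<odot>\<^bsub>B\<^esub> \<one>\<^bsub>B\<^esub>) l \<oplus>\<^bsub>N\<^esub> tensor.pure (?s {..<n}) l"
    using tensor.pure_add_left[of "?a \<odot>\<^bsub>B\<^esub> \<one>\<^bsub>B\<^esub>" "?s {..<n}" l] a s(2) pure(2) g(2) by simp
  also have "tensor.pure (?a \<odot>\<^bsub>B\<^esub> \<one>\<^bsub>B\<^esub>) l = tensor.pure \<one>\<^bsub>B\<^esub> (?a \<odot>\<^bsub>L\<^esub> l)"
    by (rule tensor.pure_balanced[OF a _ pure(2)]) simp
  also have "tensor.pure (?s {..<n}) l = ?s {..<n} \<odot>\<^bsub>V\<^esub> tensor.pure \<one>\<^bsub>B\<^esub> l"
    using s(2) by (simp add: NM.U_sel(4) tensor.pure_smult mult_op_D D_apply)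
  finally have "tensor.pure x l \<ominus>\<^bsub>V\<^esub> tensor.pure \<one>\<^bsub>B\<^esub> (?a \<odot>\<^bsub>L\<^esub> l) = ?s {..<n} \<odot>\<^bsub>V\<^esub> tensor.pure \<one>\<^bsub>B\<^esub> l"
    using NM.U.F_carrier[OF s(1)] tensor.pure_closed[OF B.one_closed al]
    by (simp add: NM.U_sel(1,6) tensor.N.minus_ac)
  then show ?case using s(1) al by (intro bexI[of _ "?a \<odot>\<^bsub>L\<^esub> l"]) simp_all
next
  case zero
  show ?case
    using tensor.pure_zero_right[of "\<one>\<^bsub>B\<^esub>"] NM.U.F_minus[OF NM.U.F_zero NM.U.F_zero] tensor.L.M.zero_closed
    by (intro bexI[of _ "\<zero>\<^bsub>L\<^esub>"]) (auto simp: NM.U_sel(3))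
next
  case (add u v)
  then obtain l m where lm: "l \<in> carrier L" "u \<ominus>\<^bsub>V\<^esub> tensor.pure \<one>\<^bsub>B\<^esub> l \<in> NM.U.F (Suc 0)"
    "m \<in> carrier L" "v \<ominus>\<^bsub>V\<^esub> tensor.pure \<one>\<^bsub>B\<^esub> m \<in> NM.U.F (Suc 0)" by blast
  have "u \<oplus>\<^bsub>N\<^esub> v \<ominus>\<^bsub>V\<^esub> tensor.pure \<one>\<^bsub>B\<^esub> (l \<oplus>\<^bsub>L\<^esub> m)
      = (u \<ominus>\<^bsub>V\<^esub> tensor.pure \<one>\<^bsub>B\<^esub> l) \<oplus>\<^bsub>V\<^esub> (v \<ominus>\<^bsub>V\<^esub> tensor.pure \<one>\<^bsub>B\<^esub> m)"
    using add(1,2) lm(1,3) tensor.pure_closed[OF B.one_closed lm(1)] tensor.pure_closed[OF B.one_closed lm(3)]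
    by (simp add: NM.U_sel(1,2,6) tensor.pure_add_right tensor.N.minus_ac)
  then show ?case using NM.U.F_add[OF lm(2,4)] lm(1,3)
    by (intro bexI[of _ "l \<oplus>\<^bsub>L\<^esub> m"]) auto
qed

text \<open>Only the start in F^1 needs an argument. There u may be replaced by some 1 \<otimes> l,
  whose value is l; then l is horizontal and lies in F^1, so it lies in every F^i and is zero by
  completeness of M.\<close>

lemma ev_reflects_F:
  assumes "u \<in> carrier N" "ev u \<in> U.F i" shows "u \<in> NM.U.F i"
proof (rule h.\<phi>_reflects_F)
  fix u assume u: "u \<in> carrier V" "ev u \<in> U.F (Suc 0)"
  obtain l where l: "l \<in> carrier L" "u \<ominus>\<^bsub>V\<^esub> tensor.pure \<one>\<^bsub>B\<^esub> l \<in> NM.U.F (Suc 0)"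
    using tensor_eq_constant_mod[of u] u(1) by (auto simp: NM.U_sel(1))
  have lU: "l \<in> carrier U" using l(1) by (simp add: horizontal_sel(1) U_sel(1))
  have p: "tensor.pure \<one>\<^bsub>B\<^esub> l \<in> carrier V" using tensor.pure_closed[OF B.one_closed l(1)] by (simp add: NM.U_sel(1))
  have evp: "ev (tensor.pure \<one>\<^bsub>B\<^esub> l) = l" using ev_pure[OF B.one_closed l(1)] lU by simp
  have "ev u \<ominus>\<^bsub>U\<^esub> l \<in> U.F (Suc 0)"
    using h.\<phi>_F[OF l(2)] h.\<phi>_minus[OF u(1) p] evp by simp
  then have l1: "l \<in> U.F (Suc 0)"
    using U.F_cong[OF U.F_sym _ u(2)] h.\<phi>_closed[OF u(1)] lU by blast
  have "l = \<zero>\<^bsub>U\<^esub>"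
    using separated U.horizontal_F[OF l1] l(1) by (simp add: horizontal_sel(1) U_sel(3))
  then have "tensor.pure \<one>\<^bsub>B\<^esub> l = \<zero>\<^bsub>V\<^esub>"
    using tensor.pure_zero_right[of "\<one>\<^bsub>B\<^esub>"] by (simp add: horizontal_sel(3) U_sel(3) NM.U_sel(3))
  then show "u \<in> NM.U.F (Suc 0)"
    using NM.U.F_cong[OF l(2)] u(1) NM.U.F_zero by simp
qed (use assms in \<open>simp_all add: NM.U_sel(1)\<close>)

text \<open>The start modulo F^1 has the witness 1 \<otimes> l, with l a horizontal approximation of
  \<open>m\<close>.\<close>

lemma ev_dense:
  assumes "m \<in> carrier M" shows "\<exists>u\<in>carrier N. ev u \<ominus>\<^bsub>U\<^esub> m \<in> U.F i"
proof -
  have "\<exists>u\<in>carrier V. ev u \<ominus>\<^bsub>U\<^esub> m \<in> U.F i"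
  proof (rule h.\<phi>_dense)
    fix m assume m: "m \<in> carrier U"
    have "\<exists>l\<in>carrier U. (\<forall>j<n. P j \<odot>\<^bsub>M\<^esub> l = \<zero>\<^bsub>U\<^esub>) \<and> l \<ominus>\<^bsub>U\<^esub> m \<in> U.F (Suc 0)"
      by (rule U.horizontal_approximation[OF _ separated U.complete_limit[OF complete] m])
        (simp_all add: U_sel(1) partial_smult_commute)
    then obtain l where l: "l \<in> carrier L" "l \<ominus>\<^bsub>U\<^esub> m \<in> U.F (Suc 0)" "l \<in> carrier U"
      by (auto simp: horizontal_sel(1) U_sel(1,3))
    then show "\<exists>u\<in>carrier V. ev u \<ominus>\<^bsub>U\<^esub> m \<in> U.F (Suc 0)"
      using tensor.pure_closed[OF B.one_closed l(1)] ev_pure[OF B.one_closed l(1)]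
      by (intro bexI[of _ "tensor.pure \<one>\<^bsub>B\<^esub> l"]) (simp_all add: NM.U_sel(1))
  qed (use assms in \<open>simp add: U_sel(1)\<close>)
  then show ?thesis by (simp add: NM.U_sel(1))
qed

section \<open>Values of the canonical homomorphism\<close>

abbreviation C where "C \<equiv> completed_tensor A n (horizontal_module A n M)"
abbreviation can where "can \<equiv> canonical_hom A n M"

lemma C_carrier: "carrier C = carrier (adic_completion B I V)"
  by (simp add: completed_tensor_def diff_completion_def Let_def)

lemma C_mem: "\<lbrakk>x \<in> carrier C; u \<in> x i\<rbrakk> \<Longrightarrow> u \<in> carrier N"
  using NM.U.completion_mem_carrier unfolding C_carrier NM.U_sel(1) .

text \<open>This replaces the inverse of the completion map and the unions of cosets by congruences
  between \<open>m\<close> and values of representatives. It does not presuppose that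
  \<open>x\<close> lies in the completion, so it applies to sums and to images under operators as
  they are defined.\<close>

lemma canonical_hom_eqI:
  assumes m: "m \<in> carrier M" and ne: "\<And>i. x i \<noteq> {}"
    and x: "\<And>i u. u \<in> x i \<Longrightarrow> u \<in> carrier N \<and> m \<ominus>\<^bsub>U\<^esub> ev u \<in> U.F i"
  shows "can x = m"
proof -
  have mU: "m \<in> carrier U" using m by (simp add: U_sel(1))
  have "completion_map B I U ev x = to_completion B I U m"
  proof
    fix i
    have "U.F i +>\<^bsub>U\<^esub> ev u = U.F i +>\<^bsub>U\<^esub> m" if "u \<in> x i" for u
      using x[OF that] ev_closed[of u] mU U.F_sym by (simp add: U.coset_eq_iff)
    then show "completion_map B I U ev x i = to_completion B I U m i"
      using ne[of i] by (auto simp: completion_map_def to_completion_def)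
  qed
  moreover have "inj_on (to_completion B I U) (carrier U)"
    using complete by (auto simp: adically_complete_def lmodule_iso_def bij_betw_def)
  ultimately show ?thesis using mU by (simp add: canonical_hom_def Let_def inv_into_f_f)
qed

text \<open>Any choice of representatives \<open>u i\<close> in \<open>x i\<close> maps to a Cauchy
  sequence in M, because the cosets decrease and \<open>ev\<close> respects the filtrations. Its
  limit meets the criterion of \<open>canonical_hom_eqI\<close> for all other representatives as
  well.\<close>

lemma canonical_hom_char:
  assumes x: "x \<in> carrier C"
  shows "can x \<in> carrier M" "u \<in> x i \<Longrightarrow> can x \<ominus>\<^bsub>U\<^esub> ev u \<in> U.F i"
proof -
  have xC: "x \<in> carrier (adic_completion B I V)" using x unfolding C_carrier .
  have "\<exists>u. u \<in> x i" for i using NM.U.completion_nonempty[OF xC] by blast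
  then obtain u where u: "\<And>i. u i \<in> x i" by metis
  have uV: "u i \<in> carrier V" for i using NM.U.completion_mem_carrier[OF xC u] .
  have d: "ev v \<ominus>\<^bsub>U\<^esub> ev w \<in> U.F i" if "v \<in> x i" "w \<in> x i" for v w i
    using h.\<phi>_F[OF NM.U.completion_mem_diff[OF xC that]]
      NM.U.completion_mem_carrier[OF xC that(1)] NM.U.completion_mem_carrier[OF xC that(2)]
    by (simp add: h.\<phi>_minus)
  have "\<exists>m\<in>carrier U. \<forall>k. m \<ominus>\<^bsub>U\<^esub> ev (u k) \<in> U.F k"
    by (rule U.complete_limit[OF complete])
      (use h.\<phi>_closed[OF uV] d[OF NM.U.completion_mem_Suc[OF xC u] u] in auto)
  then obtain m where m: "m \<in> carrier U" "\<And>k. m \<ominus>\<^bsub>U\<^esub> ev (u k) \<in> U.F k" by blast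
  have mv: "m \<ominus>\<^bsub>U\<^esub> ev v \<in> U.F i" if "v \<in> x i" for v i
    using U.F_trans[OF m(2) d[OF u that]] m(1) h.\<phi>_closed[OF uV]
      h.\<phi>_closed[OF NM.U.completion_mem_carrier[OF xC that]] by blast
  have "can x = m"
  proof (rule canonical_hom_eqI)
    show "x i \<noteq> {}" for i using u[of i] by blast
  qed (use m(1) mv C_mem[OF x] in \<open>auto simp: U_sel(1)\<close>)
  then show "can x \<in> carrier M" "u' \<in> x i \<Longrightarrow> can x \<ominus>\<^bsub>U\<^esub> ev u' \<in> U.F i" for u'
    using m(1) mv by (simp_all add: U_sel(1))
qed

lemma canonical_hom_add:
  assumes x: "x \<in> carrier C" and y: "y \<in> carrier C"
  shows "can (x \<oplus>\<^bsub>C\<^esub> y) = can x \<oplus>\<^bsub>M\<^esub> can y"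
proof (rule canonical_hom_eqI)
  note cx = canonical_hom_char[OF x] and cy = canonical_hom_char[OF y]
  have add: "(x \<oplus>\<^bsub>C\<^esub> y) i = x i <+>\<^bsub>V\<^esub> y i" for i
    by (simp add: completed_tensor_def diff_completion_def Let_def adic_completion_def quotient_module_def)
  show "can x \<oplus>\<^bsub>M\<^esub> can y \<in> carrier M" using cx(1) cy(1) by simp
  show "(x \<oplus>\<^bsub>C\<^esub> y) i \<noteq> {}" for i
  proof -
    obtain u v where "u \<in> x i" "v \<in> y i"
      using NM.U.completion_nonempty x y unfolding C_carrier by blast
    then have "u \<oplus>\<^bsub>V\<^esub> v \<in> (x \<oplus>\<^bsub>C\<^esub> y) i" unfolding add NM.U.set_add_iff by blast
    then show ?thesis by blast
  qed
  fix i w assume "w \<in> (x \<oplus>\<^bsub>C\<^esub> y) i"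
  then obtain u v where w: "u \<in> x i" "v \<in> y i" "w = u \<oplus>\<^bsub>N\<^esub> v"
    unfolding add NM.U.set_add_iff by (auto simp: NM.U_sel(2))
  have uv: "u \<in> carrier N" "v \<in> carrier N" using C_mem x y w by auto
  have "can x \<oplus>\<^bsub>M\<^esub> can y \<ominus>\<^bsub>U\<^esub> ev w = (can x \<ominus>\<^bsub>U\<^esub> ev u) \<oplus>\<^bsub>U\<^esub> (can y \<ominus>\<^bsub>U\<^esub> ev v)"
    using uv w(3) cx(1) cy(1) ev_closed[of u] ev_closed[of v] by (simp add: ev_add U_sel DM.M.minus_ac)
  then show "w \<in> carrier N \<and> can x \<oplus>\<^bsub>M\<^esub> can y \<ominus>\<^bsub>U\<^esub> ev w \<in> U.F i"
    using U.F_add[OF cx(2)[OF w(1)] cy(2)[OF w(2)]] uv w(3) by simp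
qed

text \<open>Stage i of \<theta> x is made from representatives u in stage i + k of x, with k the
  order of \<theta>. There \<open>can x\<close> and \<open>ev u\<close> agree modulo F^(i+k), and
  \<theta> loses at most k by \<open>diff_ops_smult_F\<close>.\<close>

lemma canonical_hom_smult:
  assumes th: "\<theta> \<in> carrier D" and x: "x \<in> carrier C"
  shows "can (\<theta> \<odot>\<^bsub>C\<^esub> x) = \<theta> \<odot>\<^bsub>M\<^esub> can x"
proof (rule canonical_hom_eqI)
  note cx = canonical_hom_char[OF x]
  let ?k = "diff_order A B \<theta>"
  have k: "\<theta> \<in> diff_ops A B ?k" using th unfolding D_carrier diff_order_def by (elim UN_E) (rule LeastI)
  have smult: "(\<theta> \<odot>\<^bsub>C\<^esub> x) i = (\<Union>u\<in>x (i + ?k). NM.U.F i +>\<^bsub>N\<^esub> (\<theta> \<odot>\<^bsub>N\<^esub> u))" for i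
    by (simp add: completed_tensor_def diff_completion_def Let_def)
  show "\<theta> \<odot>\<^bsub>M\<^esub> can x \<in> carrier M" using th cx(1) by (rule DM.smult_closed)
  show "(\<theta> \<odot>\<^bsub>C\<^esub> x) i \<noteq> {}" for i
  proof -
    obtain u where "u \<in> x (i + ?k)" using NM.U.completion_nonempty x unfolding C_carrier by blast
    then show ?thesis using NM.U.F_zero[of i] unfolding smult a_r_coset_def' by blast
  qed
  fix i w assume "w \<in> (\<theta> \<odot>\<^bsub>C\<^esub> x) i"
  then obtain u z where w: "u \<in> x (i + ?k)" "z \<in> NM.U.F i" "w = z \<oplus>\<^bsub>N\<^esub> \<theta> \<odot>\<^bsub>N\<^esub> u"
    unfolding smult a_r_coset_def' by blast
  have u: "u \<in> carrier N" "z \<in> carrier N" using C_mem[OF x w(1)] NM.U.F_carrier[OF w(2)] by (simp_all add: NM.U_sel(1))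
  have tu: "\<theta> \<odot>\<^bsub>N\<^esub> u \<in> carrier N" using th u(1) by (rule NM.DM.smult_closed)
  have c: "ev u \<in> carrier M" "ev z \<in> carrier M" using ev_closed u by (simp_all add: U_sel(1))
  have 1: "\<theta> \<odot>\<^bsub>M\<^esub> (can x \<ominus>\<^bsub>U\<^esub> ev u) \<in> U.F i" by (rule diff_ops_smult_F[OF k cx(2)[OF w(1)]])
  have "\<theta> \<odot>\<^bsub>M\<^esub> can x \<ominus>\<^bsub>U\<^esub> ev w = \<theta> \<odot>\<^bsub>M\<^esub> (can x \<ominus>\<^bsub>U\<^esub> ev u) \<ominus>\<^bsub>U\<^esub> ev z"
    using c cx(1) th u tu w(3) DM.smult_closed[OF th cx(1)] DM.smult_closed[OF th c(1)]
    unfolding U_sel(6) D_smult_minus[OF th cx(1) c(1)]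
    by (simp add: ev_add ev_smult U_sel(2) DM.M.minus_ac)
  then show "w \<in> carrier N \<and> \<theta> \<odot>\<^bsub>M\<^esub> can x \<ominus>\<^bsub>U\<^esub> ev w \<in> U.F i"
    using U.F_minus[OF 1 h.\<phi>_F[OF w(2)]] u tu w(3) by simp
qed

text \<open>Representatives of stage i have values that differ by an element of F^i, and
  \<open>ev_reflects_F\<close> turns this into equality of the cosets.\<close>

lemma canonical_hom_inj: "inj_on can (carrier C)"
proof (intro inj_onI ext)
  fix x y i assume x: "x \<in> carrier C" and y: "y \<in> carrier C" and eq: "can x = can y"
  have xC: "x \<in> carrier (adic_completion B I V)" "y \<in> carrier (adic_completion B I V)"
    using x y unfolding C_carrier .
  obtain u v where uv: "u \<in> x i" "v \<in> y i"
    using NM.U.completion_nonempty[OF xC(1)] NM.U.completion_nonempty[OF xC(2)] by blast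
  have c: "u \<in> carrier N" "v \<in> carrier N" using C_mem x y uv by auto
  have cm: "can x \<in> carrier U" using canonical_hom_char(1)[OF x] by (simp add: U_sel(1))
  have "ev u \<ominus>\<^bsub>U\<^esub> ev v \<in> U.F i"
    using U.F_trans[OF U.F_sym[OF canonical_hom_char(2)[OF x uv(1)]]] canonical_hom_char(2)[OF y uv(2)]
      eq cm ev_closed[OF c(1)] ev_closed[OF c(2)] by simp
  then have "ev (u \<ominus>\<^bsub>V\<^esub> v) \<in> U.F i" using c by (simp add: h.\<phi>_minus NM.U_sel(1))
  then have "u \<ominus>\<^bsub>V\<^esub> v \<in> NM.U.F i" using ev_reflects_F[of "u \<ominus>\<^bsub>V\<^esub> v"] c by (simp add: NM.U_sel(6))
  then show "x i = y i"
    using NM.U.completion_eq_coset[OF xC(1) uv(1)] NM.U.completion_eq_coset[OF xC(2) uv(2)] c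
    by (simp add: NM.U.coset_eq_iff NM.U_sel(1))
qed

text \<open>The approximations of \<open>m\<close> from \<open>ev_dense\<close> are chosen
  independently of one another. Only their values are close to each other by construction;
  \<open>ev_reflects_F\<close> carries this back, so that their cosets form an element of the
  completion.\<close>

lemma canonical_hom_surj:
  assumes m: "m \<in> carrier M" shows "\<exists>x\<in>carrier C. can x = m"
proof -
  have "\<exists>u. u \<in> carrier N \<and> ev u \<ominus>\<^bsub>U\<^esub> m \<in> U.F i" for i using ev_dense[OF m] by blast
  then obtain u where u: "\<And>i. u i \<in> carrier N" "\<And>i. ev (u i) \<ominus>\<^bsub>U\<^esub> m \<in> U.F i" by metis
  have mU: "m \<in> carrier U" using m by (simp add: U_sel(1))
  have uV: "u i \<in> carrier V" for i using u(1) by (simp add: NM.U_sel(1))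
  define x where "x = (\<lambda>i. NM.U.F i +>\<^bsub>V\<^esub> u i)"
  have "u (Suc k) \<ominus>\<^bsub>V\<^esub> u k \<in> NM.U.F k" for k
  proof (rule ev_reflects_F)
    show "u (Suc k) \<ominus>\<^bsub>V\<^esub> u k \<in> carrier N" using u(1) by (simp add: NM.U_sel(6))
    have "ev (u (Suc k)) \<ominus>\<^bsub>U\<^esub> m \<in> U.F k" using u(2)[of "Suc k"] U.F_Suc_subset by blast
    then show "ev (u (Suc k) \<ominus>\<^bsub>V\<^esub> u k) \<in> U.F k"
      using U.F_trans[OF _ U.F_sym[OF u(2)[of k]]] h.\<phi>_closed[OF uV] mU uV by (simp add: h.\<phi>_minus)
  qed
  then have x: "x \<in> carrier C" unfolding C_carrier x_def using uV by (intro NM.U.completionI)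
  have "can x = m"
  proof (rule canonical_hom_eqI[OF m])
    show "x i \<noteq> {}" for i using NM.U.coset_self[OF uV] unfolding x_def by blast
    fix i v assume v: "v \<in> x i"
    then have v': "v \<in> carrier V" "v \<ominus>\<^bsub>V\<^esub> u i \<in> NM.U.F i" using uV by (simp_all add: x_def NM.U.coset_iff)
    have "ev v \<ominus>\<^bsub>U\<^esub> ev (u i) \<in> U.F i" using h.\<phi>_F[OF v'(2)] h.\<phi>_minus[OF v'(1) uV] by simp
    then have "ev v \<ominus>\<^bsub>U\<^esub> m \<in> U.F i"
      using U.F_trans[OF _ u(2)] h.\<phi>_closed[OF uV] h.\<phi>_closed[OF v'(1)] mU by blast
    then show "v \<in> carrier N \<and> m \<ominus>\<^bsub>U\<^esub> ev v \<in> U.F i"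
      using U.F_sym h.\<phi>_closed[OF v'(1)] mU v'(1) by (simp add: NM.U_sel(1))
  qed
  with x show ?thesis by blast
qed

lemma canonical_hom_bijective:
  "can \<in> lmodule_hom D C M \<and> bij_betw can (carrier C) (carrier M)"
  unfolding lmodule_hom_def bij_betw_def
  using canonical_hom_char(1) canonical_hom_add canonical_hom_smult canonical_hom_inj canonical_hom_surj
  by (auto simp: image_iff) metis

end

theorem theorem0p6:
  fixes A :: "('a, 'x) ring_scheme"
    and n :: nat
    and M :: "(((nat \<Rightarrow> nat) \<Rightarrow> 'a) \<Rightarrow> ((nat \<Rightarrow> nat) \<Rightarrow> 'a), 'm, 'z) module_scheme"
  assumes "cring A"
    and "contains_rationals A"
    and "left_module (diff_op_ring A (power_series A n)) M"
    and "adically_complete (power_series A n) (variable_ideal A n)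
           (underlying_module (power_series A n) M)"
  shows "canonical_hom A n M \<in>
           lmodule_hom (diff_op_ring A (power_series A n))
             (completed_tensor A n (horizontal_module A n M)) M \<and>
         bij_betw (canonical_hom A n M)
           (carrier (completed_tensor A n (horizontal_module A n M))) (carrier M)"
proof -
  interpret complete_diff_module A n M
    by (intro complete_diff_module.intro diff_module.intro diff_module_axioms.intro
        complete_diff_module_axioms.intro power_series_ring.intro assms)
  show ?thesis by (rule canonical_hom_bijective)
qed

end
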